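(* Let $\mathfrak{g}=\mathfrak{sl}(n,\mathbb{C})$ with a Chevalley basis, let $\phi:\mathfrak{g}\to\mathfrak{gl}(V)$ be the irreducible representation with highest weight $\lambda$, let $\mu_1,\dots,\mu_s$ be the distinct dominant weights of $V$, and let $k_i=|O_{\mu_i}|$ be the size of the orbit of $\mu_i$ under the Weyl group $\mathscr{W}$. Then $$f_\phi(z_0,L)=(f_{\mu_1})^{m_\lambda(\mu_1)}\cdots(f_{\mu_s})^{m_\lambda(\mu_s)},$$ with each $f_{\mu_i}$ irreducible of degree $k_i$.
   Context: $f_\phi(z_0,L)=\det(z_0I+\phi(L))$, viewed as a polynomial in $z_0$ and the coordinates of $L$ with respect to the Chevalley basis. $m_\lambda(\mu)$ is the dimension of the $\mu$-weight space of $V$. $\mathfrak{h}$ is the diagonal Cartan subalgebra, $\mathscr{W}\cong\mathfrak{S}_n$ acts on $\mathfrak{h}^*$, $O_\mu=\mathscr{W}\mu$. Orbital factor: for diagonalizable $L$ with eigenvalues $\theta_1,\dots,\theta_n$, $f_\mu(z_0,L)=\prod_{\nu\in O_\mu}(z_0+\nu(\mathrm{diag}(\theta_1,\dots,\theta_n)))$; this is well defined and extends uniquely to a polynomial function on $\mathbb{C}\times\mathfrak{g}$. Irreducibility is over $\mathbb{C}$ in the polynomial ring in $z_0$ and the coordinates of $L$. *)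

theory Defs
  imports "HOL-Analysis.Analysis" "HOL-Library.Poly_Mapping" "HOL-Computational_Algebra.Factorial_Ring"
begin

definition sl :: "(complex^'n^'n) set" where
  "sl = {A. (\<Sum>i\<in>UNIV. A$i$i) = 0}"

definition cscale :: "complex \<Rightarrow> complex^'n^'m \<Rightarrow> complex^'n^'m" where
  "cscale c A = (\<chi> i j. c * A$i$j)"

definition bracket :: "complex^'n^'n \<Rightarrow> complex^'n^'n \<Rightarrow> complex^'n^'n" where
  "bracket A B = A ** B - B ** A"

definition Emat :: "'n \<Rightarrow> 'n \<Rightarrow> complex^'n^'n" where
  "Emat i j = (\<chi> k l. if k = i \<and> l = j then 1 else 0)"

definition diagm :: "complex^'n \<Rightarrow> complex^'n^'n" where
  "diagm \<theta> = (\<chi> k l. if k = l then \<theta>$k else 0)"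

definition is_rep :: "(complex^'n^'n \<Rightarrow> complex^'d^'d) \<Rightarrow> bool" where
  "is_rep \<phi> \<longleftrightarrow>
     (\<forall>c A B. A \<in> sl \<and> B \<in> sl \<longrightarrow> \<phi> (cscale c A + B) = cscale c (\<phi> A) + \<phi> B) \<and>
     (\<forall>A B. A \<in> sl \<and> B \<in> sl \<longrightarrow> \<phi> (bracket A B) = bracket (\<phi> A) (\<phi> B))"

definition csubspace :: "(complex^'d) set \<Rightarrow> bool" where
  "csubspace W \<longleftrightarrow> 0 \<in> W \<and> (\<forall>x\<in>W. \<forall>y\<in>W. x + y \<in> W) \<and> (\<forall>c. \<forall>x\<in>W. c *s x \<in> W)"

definition irreducible_rep :: "(complex^'n^'n \<Rightarrow> complex^'d^'d) \<Rightarrow> bool" where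
  "irreducible_rep \<phi> \<longleftrightarrow> is_rep \<phi> \<and>
     (\<forall>W. csubspace W \<and> (\<forall>A\<in>sl. \<forall>v\<in>W. \<phi> A *v v \<in> W) \<longrightarrow> W = {0} \<or> W = UNIV)"

definition cdim :: "(complex^'d) set \<Rightarrow> nat" where
  "cdim W = vector_space.dim (\<lambda>c (v::complex^'d). c *s v) W"

text \<open>A linear functional mu on the diagonal Cartan subalgebra h is represented by the
  unique vector w with sum 0 such that mu(diag theta) = sum_i w_i theta_i for all theta with sum 0.\<close>

definition pair :: "complex^'n \<Rightarrow> complex^'n \<Rightarrow> complex" where
  "pair w \<theta> = (\<Sum>i\<in>UNIV. w$i * \<theta>$i)"

definition weight_space :: "(complex^'n^'n \<Rightarrow> complex^'d^'d) \<Rightarrow> complex^'n \<Rightarrow> (complex^'d) set" where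
  "weight_space \<phi> w = {v. \<forall>\<theta>. (\<Sum>i\<in>UNIV. \<theta>$i) = 0 \<longrightarrow> \<phi> (diagm \<theta>) *v v = pair w \<theta> *s v}"

definition wmult :: "(complex^'n^'n \<Rightarrow> complex^'d^'d) \<Rightarrow> complex^'n \<Rightarrow> nat" where
  "wmult \<phi> w = cdim (weight_space \<phi> w)"

definition weights :: "(complex^'n^'n \<Rightarrow> complex^('d::finite)^'d) \<Rightarrow> (complex^'n) set" where
  "weights \<phi> = {w. (\<Sum>i\<in>UNIV. w$i) = 0 \<and> weight_space \<phi> w \<noteq> {0}}"

text \<open>Dominant: <w, alpha_i> is a nonnegative integer for every simple root
  alpha_i = e_i - e_(i+1) (consecutive indices).\<close>
definition dominant :: "complex^('n::{finite,linorder}) \<Rightarrow> bool" where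
  "dominant w \<longleftrightarrow> (\<forall>i j. i < j \<and> \<not>(\<exists>k. i < k \<and> k < j) \<longrightarrow> w$i - w$j \<in> \<nat>)"

definition dominant_weights :: "(complex^('n::{finite,linorder})^('n::{finite,linorder}) \<Rightarrow> complex^'d^'d) \<Rightarrow> (complex^('n::{finite,linorder})) set" where
  "dominant_weights \<phi> = {w \<in> weights \<phi>. dominant w}"

definition has_highest_weight :: "(complex^('n::{finite,linorder})^('n::{finite,linorder}) \<Rightarrow> complex^'d^'d) \<Rightarrow> complex^('n::{finite,linorder}) \<Rightarrow> bool" where
  "has_highest_weight \<phi> lam \<longleftrightarrow> (\<Sum>i\<in>UNIV. lam$i) = 0 \<and>
     (\<exists>v. v \<noteq> 0 \<and> v \<in> weight_space \<phi> lam \<and> (\<forall>i j. i < j \<longrightarrow> \<phi> (Emat i j) *v v = 0))"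

definition orbit :: "complex^'n \<Rightarrow> (complex^'n) set" where
  "orbit w = {(\<chi> i. w $ \<sigma> i) | \<sigma>. \<sigma> permutes (UNIV::'n set)}"

datatype 'n var = Z0 | Ecoord 'n 'n | Hcoord 'n

text \<open>Chevalley basis of sl_n: E_ij (i \<noteq> j) and H_i = E_ii - E_(i+1)(i+1) for i not maximal.
  Valid variables: z_0, the E_ij with i \<noteq> j, and H_i with i not the maximum.\<close>
definition valid_vars :: "(('n::{finite,linorder})) var set" where
  "valid_vars = {Z0} \<union> {Ecoord i j |i j. i \<noteq> j} \<union> {Hcoord i |i. i \<noteq> Max UNIV}"

text \<open>Coordinates of L in the Chevalley basis: coefficient of E_ij is L_ij; the coefficient of
  H_i is L_11 + ... + L_ii.\<close>
definition assign :: "complex \<Rightarrow> complex^('n::{finite,linorder})^('n::{finite,linorder}) \<Rightarrow> ('n::{finite,linorder}) var \<Rightarrow> complex" where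
  "assign z0 L x = (case x of Z0 \<Rightarrow> z0 | Ecoord i j \<Rightarrow> (if i \<noteq> j then L$i$j else 0)
                      | Hcoord i \<Rightarrow> (\<Sum>k\<in>{..i}. L$k$k))"

type_synonym 'v mpoly = "('v \<Rightarrow>\<^sub>0 nat) \<Rightarrow>\<^sub>0 complex"

definition peval :: "'v mpoly \<Rightarrow> ('v \<Rightarrow> complex) \<Rightarrow> complex" where
  "peval p a = (\<Sum>mon\<in>Poly_Mapping.keys p. Poly_Mapping.lookup p mon * (\<Prod>y\<in>Poly_Mapping.keys mon. (a y) ^ (Poly_Mapping.lookup mon y)))"

definition pvars :: "'v mpoly \<Rightarrow> 'v set" where
  "pvars p = (\<Union>mon\<in>Poly_Mapping.keys p. Poly_Mapping.keys mon)"

definition total_degree :: "'v mpoly \<Rightarrow> nat" where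
  "total_degree p = Max (insert 0 ((\<lambda>mon. \<Sum>y\<in>Poly_Mapping.keys mon. Poly_Mapping.lookup mon y) ` Poly_Mapping.keys p))"

definition f_phi :: "(complex^('n::{finite,linorder})^('n::{finite,linorder}) \<Rightarrow> complex^'d^'d) \<Rightarrow> ('n::{finite,linorder}) var mpoly" where
  "f_phi \<phi> = (THE P. pvars P \<subseteq> valid_vars \<and>
      (\<forall>z0 L. L \<in> sl \<longrightarrow> peval P (assign z0 L) = det (mat z0 + \<phi> L)))"

definition diagonalizable :: "complex^'n^'n \<Rightarrow> complex^'n \<Rightarrow> bool" where
  "diagonalizable L \<theta> \<longleftrightarrow> (\<exists>P. invertible P \<and> L = P ** diagm \<theta> ** matrix_inv P)"

definition orbital_factor :: "complex^('n::{finite,linorder}) \<Rightarrow> ('n::{finite,linorder}) var mpoly" where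
  "orbital_factor w = (THE P. pvars P \<subseteq> valid_vars \<and>
      (\<forall>z0 L \<theta>. L \<in> sl \<and> diagonalizable L \<theta> \<longrightarrow>
          peval P (assign z0 L) = (\<Prod>\<nu>\<in>orbit w. z0 + pair \<nu> \<theta>)))"

end

theory Submission
  imports Defs "HOL-Computational_Algebra.Fundamental_Theorem_Algebra"
begin

text \<open>
  A polynomial in \<open>z\<^sub>0\<close> and the Chevalley coordinates is determined by its values on diagonalizable
  matrices, since a line through a diagonal matrix with distinct entries stays diagonalizable near it.
  The orbital factor exists because symmetrized monomials in the eigenvalues are polynomials in the
  power sums \<open>tr L\<^sup>k\<close>.

  Irreducibility: if \<open>f\<^sub>\<mu> = Q R\<close>, then \<open>Q R\<close> vanishes at
  \<open>(- \<mu>(\<theta>), g diag(\<theta>) g\<^sup>-\<^sup>1)\<close> for all \<open>g\<close> and \<open>\<theta>\<close>. The parameter space is irreducible, so one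
  factor, say \<open>Q\<close>, vanishes there identically. Taking permutation matrices for \<open>g\<close> shows that
  \<open>Q(z\<^sub>0, diag(\<theta>))\<close> vanishes at all \<open>-\<nu>(\<theta>)\<close> with \<open>\<nu>\<close> in the orbit, hence \<open>Q\<close> has full degree and \<open>R\<close>
  is constant.

  Factorization: \<open>det(z\<^sub>0 + \<phi>(L))\<close> is invariant under conjugation of \<open>L\<close>, because its derivative along
  \<open>L' = [X, L]\<close> is zero. So it suffices to take \<open>L = diag(\<theta>)\<close>, where it is the product of
  \<open>z\<^sub>0 + \<nu>(\<theta>)\<close> over the weights with multiplicity. The invariance also makes multiplicities constant on
  Weyl orbits. All weights differ from \<open>\<lambda>\<close> by integer vectors, so reflecting \<open>\<lambda>\<close> shows that they are
  integral, and each orbit contains exactly one dominant weight.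
\<close>

section \<open>Evaluating multivariate polynomials\<close>

text \<open>\<open>f_phi\<close> and \<open>orbital_factor\<close> are chosen by \<open>THE\<close>,
  so each needs a polynomial with the prescribed values as well as a uniqueness argument. Existence
  is carried by the predicate \<open>realizable\<close>. Zariski topology is replaced by restriction
  to real lines: there a polynomial function is a univariate polynomial in a real parameter, and it
  is zero once it has infinitely many zeros. This single fact yields density, irreducibility of the
  parameter space and generic points. Inverses are not polynomial, so wherever a conjugating matrix
  moves along a line, the adjugate and powers of the determinant take their place. A Lie algebra
  representation comes without a group action, so there is no image of \<open>g\<close> with which
  to conjugate the image of \<open>L\<close>; hence the detour through a derivative. The resulting
  invariance stands in for the usual sl(2) argument for Weyl symmetry: permutation matrices permute
  a diagonal matrix, and for a generic one the eigenvalues identify the weights.\<close>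

definition mono_eval :: "('v \<Rightarrow>\<^sub>0 nat) \<Rightarrow> ('v \<Rightarrow> complex) \<Rightarrow> complex" where
  "mono_eval m a = (\<Prod>y\<in>Poly_Mapping.keys m. a y ^ Poly_Mapping.lookup m y)"

lemma mono_eval_superset:
  assumes "finite S" "Poly_Mapping.keys m \<subseteq> S"
  shows "mono_eval m a = (\<Prod>y\<in>S. a y ^ Poly_Mapping.lookup m y)"
  unfolding mono_eval_def
  by (rule prod.mono_neutral_left) (use assms in \<open>auto simp: in_keys_iff\<close>)

lemma mono_eval_0 [simp]: "mono_eval 0 a = 1"
  by (simp add: mono_eval_def)

lemma mono_eval_add: "mono_eval (m + n) a = mono_eval m a * mono_eval n a"
proof -
  let ?S = "Poly_Mapping.keys m \<union> Poly_Mapping.keys n"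
  have "mono_eval (m + n) a = (\<Prod>y\<in>?S. a y ^ Poly_Mapping.lookup (m + n) y)"
    by (rule mono_eval_superset) (simp_all add: Poly_Mapping.keys_add)
  also have "\<dots> = (\<Prod>y\<in>?S. a y ^ Poly_Mapping.lookup m y) * (\<Prod>y\<in>?S. a y ^ Poly_Mapping.lookup n y)"
    by (simp add: lookup_add power_add prod.distrib)
  also have "\<dots> = mono_eval m a * mono_eval n a"
    by (simp add: mono_eval_superset[of ?S])
  finally show ?thesis .
qed

lemma mono_eval_single: "mono_eval (Poly_Mapping.single x k) a = a x ^ k"
  by (simp add: mono_eval_def)

lemma peval_superset:
  assumes "finite S" "Poly_Mapping.keys p \<subseteq> S"
  shows "peval p a = (\<Sum>m\<in>S. Poly_Mapping.lookup p m * mono_eval m a)"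
  unfolding peval_def mono_eval_def[symmetric]
  by (rule sum.mono_neutral_left) (use assms in \<open>auto simp: in_keys_iff\<close>)

lemma peval_altdef: "peval p a = (\<Sum>m\<in>Poly_Mapping.keys p. Poly_Mapping.lookup p m * mono_eval m a)"
  by (rule peval_superset) auto

lemma peval_0 [simp]: "peval 0 a = 0"
  by (simp add: peval_def)

lemma peval_single: "peval (Poly_Mapping.single m c) a = c * mono_eval m a"
  by (simp add: peval_altdef)

lemma peval_1 [simp]: "peval 1 a = 1"
  using peval_single[of 0 1 a] by simp

lemma peval_add: "peval (p + q) a = peval p a + peval q a"
proof -
  let ?S = "Poly_Mapping.keys p \<union> Poly_Mapping.keys q"
  have "peval (p + q) a = (\<Sum>m\<in>?S. Poly_Mapping.lookup (p + q) m * mono_eval m a)"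
    by (rule peval_superset) (simp_all add: Poly_Mapping.keys_add)
  also have "\<dots> = peval p a + peval q a"
    by (simp add: peval_superset[of ?S] lookup_add algebra_simps sum.distrib)
  finally show ?thesis .
qed

lemma peval_diff: "peval (p - q) a = peval p a - peval q a"
  using peval_add[of "p - q" q a] by simp

lemma peval_sum: "peval (sum f I) a = (\<Sum>i\<in>I. peval (f i) a)"
  by (induction I rule: infinite_finite_induct) (simp_all add: peval_add)

lemma sum_single_lookup: "(\<Sum>m\<in>Poly_Mapping.keys p. Poly_Mapping.single m (Poly_Mapping.lookup p m)) = p"
proof (rule poly_mapping_eqI)
  fix k
  show "Poly_Mapping.lookup (\<Sum>m\<in>Poly_Mapping.keys p. Poly_Mapping.single m (Poly_Mapping.lookup p m)) k
      = Poly_Mapping.lookup p k"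
    by (simp add: lookup_sum lookup_single when_def in_keys_iff)
qed

lemma peval_mult: "peval (p * q) a = peval p a * peval q a"
proof -
  have "peval (p * q) a = peval ((\<Sum>m\<in>Poly_Mapping.keys p. Poly_Mapping.single m (Poly_Mapping.lookup p m)) *
      (\<Sum>m\<in>Poly_Mapping.keys q. Poly_Mapping.single m (Poly_Mapping.lookup q m))) a"
    by (simp only: sum_single_lookup)
  also have "\<dots> = peval p a * peval q a"
    unfolding sum_product peval_sum peval_altdef[of p] peval_altdef[of q]
    by (simp add: mult_single peval_single mono_eval_add mult_ac)
  finally show ?thesis .
qed

lemma peval_power: "peval (p ^ k) a = peval p a ^ k"
  by (induction k) (simp_all add: peval_mult)

lemma peval_prod: "peval (prod f I) a = (\<Prod>i\<in>I. peval (f i) a)"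
  by (induction I rule: infinite_finite_induct) (simp_all add: peval_mult)

lemma peval_cong:
  assumes "\<And>v. v \<in> pvars p \<Longrightarrow> a v = b v"
  shows "peval p a = peval p b"
  unfolding peval_def
proof (rule sum.cong[OF refl])
  fix m assume m: "m \<in> Poly_Mapping.keys p"
  have "(\<Prod>y\<in>Poly_Mapping.keys m. a y ^ Poly_Mapping.lookup m y) =
      (\<Prod>y\<in>Poly_Mapping.keys m. b y ^ Poly_Mapping.lookup m y)"
    by (rule prod.cong[OF refl]) (use assms m in \<open>force simp: pvars_def\<close>)
  then show "Poly_Mapping.lookup p m * (\<Prod>y\<in>Poly_Mapping.keys m. a y ^ Poly_Mapping.lookup m y) =
      Poly_Mapping.lookup p m * (\<Prod>y\<in>Poly_Mapping.keys m. b y ^ Poly_Mapping.lookup m y)" by simp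
qed

lemma pvars_0 [simp]: "pvars 0 = {}"
  by (simp add: pvars_def)

lemma pvars_single: "pvars (Poly_Mapping.single m c) \<subseteq> Poly_Mapping.keys m"
  by (auto simp: pvars_def)

lemma pvars_1 [simp]: "pvars 1 = {}"
  using pvars_single[of 0 1] by simp

lemma pvars_add: "pvars (p + q) \<subseteq> pvars p \<union> pvars q"
  using Poly_Mapping.keys_add[of p q] by (auto simp: pvars_def)

lemma pvars_diff: "pvars (p - q) \<subseteq> pvars p \<union> pvars q"
proof
  fix x assume "x \<in> pvars (p - q)"
  then obtain m where m: "Poly_Mapping.lookup p m - Poly_Mapping.lookup q m \<noteq> 0" "x \<in> Poly_Mapping.keys m"
    by (auto simp: pvars_def in_keys_iff[of _ "p - q"] lookup_minus)
  then have "m \<in> Poly_Mapping.keys p \<or> m \<in> Poly_Mapping.keys q" by (auto simp: in_keys_iff)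
  with m(2) show "x \<in> pvars p \<union> pvars q" by (auto simp: pvars_def)
qed

lemma pvars_mult: "pvars (p * q) \<subseteq> pvars p \<union> pvars q"
proof
  fix x assume "x \<in> pvars (p * q)"
  then obtain m where m: "m \<in> Poly_Mapping.keys (p * q)" "x \<in> Poly_Mapping.keys m"
    by (auto simp: pvars_def)
  then obtain m1 m2 where "m = m1 + m2" "m1 \<in> Poly_Mapping.keys p" "m2 \<in> Poly_Mapping.keys q"
    using Poly_Mapping.keys_mult[of p q] by auto
  then show "x \<in> pvars p \<union> pvars q"
    using m(2) Poly_Mapping.keys_add[of m1 m2] by (auto simp: pvars_def)
qed

lemma pvars_power: "pvars (p ^ k) \<subseteq> pvars p"
proof (induction k)
  case (Suc k)
  then show ?case using pvars_mult[of p "p ^ k"] by auto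
qed simp

lemma pvars_prod:
  assumes "\<And>i. i \<in> I \<Longrightarrow> pvars (f i) \<subseteq> V"
  shows "pvars (prod f I) \<subseteq> V"
  using assms
proof (induction I rule: infinite_finite_induct)
  case (insert i I)
  then show ?case using pvars_mult[of "f i" "prod f I"] by auto
qed simp_all

lemma power_sums_vanish:
  fixes c :: "('v \<Rightarrow> nat) \<Rightarrow> complex"
  assumes "finite V" "finite K" "inj_on (\<lambda>m. restrict m V) K"
    and "\<And>a. (\<Sum>m\<in>K. c m * (\<Prod>v\<in>V. a v ^ m v)) = 0" and "m \<in> K"
  shows "c m = 0"
  using assms
proof (induction V arbitrary: K m rule: finite_induct)
  case empty
  then have "K = {m}" by (auto simp: inj_on_def)
  then show ?case using empty(3) by simp
next
  case (insert x V)
  \<comment> \<open>The members of \<open>K'\<close> share their exponent of \<open>x\<close>, so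
    they already differ on \<open>V\<close>.\<close>
  define K' where "K' = {k \<in> K. k x = m x}"
  show ?case
  proof (rule insert.IH)
    show "finite K'" "m \<in> K'" using insert.prems by (auto simp: K'_def)
    show "inj_on (\<lambda>m. restrict m V) K'"
    proof (rule inj_onI)
      fix k l assume kl: "k \<in> K'" "l \<in> K'" "restrict k V = restrict l V"
      have "restrict k (insert x V) = restrict l (insert x V)"
      proof
        fix y show "restrict k (insert x V) y = restrict l (insert x V) y"
          using kl(1,2) fun_cong[OF kl(3), of y] by (cases "y \<in> V") (auto simp: K'_def)
      qed
      then show "k = l" using insert.prems(2) kl(1,2) unfolding inj_on_def K'_def by blast
    qed
    fix a
    define p where "p = (\<Sum>k\<in>K. monom (c k * (\<Prod>v\<in>V. a v ^ k v)) (k x))"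
    have "poly p t = 0" for t
    proof -
      have "poly p t = (\<Sum>k\<in>K. c k * (\<Prod>v\<in>insert x V. (a(x := t)) v ^ k v))"
        unfolding p_def poly_sum poly_monom
      proof (rule sum.cong[OF refl])
        fix k
        have "(\<Prod>v\<in>V. (a(x := t)) v ^ k v) = (\<Prod>v\<in>V. a v ^ k v)"
          by (rule prod.cong) (use insert.hyps in auto)
        then show "c k * (\<Prod>v\<in>V. a v ^ k v) * t ^ k x = c k * (\<Prod>v\<in>insert x V. (a(x := t)) v ^ k v)"
          using insert.hyps by simp
      qed
      then show ?thesis using insert.prems(3) by simp
    qed
    then have "p = 0" using poly_all_0_iff_0 by blast
    then have "0 = coeff p (m x)" by simp
    also have "\<dots> = (\<Sum>k\<in>K. if k x = m x then c k * (\<Prod>v\<in>V. a v ^ k v) else 0)"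
      by (simp add: p_def coeff_sum)
    also have "\<dots> = (\<Sum>k\<in>K'. c k * (\<Prod>v\<in>V. a v ^ k v))"
      using insert.prems(1) by (simp add: K'_def sum.inter_filter)
    finally show "(\<Sum>k\<in>K'. c k * (\<Prod>v\<in>V. a v ^ k v)) = 0" by simp
  qed
qed

lemma peval_eq_0_imp_eq_0:
  assumes "\<And>a. peval p a = 0"
  shows "p = 0"
proof (rule ccontr)
  assume "p \<noteq> 0"
  then obtain m0 where m0: "m0 \<in> Poly_Mapping.keys p"
    by (metis in_keys_iff lookup_zero poly_mapping_eqI)
  define V where "V = pvars p"
  define K where "K = Poly_Mapping.lookup ` Poly_Mapping.keys p"
  have V: "finite V" by (auto simp: V_def pvars_def)
  have inj: "inj Poly_Mapping.lookup" by (rule injI) (simp add: poly_mapping.lookup_inject)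
  have zero: "Poly_Mapping.lookup m v = 0" if "m \<in> Poly_Mapping.keys p" "v \<notin> V" for m v
    using that by (auto simp: V_def pvars_def in_keys_iff)
  \<comment> \<open>Exponents pass to \<open>power_sums_vanish\<close> as plain functions; on
    \<open>K\<close>, \<open>Abs_poly_mapping\<close> recovers the monomial from its
    function.\<close>
  have "Poly_Mapping.lookup p (Abs_poly_mapping (Poly_Mapping.lookup m0)) = 0"
  proof (rule power_sums_vanish[OF V, of K])
    show "finite K" "Poly_Mapping.lookup m0 \<in> K" using m0 by (auto simp: K_def)
    show "inj_on (\<lambda>m. restrict m V) K"
    proof (rule inj_onI)
      fix k l assume kl: "k \<in> K" "l \<in> K" "restrict k V = restrict l V"
      show "k = l"
      proof
        fix y show "k y = l y"
          using kl(1,2) fun_cong[OF kl(3), of y] zero by (cases "y \<in> V") (auto simp: K_def)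
      qed
    qed
    fix a
    have "(\<Sum>m\<in>K. Poly_Mapping.lookup p (Abs_poly_mapping m) * (\<Prod>v\<in>V. a v ^ m v)) =
        (\<Sum>m\<in>Poly_Mapping.keys p. Poly_Mapping.lookup p m * (\<Prod>v\<in>V. a v ^ Poly_Mapping.lookup m v))"
      unfolding K_def by (subst sum.reindex) (use inj in \<open>auto simp: inj_on_def poly_mapping.lookup_inverse\<close>)
    also have "\<dots> = peval p a"
      unfolding peval_altdef
      by (intro sum.cong refl arg_cong2[where f = "(*)"] mono_eval_superset[symmetric] V)
         (auto simp: V_def pvars_def)
    finally show "(\<Sum>m\<in>K. Poly_Mapping.lookup p (Abs_poly_mapping m) * (\<Prod>v\<in>V. a v ^ m v)) = 0"
      using assms by simp
  qed
  then show False using m0 by (simp add: poly_mapping.lookup_inverse in_keys_iff)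
qed

section \<open>Polynomial functions along real lines\<close>

text \<open>The parameter is real, so that one-sided limits and vector derivatives apply to the same
  curves; the coefficients are complex.\<close>

definition poly_curve :: "(real \<Rightarrow> complex) \<Rightarrow> bool" where
  "poly_curve c \<longleftrightarrow> (\<exists>p. \<forall>t. c t = poly p (of_real t))"

lemma poly_curve_const: "poly_curve (\<lambda>t. c)"
  unfolding poly_curve_def by (rule exI[of _ "[:c:]"]) simp

lemma poly_curve_id: "poly_curve (\<lambda>t. of_real t)"
  unfolding poly_curve_def by (rule exI[of _ "[:0, 1:]"]) simp

lemma poly_curve_add: "poly_curve c \<Longrightarrow> poly_curve d \<Longrightarrow> poly_curve (\<lambda>t. c t + d t)"
  unfolding poly_curve_def by (elim exE, rule exI[of _ "_ + _"]) (simp only: poly_add, blast)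

lemma poly_curve_diff: "poly_curve c \<Longrightarrow> poly_curve d \<Longrightarrow> poly_curve (\<lambda>t. c t - d t)"
  unfolding poly_curve_def by (elim exE, rule exI[of _ "_ - _"]) (simp only: poly_diff, blast)

lemma poly_curve_minus: "poly_curve c \<Longrightarrow> poly_curve (\<lambda>t. - c t)"
  unfolding poly_curve_def by (elim exE, rule exI[of _ "- _"]) (simp only: poly_minus, blast)

lemma poly_curve_mult: "poly_curve c \<Longrightarrow> poly_curve d \<Longrightarrow> poly_curve (\<lambda>t. c t * d t)"
  unfolding poly_curve_def by (elim exE, rule exI[of _ "_ * _"]) (simp only: poly_mult, blast)

lemma poly_curve_power: "poly_curve c \<Longrightarrow> poly_curve (\<lambda>t. c t ^ k)"
  unfolding poly_curve_def by (elim exE, rule exI[of _ "_ ^ k"]) (simp only: poly_power, blast)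

lemma poly_curve_sum: "(\<And>i. i \<in> I \<Longrightarrow> poly_curve (c i)) \<Longrightarrow> poly_curve (\<lambda>t. \<Sum>i\<in>I. c i t)"
  by (induction I rule: infinite_finite_induct) (simp_all add: poly_curve_const poly_curve_add)

lemma poly_curve_prod: "(\<And>i. i \<in> I \<Longrightarrow> poly_curve (c i)) \<Longrightarrow> poly_curve (\<lambda>t. \<Prod>i\<in>I. c i t)"
  by (induction I rule: infinite_finite_induct) (simp_all add: poly_curve_const poly_curve_mult)

lemma poly_curve_if:
  "(P \<Longrightarrow> poly_curve c) \<Longrightarrow> (\<not> P \<Longrightarrow> poly_curve d) \<Longrightarrow> poly_curve (\<lambda>t. if P then c t else d t)"
  by (cases P) simp_all

lemmas poly_curve_intros = poly_curve_sum poly_curve_prod poly_curve_if poly_curve_add poly_curve_diff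
  poly_curve_minus poly_curve_mult poly_curve_power poly_curve_id poly_curve_const

lemma poly_curve_det:
  fixes A :: "real \<Rightarrow> complex^'m^'m"
  assumes "\<And>i j. poly_curve (\<lambda>t. A t $ i $ j)"
  shows "poly_curve (\<lambda>t. det (A t))"
  unfolding det_def by (intro poly_curve_sum poly_curve_mult poly_curve_prod poly_curve_const assms)

lemma poly_curve_matrix_mult:
  fixes A :: "real \<Rightarrow> complex^'m^'k" and B :: "real \<Rightarrow> complex^'l^'m"
  assumes "\<And>i j. poly_curve (\<lambda>t. A t $ i $ j)" "\<And>i j. poly_curve (\<lambda>t. B t $ i $ j)"
  shows "poly_curve (\<lambda>t. (A t ** B t) $ i $ j)"
  unfolding matrix_matrix_mult_def by (simp, intro poly_curve_sum poly_curve_mult assms)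

lemma poly_curve_peval:
  assumes "\<And>v. poly_curve (\<lambda>t. a t v)"
  shows "poly_curve (\<lambda>t. peval p (a t))"
  unfolding peval_def
  by (intro poly_curve_sum poly_curve_mult poly_curve_prod poly_curve_power poly_curve_const assms)

lemma poly_curve_eq_0:
  assumes "poly_curve c" "infinite {t. c t = 0}"
  shows "c t = 0"
proof -
  obtain p where p: "\<And>t. c t = poly p (of_real t)"
    using assms(1) by (auto simp: poly_curve_def)
  have "infinite (complex_of_real ` {t. c t = 0})"
    using assms(2) by (simp add: finite_image_iff inj_on_def)
  moreover have "complex_of_real ` {t. c t = 0} \<subseteq> {x. poly p x = 0}"
    using p by auto
  ultimately have "infinite {x. poly p x = 0}" using infinite_super by blast
  then have "p = 0" using poly_roots_finite by blast
  then show ?thesis using p by simp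
qed

text \<open>The two zero sets cover the real line, so one of them is infinite.\<close>

lemma poly_curve_mult_eq_0:
  assumes "poly_curve c" "poly_curve d" "\<And>t. c t * d t = 0"
  shows "(\<forall>t. c t = 0) \<or> (\<forall>t. d t = 0)"
proof -
  have "infinite ({t. c t = 0} \<union> {t. d t = 0})"
  proof -
    have "{t. c t = 0} \<union> {t. d t = 0} = UNIV" using assms(3) by auto
    then show ?thesis using infinite_UNIV_char_0 by metis
  qed
  then show ?thesis using poly_curve_eq_0 assms(1,2) by blast
qed

text \<open>A coordinate-free substitute for being a polynomial function on the subspace
  \<open>S\<close>: only restrictions to lines are ever used.\<close>

definition poly_on_lines :: "'e::real_vector set \<Rightarrow> ('e \<Rightarrow> complex) \<Rightarrow> bool" where
  "poly_on_lines S f \<longleftrightarrow> (\<forall>a\<in>S. \<forall>b\<in>S. poly_curve (\<lambda>t. f (a + t *\<^sub>R b)))"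

text \<open>Irreducibility of the affine space \<open>S\<close>: on the line joining a point where
  \<open>f\<close> is nonzero to one where \<open>g\<close> is nonzero, neither factor is
  identically zero.\<close>

lemma poly_on_lines_mult_eq_0:
  assumes S: "subspace S" and "poly_on_lines S f" "poly_on_lines S g"
    and "\<And>x. x \<in> S \<Longrightarrow> f x * g x = 0"
  shows "(\<forall>x\<in>S. f x = 0) \<or> (\<forall>x\<in>S. g x = 0)"
proof (rule ccontr)
  assume "\<not> ?thesis"
  then obtain x y where xy: "x \<in> S" "f x \<noteq> 0" "y \<in> S" "g y \<noteq> 0" by auto
  have d: "y - x \<in> S" using xy S by (simp add: subspace_diff)
  have "f (x + t *\<^sub>R (y - x)) * g (x + t *\<^sub>R (y - x)) = 0" for t
    using assms(4) d xy S by (simp add: subspace_add subspace_scale)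
  then have "(\<forall>t. f (x + t *\<^sub>R (y - x)) = 0) \<or> (\<forall>t. g (x + t *\<^sub>R (y - x)) = 0)"
    using assms(2,3) d xy by (intro poly_curve_mult_eq_0) (auto simp: poly_on_lines_def)
  then show False
    using xy by (metis add.right_neutral add_diff_cancel_left' diff_add_cancel scaleR_one scaleR_zero_left add.commute)
qed

lemma poly_on_lines_prod:
  "(\<And>i. i \<in> I \<Longrightarrow> poly_on_lines S (f i)) \<Longrightarrow> poly_on_lines S (\<lambda>x. \<Prod>i\<in>I. f i x)"
  by (simp add: poly_on_lines_def poly_curve_prod)

text \<open>Finitely many proper zero sets do not cover \<open>S\<close>. This is the source of all
  generic points below.\<close>

lemma common_nonzero:
  assumes S: "subspace S" and "finite I"
    and "\<And>i. i \<in> I \<Longrightarrow> poly_on_lines S (f i)" and "\<And>i. i \<in> I \<Longrightarrow> \<exists>x\<in>S. f i x \<noteq> 0"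
  shows "\<exists>x\<in>S. \<forall>i\<in>I. f i x \<noteq> 0"
  using assms(2-4)
proof (induction I rule: finite_induct)
  case empty
  then show ?case using S subspace_0 by auto
next
  case (insert j I)
  have "\<not> (\<forall>x\<in>S. f j x = 0)" using insert.prems(2) by auto
  moreover have "\<not> (\<forall>x\<in>S. (\<Prod>i\<in>I. f i x) = 0)" using insert by auto
  ultimately have "\<not> (\<forall>x\<in>S. f j x * (\<Prod>i\<in>I. f i x) = 0)"
    using poly_on_lines_mult_eq_0[OF S, of "f j" "\<lambda>x. \<Prod>i\<in>I. f i x"]
      poly_on_lines_prod[of I S f] insert.prems(1) by blast
  then show ?case using insert.hyps by auto
qed

section \<open>Symmetric functions of the eigenvalues\<close>

text \<open>Unlike \<open>complex^'n^'n\<close>, these do not fix the sort of \<open>'n\<close> to be exactly \<open>finite\<close>.\<close>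

type_synonym 'n cmat = "complex^'n^'n"
type_synonym 'n cvec = "complex^'n"

text \<open>The indices form an arbitrary finite linear order, so the predecessor of
  \<open>k\<close> is \<open>Max {..<k}\<close>, and the value before the least index is 0.\<close>

lemma sum_atMost_telescope:
  fixes h :: "'n::{finite,linorder} \<Rightarrow> complex"
  shows "(\<Sum>k\<in>{..i}. h k - (if {..<k} = {} then 0 else h (Max {..<k}))) = h i"
proof (induction "card {..<i}" arbitrary: i rule: less_induct)
  case less
  show ?case
  proof (cases "{..<i} = {}")
    case True
    then have "{..i} = {i}" by (auto simp: le_less)
    then show ?thesis using True by simp
  next
    case False
    define j where "j = Max {..<i}"
    have j: "j < i" "\<And>k. k < i \<Longrightarrow> k \<le> j"
      using Max_in[OF finite False] by (auto simp: j_def)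
    have "{..<j} \<subset> {..<i}" using j(1) by auto
    then have "card {..<j} < card {..<i}" by (simp add: psubset_card_mono)
    note IH = less[OF this]
    have "{..i} = insert i {..j}" using j by (auto simp: le_less)
    moreover have "i \<notin> {..j}" using j(1) by auto
    ultimately show ?thesis using IH False by (simp add: j_def)
  qed
qed

text \<open>The coefficient of \<open>H_i\<close> is a partial sum of the diagonal, so diagonal
  entries are recovered as consecutive differences. Hence the Chevalley coordinates take arbitrary
  values independently.\<close>

lemma assign_surj:
  obtains L :: "('n::{finite,linorder}) cmat" where "L \<in> sl"
    and "\<And>v. v \<in> valid_vars \<Longrightarrow> assign (a Z0) L v = a v"
proof -
  \<comment> \<open>The partial sum up to the last index is the trace, which has to be 0.\<close>
  define h where "h i = (if i = Max UNIV then 0 else a (Hcoord i))" for i :: 'n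
  define d where "d k = h k - (if {..<k} = {} then 0 else h (Max {..<k}))" for k
  define L :: "'n cmat" where "L = (\<chi> i j. if i = j then d i else a (Ecoord i j))"
  have sums: "(\<Sum>k\<in>{..i}. L$k$k) = h i" for i
    using sum_atMost_telescope[of h i] by (simp add: L_def d_def)
  have "{..Max UNIV} = (UNIV :: 'n set)" by auto
  then have "L \<in> sl" using sums[of "Max UNIV"] by (simp add: sl_def h_def)
  moreover have "assign (a Z0) L v = a v" if "v \<in> valid_vars" for v
    using that sums by (auto simp: valid_vars_def assign_def L_def[THEN arg_cong, of "\<lambda>L. L$_$_"] h_def)
  ultimately show ?thesis using that by blast
qed

lemma peval_assign_unique:
  fixes P Q :: "('n::{finite,linorder}) var mpoly"
  assumes "pvars P \<subseteq> valid_vars" "pvars Q \<subseteq> valid_vars"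
    and "\<And>z L. L \<in> sl \<Longrightarrow> peval P (assign z L) = peval Q (assign z L)"
  shows "P = Q"
proof -
  have "P - Q = 0"
  proof (rule peval_eq_0_imp_eq_0)
    fix a :: "'n var \<Rightarrow> complex"
    obtain L where L: "L \<in> sl" "\<And>v. v \<in> valid_vars \<Longrightarrow> assign (a Z0) L v = a v"
      using assign_surj[of a] by blast
    have "peval P a = peval P (assign (a Z0) L)" "peval Q a = peval Q (assign (a Z0) L)"
      using L(2) assms(1,2) by (auto intro!: peval_cong)
    then show "peval (P - Q) a = 0" using assms(3)[OF L(1)] by (simp add: peval_diff)
  qed
  then show ?thesis by simp
qed

text \<open>Lets the existence of a polynomial in the Chevalley coordinates be proved by closure
  rules on functions of \<open>z\<close> and \<open>L\<close>.\<close>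

definition realizable :: "(complex \<Rightarrow> ('n::{finite,linorder}) cmat \<Rightarrow> complex) \<Rightarrow> bool" where
  "realizable F \<longleftrightarrow> (\<exists>P. pvars P \<subseteq> valid_vars \<and> (\<forall>z L. L \<in> sl \<longrightarrow> peval P (assign z L) = F z L))"

lemma realizable_cong:
  assumes "realizable F" "\<And>z L. L \<in> sl \<Longrightarrow> F z L = G z L"
  shows "realizable G"
  using assms by (auto simp: realizable_def)

lemma realizable_const: "realizable (\<lambda>z (L :: ('a::{finite,linorder}) cmat). c)"
proof -
  have "pvars (Poly_Mapping.single (0 :: 'a var \<Rightarrow>\<^sub>0 nat) c) = {}"
    using pvars_single[of "0 :: 'a var \<Rightarrow>\<^sub>0 nat" c] by simp
  then show ?thesis
    unfolding realizable_def by (intro exI[of _ "Poly_Mapping.single 0 c"]) (simp add: peval_single)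
qed

lemma realizable_var: "v \<in> valid_vars \<Longrightarrow> realizable (\<lambda>z L. assign z L v)"
  unfolding realizable_def
  using pvars_single[of "Poly_Mapping.single v 1" 1]
  by (intro exI[of _ "Poly_Mapping.single (Poly_Mapping.single v 1) 1"])
     (auto simp: peval_single mono_eval_single)

lemma realizable_add:
  assumes "realizable F" "realizable G" shows "realizable (\<lambda>z L. F z L + G z L)"
proof -
  obtain P Q where "pvars P \<subseteq> valid_vars" "pvars Q \<subseteq> valid_vars"
      "\<And>z L. L \<in> sl \<Longrightarrow> peval P (assign z L) = F z L" "\<And>z L. L \<in> sl \<Longrightarrow> peval Q (assign z L) = G z L"
    using assms by (auto simp: realizable_def)
  then show ?thesis
    unfolding realizable_def using pvars_add[of P Q] by (intro exI[of _ "P + Q"]) (auto simp: peval_add)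
qed

lemma realizable_diff:
  assumes "realizable F" "realizable G" shows "realizable (\<lambda>z L. F z L - G z L)"
proof -
  obtain P Q where "pvars P \<subseteq> valid_vars" "pvars Q \<subseteq> valid_vars"
      "\<And>z L. L \<in> sl \<Longrightarrow> peval P (assign z L) = F z L" "\<And>z L. L \<in> sl \<Longrightarrow> peval Q (assign z L) = G z L"
    using assms by (auto simp: realizable_def)
  then show ?thesis
    unfolding realizable_def using pvars_diff[of P Q] by (intro exI[of _ "P - Q"]) (auto simp: peval_diff)
qed

lemma realizable_mult:
  assumes "realizable F" "realizable G" shows "realizable (\<lambda>z L. F z L * G z L)"
proof -
  obtain P Q where "pvars P \<subseteq> valid_vars" "pvars Q \<subseteq> valid_vars"
      "\<And>z L. L \<in> sl \<Longrightarrow> peval P (assign z L) = F z L" "\<And>z L. L \<in> sl \<Longrightarrow> peval Q (assign z L) = G z L"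
    using assms by (auto simp: realizable_def)
  then show ?thesis
    unfolding realizable_def using pvars_mult[of P Q] by (intro exI[of _ "P * Q"]) (auto simp: peval_mult)
qed

lemma realizable_sum: "(\<And>i. i \<in> I \<Longrightarrow> realizable (F i)) \<Longrightarrow> realizable (\<lambda>z L. \<Sum>i\<in>I. F i z L)"
  by (induction I rule: infinite_finite_induct) (simp_all add: realizable_const realizable_add)

lemma realizable_prod: "(\<And>i. i \<in> I \<Longrightarrow> realizable (F i)) \<Longrightarrow> realizable (\<lambda>z L. \<Prod>i\<in>I. F i z L)"
  by (induction I rule: infinite_finite_induct) (simp_all add: realizable_const realizable_mult)

lemma realizable_z: "realizable (\<lambda>z L. z)"
  using realizable_var[of Z0] by (simp add: valid_vars_def assign_def)

text \<open>The last index has no coordinate of its own, but there the sum is the trace, which is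
  constantly 0 on \<open>sl\<close>.\<close>

lemma realizable_diag_sum: "realizable (\<lambda>z L. \<Sum>k\<in>{..i}. L$k$k)"
proof (cases "i = Max UNIV")
  case True
  then have "{..i} = UNIV" by auto
  then show ?thesis
    by (intro realizable_cong[OF realizable_const[of 0]]) (simp add: sl_def)
next
  case False
  then show ?thesis
    using realizable_var[of "Hcoord i"] by (simp add: valid_vars_def assign_def)
qed

lemma realizable_entry: "realizable (\<lambda>z L. L$i$j)"
proof (cases "i = j")
  case False
  then show ?thesis
    using realizable_var[of "Ecoord i j"] by (simp add: valid_vars_def assign_def)
next
  case eq: True
  show ?thesis
  proof (cases "{..<i} = {}")
    case True
    then have "{..i} = {i}" by (auto simp: le_less)
    then show ?thesis using realizable_diag_sum[of i] eq by simp
  next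
    case False
    define k where "k = Max {..<i}"
    have k: "k < i" "\<And>l. l < i \<Longrightarrow> l \<le> k"
      using Max_in[OF finite False] by (auto simp: k_def)
    then have "{..i} = insert i {..k}" "i \<notin> {..k}" by (auto simp: le_less)
    then show ?thesis
      using realizable_diff[OF realizable_diag_sum[of i] realizable_diag_sum[of k]] eq by simp
  qed
qed

lemma realizable_matrix_mult:
  fixes A :: "('n::{finite,linorder}) cmat \<Rightarrow> complex^'m^'k" and B :: "'n cmat \<Rightarrow> complex^'l^'m"
  assumes "\<And>i j. realizable (\<lambda>z L. A L $ i $ j)" "\<And>i j. realizable (\<lambda>z L. B L $ i $ j)"
  shows "realizable (\<lambda>z L. (A L ** B L) $ i $ j)"
  unfolding matrix_matrix_mult_def by (simp, intro realizable_sum realizable_mult assms)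

lemma realizable_det:
  fixes A :: "complex \<Rightarrow> ('n::{finite,linorder}) cmat \<Rightarrow> complex^'m^'m"
  assumes "\<And>i j. realizable (\<lambda>z L. A z L $ i $ j)"
  shows "realizable (\<lambda>z L. det (A z L))"
  unfolding det_def by (intro realizable_sum realizable_mult realizable_prod realizable_const assms)

primrec matpow :: "complex^'n^'n \<Rightarrow> nat \<Rightarrow> complex^'n^'n" where
  "matpow L 0 = mat 1"
| "matpow L (Suc k) = L ** matpow L k"

lemma realizable_matpow: "realizable (\<lambda>z L. matpow L k $ i $ j)"
proof (induction k arbitrary: i j)
  case 0
  then show ?case using realizable_const by simp
next
  case (Suc k)
  then show ?case by (simp add: realizable_matrix_mult realizable_entry)
qed

lemma matrix_inv_mult:
  fixes P :: "complex^'n^'n"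
  assumes "invertible P"
  shows "P ** matrix_inv P = mat 1" "matrix_inv P ** P = mat 1"
  using assms someI_ex[of "\<lambda>A'. P ** A' = mat 1 \<and> A' ** P = mat 1"]
  by (auto simp: matrix_inv_def invertible_def)

lemma diagm_mult: "diagm \<theta> ** diagm \<eta> = diagm (\<chi> i. \<theta>$i * \<eta>$i)"
  by (simp add: diagm_def matrix_matrix_mult_def vec_eq_iff if_distrib[of "\<lambda>x. x * _"] cong: if_cong)

lemma trace_conj:
  fixes P :: "complex^'n^'n"
  assumes "invertible P"
  shows "trace (P ** A ** matrix_inv P) = trace A"
proof -
  have "trace (P ** A ** matrix_inv P) = trace (matrix_inv P ** (P ** A))" by (rule trace_mul_sym)
  also have "\<dots> = trace A" by (simp add: matrix_mul_assoc matrix_inv_mult assms)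
  finally show ?thesis .
qed

lemma trace_diagm: "trace (diagm \<theta>) = (\<Sum>i\<in>UNIV. \<theta>$i)"
  by (simp add: trace_def diagm_def)

lemma sl_eq_trace: "L \<in> sl \<longleftrightarrow> trace L = 0"
  by (simp add: sl_def trace_def)

lemma matpow_conj_diagm:
  fixes P :: "complex^'n^'n"
  assumes "invertible P"
  shows "matpow (P ** diagm \<theta> ** matrix_inv P) k = P ** diagm (\<chi> i. \<theta>$i ^ k) ** matrix_inv P"
proof (induction k)
  case 0
  have "diagm (\<chi> i::'n. 1) = mat 1" by (simp add: diagm_def mat_def vec_eq_iff)
  then show ?case using assms by (simp add: matrix_inv_mult)
next
  case (Suc k)
  have "matpow (P ** diagm \<theta> ** matrix_inv P) (Suc k)
      = P ** diagm \<theta> ** (matrix_inv P ** P) ** diagm (\<chi> i. \<theta>$i ^ k) ** matrix_inv P"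
    by (simp only: matpow.simps Suc matrix_mul_assoc)
  also have "\<dots> = P ** (diagm \<theta> ** diagm (\<chi> i. \<theta>$i ^ k)) ** matrix_inv P"
    using assms by (simp only: matrix_inv_mult matrix_mul_rid matrix_mul_assoc)
  finally show ?case by (simp add: diagm_mult)
qed

definition spectrally_realizable :: "(complex \<Rightarrow> ('n::{finite,linorder}) cvec \<Rightarrow> complex) \<Rightarrow> bool" where
  "spectrally_realizable G \<longleftrightarrow> (\<exists>F. realizable F \<and>
     (\<forall>z L \<theta>. L \<in> sl \<and> diagonalizable L \<theta> \<longrightarrow> F z L = G z \<theta>))"

lemma spectrally_realizable_const: "spectrally_realizable (\<lambda>z \<theta>. c)"
  unfolding spectrally_realizable_def using realizable_const by blast

lemma spectrally_realizable_z: "spectrally_realizable (\<lambda>z \<theta>. z)"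
  unfolding spectrally_realizable_def using realizable_z by blast

lemma spectrally_realizable_power_sum: "spectrally_realizable (\<lambda>z \<theta>. \<Sum>i\<in>UNIV. \<theta>$i ^ k)"
  unfolding spectrally_realizable_def
proof (intro exI conjI allI impI)
  show "realizable (\<lambda>z L. \<Sum>i\<in>UNIV. matpow L k $ i $ i)"
    by (intro realizable_sum realizable_matpow)
  fix L :: "complex^'n^'n" and \<theta> assume "L \<in> sl \<and> diagonalizable L \<theta>"
  then obtain P where "invertible P" "L = P ** diagm \<theta> ** matrix_inv P"
    by (auto simp: diagonalizable_def)
  then have "trace (matpow L k) = (\<Sum>i\<in>UNIV. \<theta>$i ^ k)"
    by (simp add: matpow_conj_diagm trace_conj trace_diagm)
  then show "(\<Sum>i\<in>UNIV. matpow L k $ i $ i) = (\<Sum>i\<in>UNIV. \<theta>$i ^ k)" by (simp add: trace_def)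
qed

lemma spectrally_realizable_add:
  assumes "spectrally_realizable F" "spectrally_realizable G"
  shows "spectrally_realizable (\<lambda>z \<theta>. F z \<theta> + G z \<theta>)"
proof -
  obtain F' G' where "realizable F'" "realizable G'"
      "\<And>z L \<theta>. L \<in> sl \<and> diagonalizable L \<theta> \<Longrightarrow> F' z L = F z \<theta>"
      "\<And>z L \<theta>. L \<in> sl \<and> diagonalizable L \<theta> \<Longrightarrow> G' z L = G z \<theta>"
    using assms unfolding spectrally_realizable_def by metis
  then show ?thesis
    unfolding spectrally_realizable_def
    by (intro exI[of _ "\<lambda>z L. F' z L + G' z L"] conjI allI impI realizable_add arg_cong2[where f = "(+)"]) blast+
qed

lemma spectrally_realizable_mult:
  assumes "spectrally_realizable F" "spectrally_realizable G"
  shows "spectrally_realizable (\<lambda>z \<theta>. F z \<theta> * G z \<theta>)"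
proof -
  obtain F' G' where "realizable F'" "realizable G'"
      "\<And>z L \<theta>. L \<in> sl \<and> diagonalizable L \<theta> \<Longrightarrow> F' z L = F z \<theta>"
      "\<And>z L \<theta>. L \<in> sl \<and> diagonalizable L \<theta> \<Longrightarrow> G' z L = G z \<theta>"
    using assms unfolding spectrally_realizable_def by metis
  then show ?thesis
    unfolding spectrally_realizable_def
    by (intro exI[of _ "\<lambda>z L. F' z L * G' z L"] conjI allI impI realizable_mult arg_cong2[where f = "(*)"]) blast+
qed

lemma spectrally_realizable_diff:
  assumes "spectrally_realizable F" "spectrally_realizable G"
  shows "spectrally_realizable (\<lambda>z \<theta>. F z \<theta> - G z \<theta>)"
  using spectrally_realizable_add[OF assms(1) spectrally_realizable_mult[OF spectrally_realizable_const[of "-1"] assms(2)]]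
  by simp

lemma spectrally_realizable_sum:
  "(\<And>i. i \<in> I \<Longrightarrow> spectrally_realizable (F i)) \<Longrightarrow> spectrally_realizable (\<lambda>z \<theta>. \<Sum>i\<in>I. F i z \<theta>)"
  by (induction I rule: infinite_finite_induct)
     (simp_all add: spectrally_realizable_const spectrally_realizable_add)

lemma spectrally_realizable_z_power: "spectrally_realizable (\<lambda>z \<theta>. z ^ k)"
  by (induction k) (simp_all add: spectrally_realizable_const spectrally_realizable_mult spectrally_realizable_z)

section \<open>Symmetrized monomials from power sums\<close>

definition inj_maps :: "'n set \<Rightarrow> ('n \<Rightarrow> 'n::finite) set" where
  "inj_maps I = {f \<in> I \<rightarrow>\<^sub>E UNIV. inj_on f I}"

text \<open>An augmented monomial symmetric function: the exponents \<open>a i\<close> are placed on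
  pairwise distinct eigenvalues. A proper subset \<open>I\<close> is allowed so that exponents can
  be removed one at a time.\<close>

definition inj_sum :: "'n set \<Rightarrow> ('n \<Rightarrow> nat) \<Rightarrow> complex^'n \<Rightarrow> complex" where
  "inj_sum I a \<theta> = (\<Sum>f\<in>inj_maps I. \<Prod>i\<in>I. \<theta>$(f i) ^ a i)"

lemma finite_inj_maps: "finite (inj_maps I)"
  unfolding inj_maps_def by (rule finite_subset[of _ "I \<rightarrow>\<^sub>E UNIV"]) (auto intro: finite_PiE)

text \<open>Choosing the place of \<open>x\<close> freely gives a power sum times the smaller sum.
  The excess consists of the choices where \<open>x\<close> collides with some \<open>i\<close> in
  \<open>I\<close>, and there the exponent \<open>a x\<close> is added to \<open>a i\<close>. The
  recursion ends in products of power sums.\<close>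

lemma inj_sum_insert:
  fixes \<theta> :: "complex^'n"
  assumes x: "x \<notin> I"
  shows "inj_sum (insert x I) a \<theta> =
    (\<Sum>j\<in>UNIV. \<theta>$j ^ a x) * inj_sum I a \<theta> - (\<Sum>i\<in>I. inj_sum I (a(i := a i + a x)) \<theta>)"
proof -
  let ?m = "\<lambda>f. \<Prod>i\<in>I. \<theta>$(f i) ^ a i"
  have "inj_sum (insert x I) a \<theta> = (\<Sum>(f, j)\<in>(SIGMA f:inj_maps I. - f ` I). \<theta>$j ^ a x * ?m f)"
    unfolding inj_sum_def
  proof (rule sum.reindex_bij_witness[where i = "\<lambda>(f, j). f(x := j)" and j = "\<lambda>g. (restrict g I, g x)"])
    fix g assume g: "g \<in> inj_maps (insert x I)"
    have "(restrict g I)(x := g x) = g"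
      using g x by (auto simp: inj_maps_def fun_eq_iff PiE_def extensional_def)
    then show "(case (restrict g I, g x) of (f, j) \<Rightarrow> f(x := j)) = g" by simp
    have "g x \<notin> g ` I" using g x by (auto simp: inj_maps_def inj_on_def)
    then show "(restrict g I, g x) \<in> (SIGMA f:inj_maps I. - f ` I)"
      using g by (auto simp: inj_maps_def inj_on_def)
    show "(case (restrict g I, g x) of (f, j) \<Rightarrow> \<theta>$j ^ a x * ?m f) = (\<Prod>i\<in>insert x I. \<theta>$(g i) ^ a i)"
      using x by simp
  next
    fix p assume p: "p \<in> (SIGMA f:inj_maps I. - f ` I)"
    obtain f j where fj: "p = (f, j)" by force
    have f: "f \<in> I \<rightarrow>\<^sub>E UNIV" "inj_on f I" "j \<notin> f ` I" using p fj by (auto simp: inj_maps_def)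
    have "restrict (f(x := j)) I = f"
      using f(1) x by (auto simp: fun_eq_iff PiE_def extensional_def)
    then show "(restrict (case p of (f, j) \<Rightarrow> f(x := j)) I, (case p of (f, j) \<Rightarrow> f(x := j)) x) = p"
      by (simp add: fj)
    have "inj_on (f(x := j)) (insert x I)"
      using f x by (auto simp: inj_on_def)
    moreover have "f(x := j) \<in> insert x I \<rightarrow>\<^sub>E UNIV"
      using f(1) by (auto simp: PiE_def extensional_def)
    ultimately show "(case p of (f, j) \<Rightarrow> f(x := j)) \<in> inj_maps (insert x I)"
      by (simp add: fj inj_maps_def)
  qed
  also have "\<dots> = (\<Sum>f\<in>inj_maps I. \<Sum>j\<in>- f ` I. \<theta>$j ^ a x * ?m f)"
    by (rule sum.Sigma[symmetric]) (simp_all add: finite_inj_maps)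
  also have "\<dots> = (\<Sum>f\<in>inj_maps I. (\<Sum>j\<in>UNIV. \<theta>$j ^ a x) * ?m f -
      (\<Sum>i\<in>I. \<Prod>k\<in>I. \<theta>$(f k) ^ (a(i := a i + a x)) k))"
  proof (rule sum.cong[OF refl])
    fix f assume "f \<in> inj_maps I"
    then have inj: "inj_on f I" by (simp add: inj_maps_def)
    have "(\<Sum>j\<in>- f ` I. \<theta>$j ^ a x) = (\<Sum>j\<in>UNIV. \<theta>$j ^ a x) - (\<Sum>j\<in>f ` I. \<theta>$j ^ a x)"
      using sum.subset_diff[of "f ` I" UNIV "\<lambda>j. \<theta>$j ^ a x"] by (simp add: Compl_eq_Diff_UNIV)
    also have "(\<Sum>j\<in>f ` I. \<theta>$j ^ a x) = (\<Sum>i\<in>I. \<theta>$(f i) ^ a x)"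
      by (simp add: sum.reindex[OF inj])
    finally have "(\<Sum>j\<in>- f ` I. \<theta>$j ^ a x * ?m f) =
        (\<Sum>j\<in>UNIV. \<theta>$j ^ a x) * ?m f - (\<Sum>i\<in>I. \<theta>$(f i) ^ a x * ?m f)"
      by (simp add: sum_distrib_right[symmetric] left_diff_distrib)
    also have "(\<Sum>i\<in>I. \<theta>$(f i) ^ a x * ?m f) = (\<Sum>i\<in>I. \<Prod>k\<in>I. \<theta>$(f k) ^ (a(i := a i + a x)) k)"
    proof (rule sum.cong[OF refl])
      fix i assume i: "i \<in> I"
      have "(\<Prod>k\<in>I - {i}. \<theta>$(f k) ^ (a(i := a i + a x)) k) = (\<Prod>k\<in>I - {i}. \<theta>$(f k) ^ a k)"
        by (rule prod.cong) auto
      then show "\<theta>$(f i) ^ a x * ?m f = (\<Prod>k\<in>I. \<theta>$(f k) ^ (a(i := a i + a x)) k)"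
        using i by (simp add: prod.remove[of I i] power_add mult_ac)
    qed
    finally show "(\<Sum>j\<in>- f ` I. \<theta>$j ^ a x * ?m f) = (\<Sum>j\<in>UNIV. \<theta>$j ^ a x) * ?m f -
      (\<Sum>i\<in>I. \<Prod>k\<in>I. \<theta>$(f k) ^ (a(i := a i + a x)) k)" .
  qed
  also have "\<dots> = (\<Sum>j\<in>UNIV. \<theta>$j ^ a x) * inj_sum I a \<theta> - (\<Sum>i\<in>I. inj_sum I (a(i := a i + a x)) \<theta>)"
    unfolding inj_sum_def sum_subtractf sum_distrib_left
    by (rule arg_cong2[where f = "(-)", OF refl], rule sum.swap)
  finally show ?thesis .
qed

lemma spectrally_realizable_inj_sum:
  fixes I :: "('n::{finite,linorder}) set"
  shows "spectrally_realizable (\<lambda>z \<theta>. inj_sum I a \<theta>)"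
proof (induction I arbitrary: a rule: finite_induct[OF finite])
  case 1
  show ?case using spectrally_realizable_const by (simp add: inj_sum_def inj_maps_def)
next
  case (2 x I)
  then show ?case
    by (simp add: inj_sum_insert spectrally_realizable_diff spectrally_realizable_mult
        spectrally_realizable_power_sum spectrally_realizable_sum)
qed

lemma spectrally_realizable_symmetrized_monomial:
  "spectrally_realizable (\<lambda>z \<theta>. \<Sum>\<sigma> | \<sigma> permutes (UNIV::('n::{finite,linorder}) set). \<Prod>i\<in>UNIV. \<theta>$(\<sigma> i) ^ a i)"
proof -
  have "inj_maps (UNIV :: 'n set) = {\<sigma>. \<sigma> permutes UNIV}"
    by (auto simp: inj_maps_def permutes_inj finite_UNIV_inj_surj bij_def intro!: bij_imp_permutes)
  then show ?thesis
    using spectrally_realizable_inj_sum[of UNIV a] by (simp add: inj_sum_def)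
qed

lemma finite_orbit: "finite (orbit w)"
proof -
  have "orbit w = (\<lambda>\<sigma>. \<chi> i. w $ \<sigma> i) ` {\<sigma>. \<sigma> permutes UNIV}" by (auto simp: orbit_def)
  then show ?thesis by (simp add: finite_permutations)
qed

text \<open>The prefactor makes the induction go through. Expanding one linear factor of the product
  either raises the power of \<open>z\<close> or raises one exponent \<open>a k\<close>, and both
  results are again of this form with a smaller \<open>N\<close>.\<close>

lemma symmetrization_realizable:
  fixes N :: "(('n::{finite,linorder}) cvec) set"
  assumes "finite N"
  shows "spectrally_realizable (\<lambda>z \<theta>. \<Sum>\<sigma> | \<sigma> permutes (UNIV::'n set).
    z ^ b * (\<Prod>i\<in>UNIV. \<theta>$(\<sigma> i) ^ a i) * (\<Prod>\<nu>\<in>N. z + pair \<nu> (\<chi> i. \<theta>$\<sigma> i)))"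
  using assms
proof (induction N arbitrary: a b rule: finite_induct)
  case empty
  then show ?case
    using spectrally_realizable_mult[OF spectrally_realizable_z_power spectrally_realizable_symmetrized_monomial]
    by (simp add: sum_distrib_left)
next
  case (insert \<nu> N)
  let ?S = "\<lambda>a b z \<theta>. \<Sum>\<sigma> | \<sigma> permutes (UNIV::'n set).
    z ^ b * (\<Prod>i\<in>UNIV. \<theta>$(\<sigma> i) ^ a i) * (\<Prod>\<nu>\<in>N. z + pair \<nu> (\<chi> i. \<theta>$\<sigma> i))"
  have "spectrally_realizable (\<lambda>z \<theta>. ?S a (Suc b) z \<theta> + (\<Sum>k\<in>UNIV. \<nu>$k * ?S (a(k := Suc (a k))) b z \<theta>))"
    by (intro spectrally_realizable_add spectrally_realizable_sum spectrally_realizable_mult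
        spectrally_realizable_const insert.IH)
  also have "(\<lambda>z \<theta>. ?S a (Suc b) z \<theta> + (\<Sum>k\<in>UNIV. \<nu>$k * ?S (a(k := Suc (a k))) b z \<theta>)) =
     (\<lambda>z \<theta>. \<Sum>\<sigma> | \<sigma> permutes (UNIV::'n set).
    z ^ b * (\<Prod>i\<in>UNIV. \<theta>$(\<sigma> i) ^ a i) * (\<Prod>\<nu>\<in>insert \<nu> N. z + pair \<nu> (\<chi> i. \<theta>$\<sigma> i)))"
  proof (intro ext)
    fix z and \<theta> :: "'n cvec"
    have up: "(\<Prod>i\<in>UNIV. \<theta>$(\<sigma> i) ^ (a(k := Suc (a k))) i) = \<theta>$(\<sigma> k) * (\<Prod>i\<in>UNIV. \<theta>$(\<sigma> i) ^ a i)"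
      for \<sigma> :: "'n \<Rightarrow> 'n" and k
    proof -
      have "(\<Prod>i\<in>UNIV - {k}. \<theta>$(\<sigma> i) ^ (a(k := Suc (a k))) i) = (\<Prod>i\<in>UNIV - {k}. \<theta>$(\<sigma> i) ^ a i)"
        by (rule prod.cong) auto
      then show ?thesis by (simp add: prod.remove[of UNIV k] mult_ac)
    qed
    have "(\<Sum>k\<in>UNIV. \<nu>$k * ?S (a(k := Suc (a k))) b z \<theta>) =
      (\<Sum>\<sigma> | \<sigma> permutes (UNIV::'n set). \<Sum>k\<in>UNIV. \<nu>$k * (z ^ b * (\<theta>$(\<sigma> k) * (\<Prod>i\<in>UNIV. \<theta>$(\<sigma> i) ^ a i)) *
         (\<Prod>\<nu>\<in>N. z + pair \<nu> (\<chi> i. \<theta>$\<sigma> i))))"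
      unfolding up sum_distrib_left by (rule sum.swap)
    then show "?S a (Suc b) z \<theta> + (\<Sum>k\<in>UNIV. \<nu>$k * ?S (a(k := Suc (a k))) b z \<theta>) =
      (\<Sum>\<sigma> | \<sigma> permutes (UNIV::'n set).
    z ^ b * (\<Prod>i\<in>UNIV. \<theta>$(\<sigma> i) ^ a i) * (\<Prod>\<nu>\<in>insert \<nu> N. z + pair \<nu> (\<chi> i. \<theta>$\<sigma> i)))"
      using insert.hyps
      by (simp add: sum.distrib[symmetric] pair_def sum_distrib_left sum_distrib_right algebra_simps)
  qed
  finally show ?case .
qed

lemma pair_permute:
  fixes \<nu> :: "complex^'n"
  assumes "\<sigma> permutes UNIV"
  shows "pair (\<chi> i. \<nu>$\<sigma> i) (\<chi> i. \<theta>$\<sigma> i) = pair \<nu> \<theta>"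
  unfolding pair_def using sum.permute[OF assms, of "\<lambda>i. \<nu>$i * \<theta>$i"] by (simp add: comp_def)

lemma orbit_permute:
  fixes w :: "complex^'n"
  assumes "\<sigma> permutes UNIV" "\<nu> \<in> orbit w"
  shows "(\<chi> i. \<nu>$\<sigma> i) \<in> orbit w"
proof -
  obtain \<tau> where "\<tau> permutes UNIV" "\<nu> = (\<chi> i. w$\<tau> i)" using assms(2) by (auto simp: orbit_def)
  then show ?thesis
    unfolding orbit_def using permutes_compose[OF assms(1), of \<tau>] by (auto intro!: exI[of _ "\<tau> \<circ> \<sigma>"])
qed

lemma orbit_prod_permute:
  fixes w :: "complex^'n"
  assumes "\<sigma> permutes UNIV"
  shows "(\<Prod>\<nu>\<in>orbit w. z + pair \<nu> (\<chi> i. \<theta>$\<sigma> i)) = (\<Prod>\<nu>\<in>orbit w. z + pair \<nu> \<theta>)"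
proof (rule prod.reindex_bij_witness[where j = "\<lambda>\<nu>. \<chi> i. \<nu>$inv \<sigma> i" and i = "\<lambda>\<nu>. \<chi> i. \<nu>$\<sigma> i"])
  fix \<nu> assume \<nu>: "\<nu> \<in> orbit w"
  show "(\<chi> i. (\<chi> i. \<nu>$inv \<sigma> i)$\<sigma> i) = \<nu>" "(\<chi> i. (\<chi> i. \<nu>$\<sigma> i)$inv \<sigma> i) = \<nu>"
    using assms by (simp_all add: permutes_inverses vec_eq_iff)
  show "(\<chi> i. \<nu>$inv \<sigma> i) \<in> orbit w" "(\<chi> i. \<nu>$\<sigma> i) \<in> orbit w"
    using orbit_permute[OF _ \<nu>] assms permutes_inv by auto
  show "z + pair (\<chi> i. \<nu>$inv \<sigma> i) \<theta> = z + pair \<nu> (\<chi> i. \<theta>$\<sigma> i)"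
    using pair_permute[OF assms, of "\<chi> i. \<nu>$inv \<sigma> i" \<theta>] assms by (simp add: permutes_inverses)
qed

text \<open>The orbit product is already symmetric, so symmetrizing multiplies it by the number of
  permutations, which is then divided out.\<close>

lemma orbit_prod_realizable:
  fixes w :: "('n::{finite,linorder}) cvec"
  shows "spectrally_realizable (\<lambda>z \<theta>. \<Prod>\<nu>\<in>orbit w. z + pair \<nu> \<theta>)"
proof -
  let ?N = "card {\<sigma>. \<sigma> permutes (UNIV :: 'n set)}"
  have "?N \<noteq> 0" by (simp add: card_permutations[OF refl])
  moreover have "spectrally_realizable (\<lambda>z \<theta>. \<Sum>\<sigma> | \<sigma> permutes (UNIV::'n set).
    z ^ 0 * (\<Prod>i\<in>UNIV. \<theta>$(\<sigma> i) ^ 0) * (\<Prod>\<nu>\<in>orbit w. z + pair \<nu> (\<chi> i. \<theta>$\<sigma> i)))"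
    by (rule symmetrization_realizable[OF finite_orbit])
  then have "spectrally_realizable (\<lambda>z \<theta>. of_nat ?N * (\<Prod>\<nu>\<in>orbit w. z + pair \<nu> \<theta>))"
    by (simp add: orbit_prod_permute)
  from spectrally_realizable_mult[OF spectrally_realizable_const[of "1 / of_nat ?N"] this]
  show ?thesis using \<open>?N \<noteq> 0\<close> by simp
qed

section \<open>Density of the diagonalizable matrices\<close>

text \<open>Factors may be constant, so \<open>card I\<close> is only a bound on the degree and the
  coefficient there may be 0. The bound is proved together with the coefficient because the
  induction step for the latter uses it.\<close>

lemma coeff_prod_linear:
  fixes f :: "'i \<Rightarrow> complex poly"
  assumes "finite I" "\<And>i. i \<in> I \<Longrightarrow> degree (f i) \<le> 1"
  shows "degree (prod f I) \<le> card I \<and> coeff (prod f I) (card I) = (\<Prod>i\<in>I. coeff (f i) 1)"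
  using assms
proof (induction I rule: finite_induct)
  case (insert x I)
  obtain a b where ab: "f x = [:a, b:]"
    using insert.prems[of x] degree1_coeffs[of "f x"] degree_eq_zeroE[of "f x"]
    by (cases "degree (f x) = 1") fastforce+
  have IH: "degree (prod f I) \<le> card I" "coeff (prod f I) (card I) = (\<Prod>i\<in>I. coeff (f i) 1)"
    using insert by auto
  have "degree (f x * prod f I) \<le> degree (f x) + degree (prod f I)" by (rule degree_mult_le)
  also have "\<dots> \<le> 1 + card I" using insert.prems[of x] IH(1) by (intro add_mono) auto
  finally have "degree (f x * prod f I) \<le> Suc (card I)" by simp
  moreover have "coeff (f x * prod f I) (Suc (card I)) = b * coeff (prod f I) (card I)"
    using IH(1) by (simp add: ab coeff_eq_0)
  ultimately show ?case using insert.hyps IH(2) by (simp add: ab)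
qed simp

lemma monic_char_poly:
  fixes A :: "complex^'n^'n"
  obtains p where "\<And>x. poly p x = det (mat x - A)" "lead_coeff p = 1" "degree p = CARD('n)"
proof -
  define c where "c i j = [:- A$i$j, if i = j then 1 else 0:]" for i j
  define p where "p = (\<Sum>\<sigma> | \<sigma> permutes (UNIV::'n set). of_int (sign \<sigma>) * (\<Prod>i\<in>UNIV. c i (\<sigma> i)))"
  have ci: "degree (c i j) \<le> 1" for i j by (simp add: c_def)
  have "poly (c i j) x = (mat x - A) $ i $ j" for i j x
    by (simp add: c_def mat_def)
  then have val: "poly p x = det (mat x - A)" for x
    by (simp add: p_def det_def poly_sum poly_prod)
  have deg: "degree p \<le> CARD('n)"
    unfolding p_def
  proof (rule degree_sum_le)
    fix \<sigma> :: "'n \<Rightarrow> 'n"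
    have "degree (of_int (sign \<sigma>) * (\<Prod>i\<in>UNIV. c i (\<sigma> i))) \<le> degree (\<Prod>i\<in>UNIV. c i (\<sigma> i))"
      using degree_mult_le[of "of_int (sign \<sigma>)" "\<Prod>i\<in>UNIV. c i (\<sigma> i)"] by simp
    also have "\<dots> \<le> CARD('n)"
      using coeff_prod_linear[OF finite, of UNIV "\<lambda>i. c i (\<sigma> i)"] ci by blast
    finally show "degree (of_int (sign \<sigma>) * (\<Prod>i\<in>UNIV. c i (\<sigma> i))) \<le> CARD('n)" .
  qed (simp add: finite_permutations)
  \<comment> \<open>Taking the coefficient of \<open>x\<close> in every entry turns the Leibniz sum
    into that of the identity matrix.\<close>
  have "coeff p CARD('n) = (\<Sum>\<sigma> | \<sigma> permutes (UNIV::'n set). of_int (sign \<sigma>) * (\<Prod>i\<in>UNIV. coeff (c i (\<sigma> i)) 1))"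
    unfolding p_def coeff_sum
  proof (rule sum.cong[OF refl])
    fix \<sigma> :: "'n \<Rightarrow> 'n"
    have "coeff (\<Prod>i\<in>UNIV. c i (\<sigma> i)) CARD('n) = (\<Prod>i\<in>UNIV. coeff (c i (\<sigma> i)) 1)"
      using coeff_prod_linear[OF finite, of UNIV "\<lambda>i. c i (\<sigma> i)"] ci by blast
    then show "coeff (of_int (sign \<sigma>) * (\<Prod>i\<in>UNIV. c i (\<sigma> i))) CARD('n) =
        of_int (sign \<sigma>) * (\<Prod>i\<in>UNIV. coeff (c i (\<sigma> i)) 1)"
      by (simp add: of_int_poly)
  qed
  also have "\<dots> = det (mat 1 :: complex^'n^'n)"
    by (simp add: det_def mat_def c_def)
  finally have "coeff p CARD('n) = 1" by simp
  moreover from this deg have "degree p = CARD('n)"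
    by (metis le_antisym le_degree zero_neq_one)
  ultimately show ?thesis using that[OF val] by simp
qed

text \<open>The absolute value of a monic polynomial at \<open>c\<close> is the product of the
  distances from \<open>c\<close> to the roots. If all of them were at least
  \<open>\<delta>\<close>, the product would be at least \<open>\<delta> ^ degree p\<close>.\<close>

lemma root_near:
  fixes p :: "complex poly"
  assumes "lead_coeff p = 1" "0 < \<delta>" "norm (poly p c) < \<delta> ^ degree p"
  shows "\<exists>r. poly p r = 0 \<and> norm (c - r) < \<delta>"
proof (rule ccontr)
  assume "\<not> ?thesis"
  then have far: "\<delta> \<le> norm (c - r)" if "poly p r = 0" for r using that by force
  have p0: "p \<noteq> 0" using assms(1) by auto
  have decomp: "(\<Prod>x\<in>#proots p. [:-x, 1:]) = p"
    using complex_poly_decompose_multiset[of p] assms(1) by simp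
  have bound: "\<delta> ^ size M \<le> norm (poly (\<Prod>x\<in>#M. [:-x, 1:]) c)" if "set_mset M \<subseteq> {x. poly p x = 0}" for M
    using that
  proof (induction M)
    case (add x M)
    have "poly (\<Prod>x\<in>#add_mset x M. [:-x, 1:]) c = (c - x) * poly (\<Prod>x\<in>#M. [:-x, 1:]) c"
      by (simp add: algebra_simps)
    then show ?case using far[of x] assms(2) add by (simp add: norm_mult mult_mono)
  qed simp
  have "\<delta> ^ size (proots p) \<le> norm (poly p c)"
    using bound[of "proots p"] p0 unfolding decomp by simp
  then show False
    using assms(3) by (simp add: size_proots_complex)
qed

text \<open>A shortest linear relation cannot exist: applying \<open>A\<close> minus the eigenvalue
  of index \<open>j\<close> removes the term at \<open>j\<close> and multiplies the other
  coefficients by nonzero differences of eigenvalues.\<close>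

lemma eigenvectors_independent:
  fixes A P :: "complex^'n^'n"
  assumes AP: "A ** P = P ** diagm r" and inj: "inj (\<lambda>i. r$i)"
    and nz: "\<And>i. column i P \<noteq> 0"
  shows "P *v c = 0 \<Longrightarrow> c = 0"
proof (induction "card {i. c$i \<noteq> 0}" arbitrary: c rule: less_induct)
  case less
  show ?case
  proof (rule ccontr)
    assume "c \<noteq> 0"
    then obtain j where j: "c$j \<noteq> 0" by (auto simp: vec_eq_iff)
    define c' where "c' = diagm r *v c - r$j *s c"
    have c': "c'$i = (r$i - r$j) * c$i" for i
    proof -
      have "(diagm r *v c)$i = r$i * c$i"
        by (simp add: diagm_def matrix_vector_mult_def if_distrib[of "\<lambda>x. x * _"] cong: if_cong)
      then show ?thesis by (simp add: c'_def algebra_simps)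
    qed
    have "P *v c' = A *v (P *v c) - r$j *s (P *v c)"
      by (simp add: c'_def matrix_vector_mult_diff_distrib vector_scalar_commute matrix_vector_mul_assoc AP)
    then have "P *v c' = 0" using less.prems by simp
    moreover have "card {i. c'$i \<noteq> 0} < card {i. c$i \<noteq> 0}"
      by (rule psubset_card_mono) (use j c' in auto)
    ultimately have "c' = 0" using less.hyps by blast
    then have "c$i = 0" if "i \<noteq> j" for i
      using c'[of i] that inj by (auto simp: inj_def)
    then have "P *v c = c$j *s column j P"
    proof -
      have "(\<Sum>i\<in>UNIV. P$k$i * c$i) = (\<Sum>i\<in>UNIV. if i = j then c$j * P$k$j else 0)" for k
        by (rule sum.cong) (use \<open>\<And>i. i \<noteq> j \<Longrightarrow> c$i = 0\<close> in auto)
      then show ?thesis by (simp add: vec_eq_iff matrix_vector_mult_def column_def)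
    qed
    then show False using less.prems j nz[of j] by simp
  qed
qed

lemma diagonalizable_if_distinct_eigenvalues:
  fixes A :: "complex^'n^'n"
  assumes "inj (\<lambda>i. r$i)" "\<And>i. det (mat (r$i) - A) = 0"
  shows "diagonalizable A r"
proof -
  have "\<exists>v. v \<noteq> 0 \<and> A *v v = r$i *s v" for i
  proof -
    have "\<not> invertible (mat (r$i) - A)" using assms(2) by (simp add: invertible_det_nz)
    then have "\<not> (\<exists>B. B ** (mat (r$i) - A) = mat 1)"
      using matrix_left_right_inverse by (auto simp: invertible_def)
    then obtain v where "v \<noteq> 0" "(mat (r$i) - A) *v v = 0"
      using matrix_left_invertible_ker by blast
    moreover have "mat (r$i) *v v = r$i *s v"
      by (simp add: mat_def matrix_vector_mult_def vec_eq_iff if_distrib[of "\<lambda>x. x * _"] cong: if_cong)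
    ultimately show ?thesis by (auto simp: matrix_vector_mult_diff_rdistrib)
  qed
  then obtain v where v: "\<And>i. v i \<noteq> 0" "\<And>i. A *v v i = r$i *s v i" by metis
  define P :: "complex^'n^'n" where "P = (\<chi> k i. v i $ k)"
  have col: "column i P = v i" for i by (simp add: P_def column_def vec_eq_iff)
  have AP: "A ** P = P ** diagm r"
  proof -
    have "(A ** P) $ k $ i = (A *v v i) $ k" for k i
      by (simp add: P_def matrix_matrix_mult_def matrix_vector_mult_def)
    moreover have "(P ** diagm r) $ k $ i = r$i * v i $ k" for k i
      by (simp add: P_def diagm_def matrix_matrix_mult_def if_distrib[of "\<lambda>x. _ * x"] cong: if_cong)
    ultimately show ?thesis using v(2) by (simp add: vec_eq_iff)
  qed
  have "\<forall>c. P *v c = 0 \<longrightarrow> c = 0"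
    using eigenvectors_independent[OF AP assms(1)] v(1) col by auto
  then have "invertible P"
    using matrix_left_invertible_ker matrix_left_right_inverse unfolding invertible_def by metis
  moreover from this have "A = P ** diagm r ** matrix_inv P"
    by (metis AP matrix_inv_mult(1) matrix_mul_assoc matrix_mul_rid)
  ultimately show ?thesis by (auto simp: diagonalizable_def)
qed

lemma poly_curve_continuous: "poly_curve c \<Longrightarrow> continuous_on UNIV c"
  unfolding poly_curve_def by (auto intro!: continuous_intros)

text \<open>For small \<open>t\<close> the characteristic polynomial is small at every
  \<open>d$i\<close>, so by \<open>root_near\<close> it has a root close to each of them. The discs
  around the \<open>d$i\<close> are disjoint, which gives as many distinct eigenvalues as the size
  of the matrix.\<close>

lemma diagonalizable_near_diagm:
  fixes d :: "complex^'n" and M :: "complex^'n^'n"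
  assumes inj: "inj (\<lambda>i. d$i)"
  shows "\<forall>\<^sub>F t in at_right 0. \<exists>\<theta>. diagonalizable (diagm d + t *\<^sub>R M) \<theta>"
proof -
  \<comment> \<open>Half the smallest gap keeps the discs apart; the element 1 makes the minimum
    meaningful when there is only one index.\<close>
  define Y where "Y = insert 1 ((\<lambda>(i, j). norm (d$i - d$j) / 2) ` {(i, j). i \<noteq> j})"
  define \<delta> where "\<delta> = Min Y"
  have fin: "finite Y" by (auto simp: Y_def)
  have "\<forall>y\<in>Y. 0 < y" using inj by (auto simp: Y_def inj_def)
  then have \<delta>: "0 < \<delta>" using fin by (simp add: \<delta>_def Y_def)
  have sep: "2 * \<delta> \<le> norm (d$i - d$j)" if "i \<noteq> j" for i j
    using Min_le[OF fin, of "norm (d$i - d$j) / 2"] that by (force simp: \<delta>_def Y_def)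
  define c where "c i t = det (mat (d$i) - (diagm d + t *\<^sub>R M))" for i t
  have "poly_curve (c i)" for i
    unfolding c_def
    by (rule poly_curve_det) (simp add: scaleR_conv_of_real[where 'a = complex], intro poly_curve_intros)
  then have "(c i \<longlongrightarrow> c i 0) (at_right 0)" for i
    using poly_curve_continuous[of "c i"] by (auto simp: continuous_on_def intro: filterlim_mono at_le)
  moreover have "c i 0 = 0" for i
  proof -
    have "row i (mat (d$i) - (diagm d + 0 *\<^sub>R M)) = 0"
      by (simp add: row_def mat_def diagm_def vec_eq_iff)
    then show ?thesis unfolding c_def by (rule det_zero_row)
  qed
  ultimately have "((\<lambda>t. norm (c i t)) \<longlongrightarrow> 0) (at_right 0)" for i
    using tendsto_norm_zero[of "c i"] by metis
  then have "\<forall>\<^sub>F t in at_right 0. norm (c i t) < \<delta> ^ CARD('n)" for i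
    using order_tendstoD(2) \<delta> zero_less_power by blast
  then have "\<forall>\<^sub>F t in at_right 0. \<forall>i. norm (c i t) < \<delta> ^ CARD('n)"
    by (simp add: eventually_all_finite)
  then show ?thesis
  proof (rule eventually_mono)
    fix t assume small: "\<forall>i. norm (c i t) < \<delta> ^ CARD('n)"
    let ?A = "diagm d + t *\<^sub>R M"
    obtain p where p: "\<And>x. poly p x = det (mat x - ?A)" "lead_coeff p = 1" "degree p = CARD('n)"
      using monic_char_poly[of ?A] by blast
    have "\<exists>x. poly p x = 0 \<and> norm (d$i - x) < \<delta>" for i
      using small p by (intro root_near \<delta>) (auto simp: c_def)
    then obtain r where r: "\<And>i. poly p (r i) = 0" "\<And>i. norm (d$i - r i) < \<delta>" by metis
    have "inj (\<lambda>i. (\<chi> i. r i) $ i)"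
    proof (rule injI, rule ccontr)
      fix i j assume ij: "(\<chi> i. r i) $ i = (\<chi> i. r i) $ j" "i \<noteq> j"
      have "norm (d$i - d$j) \<le> norm (d$i - r i) + norm (d$j - r i)"
        using norm_triangle_ineq4[of "d$i - r i" "d$j - r i"] by simp
      then show False using r(2)[of i] r(2)[of j] sep[OF ij(2)] ij(1) by simp
    qed
    then have "diagonalizable ?A (\<chi> i. r i)"
      using r(1) p(1) by (intro diagonalizable_if_distinct_eigenvalues) auto
    then show "\<exists>\<theta>. diagonalizable ?A \<theta>" by blast
  qed
qed

lemma infinite_if_eventually_at_right:
  fixes P :: "real \<Rightarrow> bool"
  assumes "\<forall>\<^sub>F t in at_right a. P t"
  shows "infinite {t. P t}"
proof -
  obtain b where b: "a < b" "\<And>t. a < t \<Longrightarrow> t < b \<Longrightarrow> P t"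
    using assms by (auto simp: eventually_at_right[of a "a + 1"])
  then have "{a<..<b} \<subseteq> {t. P t}" by auto
  then show ?thesis using infinite_Ioo[OF b(1)] finite_subset by blast
qed

lemma poly_curve_assign:
  assumes "poly_curve z" "\<And>i j. poly_curve (\<lambda>t. L t $ i $ j)"
  shows "poly_curve (\<lambda>t. assign (z t) (L t) v)"
proof (cases v)
  case (Ecoord i j)
  then show ?thesis by (cases "i = j") (simp_all add: assign_def poly_curve_const assms)
qed (simp_all add: assign_def assms poly_curve_sum)

lemma diagonalizable_dense:
  fixes P Q :: "('n::{finite,linorder}) var mpoly"
  assumes "pvars P \<subseteq> valid_vars" "pvars Q \<subseteq> valid_vars"
    and eq: "\<And>z L \<theta>. L \<in> sl \<Longrightarrow> diagonalizable L \<theta> \<Longrightarrow> peval P (assign z L) = peval Q (assign z L)"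
  shows "P = Q"
proof (rule peval_assign_unique[OF assms(1,2)])
  fix z and L :: "'n cmat" assume L: "L \<in> sl"
  \<comment> \<open>\<open>e\<close> has pairwise distinct entries, and subtracting the mean keeps
    them distinct while making the trace 0. The line from \<open>diagm d\<close> reaches
    \<open>L\<close> at parameter 1.\<close>
  define e :: "'n cvec" where "e = (\<chi> i. of_nat (to_nat i))"
  define d :: "'n cvec" where "d = (\<chi> i. e$i - (\<Sum>k\<in>UNIV. e$k) / of_nat CARD('n))"
  have inj: "inj (\<lambda>i. d$i)" by (auto simp: d_def e_def inj_def)
  have "(\<Sum>k\<in>UNIV. d$k) = 0" by (simp add: d_def sum_subtractf)
  then have D: "trace (diagm d) = 0" by (simp add: trace_diagm)
  define A where "A t = diagm d + t *\<^sub>R (L - diagm d)" for t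
  define c where "c t = peval P (assign z (A t)) - peval Q (assign z (A t))" for t
  have A: "A t \<in> sl" for t
    using L D by (simp add: A_def sl_def trace_def sum.distrib sum_subtractf flip: scaleR_sum_right)
  have "poly_curve c"
    unfolding c_def
    by (intro poly_curve_diff poly_curve_peval poly_curve_assign poly_curve_const)
       (simp_all add: A_def scaleR_conv_of_real[where 'a = complex] poly_curve_add poly_curve_mult poly_curve_const poly_curve_id)
  moreover have "infinite {t. c t = 0}"
  proof (rule infinite_if_eventually_at_right)
    show "\<forall>\<^sub>F t in at_right 0. c t = 0"
      using diagonalizable_near_diagm[OF inj, of "L - diagm d"]
      by (rule eventually_mono) (use A eq in \<open>auto simp: c_def A_def\<close>)
  qed
  ultimately have "c 1 = 0" by (rule poly_curve_eq_0)
  then show "peval P (assign z L) = peval Q (assign z L)" by (simp add: c_def A_def)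
qed

lemma orbital_factor_eqI:
  assumes "pvars P \<subseteq> valid_vars"
    and "\<And>z L \<theta>. L \<in> sl \<Longrightarrow> diagonalizable L \<theta> \<Longrightarrow> peval P (assign z L) = (\<Prod>\<nu>\<in>orbit w. z + pair \<nu> \<theta>)"
  shows "orbital_factor w = P"
  unfolding orbital_factor_def
proof (rule the_equality)
  fix Q
  assume "pvars Q \<subseteq> valid_vars \<and> (\<forall>z0 L \<theta>. L \<in> sl \<and> diagonalizable L \<theta> \<longrightarrow>
    peval Q (assign z0 L) = (\<Prod>\<nu>\<in>orbit w. z0 + pair \<nu> \<theta>))"
  then show "Q = P" using assms by (intro diagonalizable_dense) auto
qed (use assms in auto)

lemma orbital_factor_spec:
  shows "pvars (orbital_factor w) \<subseteq> valid_vars"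
    and "L \<in> sl \<Longrightarrow> diagonalizable L \<theta> \<Longrightarrow>
      peval (orbital_factor w) (assign z L) = (\<Prod>\<nu>\<in>orbit w. z + pair \<nu> \<theta>)"
proof -
  obtain F where F: "realizable F"
      "\<And>z L \<theta>. L \<in> sl \<and> diagonalizable L \<theta> \<Longrightarrow> F z L = (\<Prod>\<nu>\<in>orbit w. z + pair \<nu> \<theta>)"
    using orbit_prod_realizable[of w] unfolding spectrally_realizable_def by blast
  then obtain P where P: "pvars P \<subseteq> valid_vars" "\<And>z L. L \<in> sl \<Longrightarrow> peval P (assign z L) = F z L"
    by (auto simp: realizable_def)
  have "orbital_factor w = P" using P F(2) by (intro orbital_factor_eqI) auto
  then show "pvars (orbital_factor w) \<subseteq> valid_vars"
    and "L \<in> sl \<Longrightarrow> diagonalizable L \<theta> \<Longrightarrow>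
      peval (orbital_factor w) (assign z L) = (\<Prod>\<nu>\<in>orbit w. z + pair \<nu> \<theta>)"
    using P F(2) by auto
qed

section \<open>Degree and irreducibility of the orbital factors\<close>

definition mdeg :: "('v \<Rightarrow>\<^sub>0 nat) \<Rightarrow> nat" where
  "mdeg m = (\<Sum>y\<in>Poly_Mapping.keys m. Poly_Mapping.lookup m y)"

lemma mdeg_le_total_degree: "m \<in> Poly_Mapping.keys p \<Longrightarrow> mdeg m \<le> total_degree p"
  unfolding total_degree_def mdeg_def by (rule Max_ge) auto

lemma total_degree_attained:
  assumes "p \<noteq> 0"
  shows "\<exists>m\<in>Poly_Mapping.keys p. mdeg m = total_degree p"
proof -
  have "Poly_Mapping.keys p \<noteq> {}" using assms by (metis keys_eq_empty)
  then have "total_degree p = Max (mdeg ` Poly_Mapping.keys p)"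
    unfolding total_degree_def mdeg_def by (subst Max_insert) auto
  moreover have "Max (mdeg ` Poly_Mapping.keys p) \<in> mdeg ` Poly_Mapping.keys p"
    using \<open>Poly_Mapping.keys p \<noteq> {}\<close> by (intro Max_in) auto
  ultimately show ?thesis by auto
qed

lemma mono_eval_scale: "mono_eval m (\<lambda>v. t * a v) = t ^ mdeg m * mono_eval m a"
  by (simp add: mono_eval_def mdeg_def power_mult_distrib prod.distrib power_sum)

definition hom_part :: "nat \<Rightarrow> 'v mpoly \<Rightarrow> 'v mpoly" where
  "hom_part k p = (\<Sum>m\<in>{m \<in> Poly_Mapping.keys p. mdeg m = k}. Poly_Mapping.single m (Poly_Mapping.lookup p m))"

lemma lookup_hom_part:
  "Poly_Mapping.lookup (hom_part k p) m = (if mdeg m = k then Poly_Mapping.lookup p m else 0)"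
proof -
  have "Poly_Mapping.lookup (hom_part k p) m =
      (\<Sum>m'\<in>{m \<in> Poly_Mapping.keys p. mdeg m = k}. if m' = m then Poly_Mapping.lookup p m else 0)"
    unfolding hom_part_def lookup_sum by (rule sum.cong) (auto simp: lookup_single when_def)
  then show ?thesis by (simp add: in_keys_iff)
qed

lemma keys_hom_part: "Poly_Mapping.keys (hom_part k p) = {m \<in> Poly_Mapping.keys p. mdeg m = k}"
  by (auto simp: in_keys_iff lookup_hom_part split: if_splits)

lemma pvars_hom_part: "pvars (hom_part k p) \<subseteq> pvars p"
  by (auto simp: pvars_def keys_hom_part)

text \<open>The restriction of \<open>p\<close> to the ray through \<open>a\<close>. Its
  coefficients are the values of the homogeneous parts at \<open>a\<close>, which reduces questions
  about total degree to univariate ones.\<close>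

definition radial :: "'v mpoly \<Rightarrow> ('v \<Rightarrow> complex) \<Rightarrow> complex poly" where
  "radial p a = (\<Sum>m\<in>Poly_Mapping.keys p. monom (Poly_Mapping.lookup p m * mono_eval m a) (mdeg m))"

lemma poly_radial: "poly (radial p a) t = peval p (\<lambda>v. t * a v)"
  by (simp add: radial_def poly_sum poly_monom peval_altdef mono_eval_scale mult_ac)

lemma coeff_radial: "coeff (radial p a) k = peval (hom_part k p) a"
proof -
  have "coeff (radial p a) k = (\<Sum>m\<in>Poly_Mapping.keys p. if mdeg m = k then Poly_Mapping.lookup p m * mono_eval m a else 0)"
    by (simp add: radial_def coeff_sum)
  also have "\<dots> = (\<Sum>m\<in>{m \<in> Poly_Mapping.keys p. mdeg m = k}. Poly_Mapping.lookup p m * mono_eval m a)"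
    by (simp add: sum.inter_filter)
  also have "\<dots> = peval (hom_part k p) a"
    by (auto simp: peval_altdef keys_hom_part lookup_hom_part intro!: sum.cong)
  finally show ?thesis .
qed

lemma degree_radial: "degree (radial p a) \<le> total_degree p"
  unfolding radial_def
  by (rule degree_sum_le) (auto intro: order.trans[OF degree_monom_le mdeg_le_total_degree])

lemma radial_mult: "radial (p * q) a = radial p a * radial q a"
  by (rule poly_ext) (simp add: poly_radial peval_mult)

text \<open>The line argument of \<open>poly_on_lines_mult_eq_0\<close>, carried out for valuations
  of the variables.\<close>

lemma common_nonvanishing_point:
  assumes "p \<noteq> 0" "q \<noteq> 0"
  shows "\<exists>a. peval p a \<noteq> 0 \<and> peval q a \<noteq> 0"
proof (rule ccontr)
  assume contra: "\<not> ?thesis"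
  obtain x y where xy: "peval p x \<noteq> 0" "peval q y \<noteq> 0"
    using assms peval_eq_0_imp_eq_0 by metis
  define c where "c t v = x v + of_real t * (y v - x v)" for t v
  have c: "poly_curve (\<lambda>t. c t v)" for v
    unfolding c_def by (intro poly_curve_intros)
  have "(\<forall>t. peval p (c t) = 0) \<or> (\<forall>t. peval q (c t) = 0)"
    using contra c by (intro poly_curve_mult_eq_0 poly_curve_peval) auto
  moreover have "c 0 = x" "c 1 = y" by (auto simp: c_def)
  ultimately show False using xy by metis
qed

text \<open>Along a ray on which neither top homogeneous part vanishes, the product has degree at
  least the sum of the total degrees.\<close>

lemma total_degree_mult_ge:
  assumes "p \<noteq> 0" "q \<noteq> 0"
  shows "total_degree p + total_degree q \<le> total_degree (p * q)"
proof -
  have top: "hom_part (total_degree r) r \<noteq> 0" if "r \<noteq> 0" for r :: "'a mpoly"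
  proof -
    obtain m where "m \<in> Poly_Mapping.keys r" "mdeg m = total_degree r"
      using total_degree_attained[OF \<open>r \<noteq> 0\<close>] by blast
    then have "m \<in> Poly_Mapping.keys (hom_part (total_degree r) r)" by (simp add: keys_hom_part)
    then show ?thesis by auto
  qed
  obtain a where "peval (hom_part (total_degree p) p) a \<noteq> 0" "peval (hom_part (total_degree q) q) a \<noteq> 0"
    using common_nonvanishing_point[OF top top] assms by blast
  then have nz: "coeff (radial p a) (total_degree p) \<noteq> 0" "coeff (radial q a) (total_degree q) \<noteq> 0"
    by (simp_all add: coeff_radial)
  then have "total_degree p + total_degree q \<le> degree (radial p a) + degree (radial q a)"
    by (intro add_mono le_degree)
  also have "\<dots> = degree (radial (p * q) a)"
    using nz by (subst radial_mult, subst degree_mult_eq) auto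
  also have "\<dots> \<le> total_degree (p * q)" by (rule degree_radial)
  finally show ?thesis .
qed

lemma unit_if_total_degree_0:
  assumes "p \<noteq> 0" "total_degree p = 0"
  shows "p dvd 1"
proof -
  have "mdeg m = 0" if "m \<in> Poly_Mapping.keys p" for m
    using mdeg_le_total_degree[OF that] assms(2) by simp
  then have "Poly_Mapping.keys m = {}" if "m \<in> Poly_Mapping.keys p" for m
    using that by (fastforce simp: mdeg_def in_keys_iff)
  then have "Poly_Mapping.keys p \<subseteq> {0}" using keys_eq_empty by blast
  moreover have "Poly_Mapping.keys p \<noteq> {}" using assms(1) keys_eq_empty by blast
  ultimately have k: "Poly_Mapping.keys p = {0}" by blast
  define c where "c = Poly_Mapping.lookup p 0"
  have p: "p = Poly_Mapping.single 0 c"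
    using sum_single_lookup[of p] by (simp add: k c_def)
  have "c \<noteq> 0" using k by (auto simp: c_def in_keys_iff[symmetric])
  then have "p * Poly_Mapping.single 0 (1 / c) = 1" by (simp add: p mult_single)
  then show ?thesis by (metis dvd_triv_left)
qed

text \<open>Used to bound a total degree from below by counting roots in the single variable
  \<open>Z0\<close>.\<close>

lemma univariate_specialization:
  obtains q where "\<And>x. poly q x = peval p (b(v := x))" "degree q \<le> total_degree p"
proof -
  define r where "r m = (\<Prod>y\<in>Poly_Mapping.keys m - {v}. b y ^ Poly_Mapping.lookup m y)" for m
  define q where "q = (\<Sum>m\<in>Poly_Mapping.keys p. monom (Poly_Mapping.lookup p m * r m) (Poly_Mapping.lookup m v))"
  have "mono_eval m (b(v := x)) = x ^ Poly_Mapping.lookup m v * r m" for m x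
  proof -
    have "mono_eval m (b(v := x)) = (\<Prod>y\<in>insert v (Poly_Mapping.keys m). (b(v := x)) y ^ Poly_Mapping.lookup m y)"
      by (rule mono_eval_superset) auto
    also have "\<dots> = x ^ Poly_Mapping.lookup m v *
        (\<Prod>y\<in>Poly_Mapping.keys m - {v}. (b(v := x)) y ^ Poly_Mapping.lookup m y)"
      by (subst prod.insert_remove) auto
    also have "(\<Prod>y\<in>Poly_Mapping.keys m - {v}. (b(v := x)) y ^ Poly_Mapping.lookup m y) = r m"
      unfolding r_def by (rule prod.cong) auto
    finally show ?thesis .
  qed
  then have "poly q x = peval p (b(v := x))" for x
    by (simp add: q_def poly_sum poly_monom peval_altdef mult_ac)
  moreover have "degree q \<le> total_degree p"
    unfolding q_def
  proof (rule degree_sum_le)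
    fix m assume m: "m \<in> Poly_Mapping.keys p"
    have "Poly_Mapping.lookup m v \<le> mdeg m"
    proof (cases "v \<in> Poly_Mapping.keys m")
      case True
      then show ?thesis unfolding mdeg_def by (intro member_le_sum) auto
    next
      case False
      then show ?thesis by (simp add: in_keys_iff)
    qed
    also have "\<dots> \<le> total_degree p" by (rule mdeg_le_total_degree[OF m])
    finally show "degree (monom (Poly_Mapping.lookup p m * r m) (Poly_Mapping.lookup m v)) \<le> total_degree p"
      using degree_monom_le order.trans by blast
  qed simp
  ultimately show ?thesis using that by blast
qed

section \<open>Generic points of the Cartan subalgebra\<close>

lemma pair_add_left: "pair (u + v) \<theta> = pair u \<theta> + pair v \<theta>"
  by (simp add: pair_def sum.distrib algebra_simps)

lemma pair_diff_left: "pair (u - v) \<theta> = pair u \<theta> - pair v \<theta>"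
  by (simp add: pair_def sum_subtractf algebra_simps)

lemma pair_scale: "pair u (c *s \<theta>) = c * pair u \<theta>"
  by (simp add: pair_def sum_distrib_left mult_ac)

lemma subspace_sum_zero: "subspace {\<theta> :: complex^'n. (\<Sum>i\<in>UNIV. \<theta>$i) = 0}"
  by (auto simp: subspace_def sum.distrib simp flip: scaleR_sum_right)

lemma generic_nonzero:
  fixes F :: "(complex^'n) set"
  assumes "finite F" "\<And>u. u \<in> F \<Longrightarrow> (\<Sum>i\<in>UNIV. u$i) = 0" "\<And>u. u \<in> F \<Longrightarrow> u \<noteq> 0"
  obtains \<theta> where "(\<Sum>i\<in>UNIV. \<theta>$i) = 0" "\<And>u. u \<in> F \<Longrightarrow> pair u \<theta> \<noteq> 0"
proof -
  have "\<exists>\<theta>\<in>{\<theta>. (\<Sum>i\<in>UNIV. \<theta>$i) = 0}. \<forall>u\<in>F. pair u \<theta> \<noteq> 0"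
  proof (rule common_nonzero[OF subspace_sum_zero assms(1)])
    fix u assume u: "u \<in> F"
    show "poly_on_lines {\<theta>. (\<Sum>i\<in>UNIV. \<theta>$i) = 0} (\<lambda>\<theta>. pair u \<theta>)"
      unfolding poly_on_lines_def pair_def
      by (intro ballI) (simp add: scaleR_conv_of_real[where 'a = complex], intro poly_curve_intros)
    \<comment> \<open>The complex conjugate of \<open>u\<close> has sum 0 as well, and pairing it
      with \<open>u\<close> gives the sum of the squared absolute values.\<close>
    define \<theta> where "\<theta> = (\<chi> i. cnj (u$i))"
    have "(\<Sum>i\<in>UNIV. \<theta>$i) = 0"
      using arg_cong[OF assms(2)[OF u], of cnj] by (simp add: \<theta>_def)
    moreover have "pair u \<theta> = of_real (\<Sum>i\<in>UNIV. (norm (u$i))\<^sup>2)"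
      by (simp only: pair_def \<theta>_def vec_lambda_beta of_real_sum complex_norm_square)
    moreover have "(\<Sum>i\<in>UNIV. (norm (u$i))\<^sup>2) \<noteq> 0"
      using assms(3)[OF u] by (subst sum_nonneg_eq_0_iff) (auto simp: vec_eq_iff)
    ultimately show "\<exists>\<theta>\<in>{\<theta>. (\<Sum>i\<in>UNIV. \<theta>$i) = 0}. pair u \<theta> \<noteq> 0"
      by (metis (mono_tags, lifting) mem_Collect_eq of_real_eq_0_iff)
  qed
  then show ?thesis using that by blast
qed

text \<open>Apply \<open>generic_nonzero\<close> to the differences. The common sum puts them into
  the space of vectors with sum 0, on which the pairing is nondegenerate.\<close>

lemma generic_separating:
  fixes X :: "(complex^'n) set"
  assumes "finite X" "\<And>u. u \<in> X \<Longrightarrow> (\<Sum>i\<in>UNIV. u$i) = s"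
  obtains \<theta> where "(\<Sum>i\<in>UNIV. \<theta>$i) = 0" "inj_on (\<lambda>u. pair u \<theta>) X"
proof -
  define F where "F = (\<lambda>(u, v). u - v) ` {(u, v) \<in> X \<times> X. u \<noteq> v}"
  have "finite F" unfolding F_def by (rule finite_imageI, rule finite_subset[of _ "X \<times> X"]) (use assms in auto)
  then obtain \<theta> where \<theta>: "(\<Sum>i\<in>UNIV. \<theta>$i) = 0" "\<And>u. u \<in> F \<Longrightarrow> pair u \<theta> \<noteq> 0"
    by (rule generic_nonzero) (use assms(2) in \<open>auto simp: F_def sum_subtractf\<close>)
  have "inj_on (\<lambda>u. pair u \<theta>) X"
  proof (rule inj_onI, rule ccontr)
    fix u v assume "u \<in> X" "v \<in> X" "pair u \<theta> = pair v \<theta>" "u \<noteq> v"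
    moreover from this have "u - v \<in> F" by (auto simp: F_def)
    ultimately show False using \<theta>(2)[of "u - v"] by (simp add: pair_diff_left)
  qed
  then show ?thesis using \<theta>(1) that by blast
qed

lemma sum_orbit: "\<nu> \<in> orbit w \<Longrightarrow> (\<Sum>i\<in>UNIV. \<nu>$i) = (\<Sum>i\<in>UNIV. w$i)"
  unfolding orbit_def using sum.permute[of _ UNIV "\<lambda>i. w$i"] by (auto simp: comp_def)

lemma orbit_refl: "w \<in> orbit w"
  unfolding orbit_def by (auto intro!: exI[of _ id] simp: permutes_id)

lemma diagonalizable_diagm: "diagonalizable (diagm \<theta>) \<theta>"
proof -
  have "invertible (mat 1 :: complex^'a^'a)" by (auto simp: invertible_def intro!: exI[of _ "mat 1"])
  moreover from matrix_inv_mult(1)[OF this] have "matrix_inv (mat 1) = (mat 1 :: complex^'a^'a)" by simp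
  ultimately show ?thesis unfolding diagonalizable_def by (intro exI[of _ "mat 1"]) simp
qed

lemma diagm_in_sl: "diagm \<theta> \<in> sl \<longleftrightarrow> (\<Sum>i\<in>UNIV. \<theta>$i) = 0"
  by (simp add: sl_eq_trace trace_diagm)

lemma cscale_mult_left: "cscale c A ** B = cscale c (A ** B)"
  by (simp add: cscale_def matrix_matrix_mult_def vec_eq_iff sum_distrib_left mult_ac)

lemma cscale_mult_right: "A ** cscale c B = cscale c (A ** B)"
  by (simp add: cscale_def matrix_matrix_mult_def vec_eq_iff sum_distrib_left mult_ac)

lemma cscale_diagm: "cscale c (diagm \<theta>) = diagm (c *s \<theta>)"
  by (simp add: cscale_def diagm_def vec_eq_iff)

lemma diagonalizable_cscale: "diagonalizable L \<theta> \<Longrightarrow> diagonalizable (cscale c L) (c *s \<theta>)"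
  unfolding diagonalizable_def
  by (auto simp: cscale_diagm[symmetric] cscale_mult_left cscale_mult_right)

lemma cscale_in_sl: "L \<in> sl \<Longrightarrow> cscale c L \<in> sl"
  by (simp add: sl_def cscale_def flip: sum_distrib_left)

lemma assign_cscale: "assign (c * z) (cscale c L) v = c * assign z L v"
  by (cases v) (simp_all add: assign_def cscale_def sum_distrib_left)

text \<open>Scaling \<open>z\<close> and \<open>L\<close> by \<open>t\<close> multiplies the orbit
  product by \<open>t\<close> to the size of the orbit, so the restriction to a ray is a monomial.
  The homogeneous part therefore has the values that characterize the orbital factor, and uniqueness
  identifies the two.\<close>

lemma hom_part_orbital_factor:
  fixes w :: "('n::{finite,linorder}) cvec"
  shows "hom_part (card (orbit w)) (orbital_factor w) = orbital_factor w"
proof (rule orbital_factor_eqI[symmetric])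
  show "pvars (hom_part (card (orbit w)) (orbital_factor w)) \<subseteq> valid_vars"
    by (rule order.trans[OF pvars_hom_part orbital_factor_spec(1)])
  fix z and L :: "'n cmat" and \<theta> assume L: "L \<in> sl" "diagonalizable L \<theta>"
  let ?c = "\<Prod>\<nu>\<in>orbit w. z + pair \<nu> \<theta>"
  have "poly (radial (orbital_factor w) (assign z L)) t = poly (monom ?c (card (orbit w))) t" for t
  proof -
    have "poly (radial (orbital_factor w) (assign z L)) t = peval (orbital_factor w) (assign (t * z) (cscale t L))"
      by (simp add: poly_radial flip: assign_cscale)
    also have "\<dots> = (\<Prod>\<nu>\<in>orbit w. t * z + pair \<nu> (t *s \<theta>))"
      using L by (intro orbital_factor_spec(2) cscale_in_sl diagonalizable_cscale)
    also have "\<dots> = t ^ card (orbit w) * ?c"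
      by (simp add: pair_scale prod.distrib flip: distrib_left)
    finally show ?thesis by (simp add: poly_monom mult_ac)
  qed
  then have "radial (orbital_factor w) (assign z L) = monom ?c (card (orbit w))"
    by (simp add: poly_ext)
  then show "peval (hom_part (card (orbit w)) (orbital_factor w)) (assign z L) = ?c"
    by (simp flip: coeff_radial)
qed

lemma orbital_factor_nonzero: "orbital_factor w \<noteq> 0"
proof
  assume "orbital_factor w = 0"
  moreover have "peval (orbital_factor w) (assign 1 (diagm 0)) = (\<Prod>\<nu>\<in>orbit w. 1 + pair \<nu> 0)"
    by (intro orbital_factor_spec diagonalizable_diagm) (simp add: diagm_in_sl)
  ultimately show False by (simp add: pair_def)
qed

lemma total_degree_orbital_factor: "total_degree (orbital_factor w) = card (orbit w)"
proof -
  obtain m where m: "m \<in> Poly_Mapping.keys (orbital_factor w)" "mdeg m = total_degree (orbital_factor w)"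
    using total_degree_attained[OF orbital_factor_nonzero] by blast
  then have "m \<in> Poly_Mapping.keys (hom_part (card (orbit w)) (orbital_factor w))"
    by (simp add: hom_part_orbital_factor)
  then show ?thesis using m(2) by (simp add: keys_hom_part)
qed

section \<open>Evaluation on conjugates of diagonal matrices\<close>

text \<open>The adjugate in the form of Cramer's rule: column \<open>i\<close> is replaced by the
  unit vector \<open>j\<close>. Its entries are polynomials in \<open>A\<close>, so lines may pass
  through singular matrices.\<close>

definition adjm :: "complex^'n^'n \<Rightarrow> complex^'n^'n" where
  "adjm A = (\<chi> i j. det (\<chi> k l. if l = i then (if k = j then 1 else 0) else A$k$l))"

lemma adjm_eq:
  fixes A :: "complex^'n^'n"
  assumes "det A \<noteq> 0"
  shows "adjm A = cscale (det A) (matrix_inv A)"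
proof -
  have inv: "A ** matrix_inv A = mat 1"
    using assms by (intro matrix_inv_mult) (simp add: invertible_det_nz)
  have "matrix_inv A $ i $ j = adjm A $ i $ j / det A" for i j
  proof -
    have "A *v column j (matrix_inv A) = axis j 1"
      using inv by (simp add: vec_eq_iff matrix_vector_mult_def matrix_matrix_mult_def column_def mat_def axis_def)
    then have "column j (matrix_inv A) = (\<chi> k. det (\<chi> i l. if l = k then axis j 1 $ i else A$i$l) / det A)"
      using cramer[OF assms] by blast
    from arg_cong[OF this, of "\<lambda>v. v $ i"] show ?thesis
      by (simp add: adjm_def column_def axis_def cong: if_cong)
  qed
  then show ?thesis using assms by (simp add: vec_eq_iff cscale_def)
qed

lemma poly_curve_adjm:
  fixes A :: "real \<Rightarrow> complex^'n^'n"
  assumes "\<And>i j. poly_curve (\<lambda>t. A t $ i $ j)"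
  shows "poly_curve (\<lambda>t. adjm (A t) $ i $ j)"
  unfolding adjm_def by (simp, intro poly_curve_det) (simp add: poly_curve_if poly_curve_const assms)

definition perm_mat :: "('n \<Rightarrow> 'n) \<Rightarrow> complex^'n^'n" where
  "perm_mat \<sigma> = (\<chi> i j. if j = \<sigma> i then 1 else 0)"

lemma invertible_perm_mat:
  fixes \<sigma> :: "'n::finite \<Rightarrow> 'n"
  assumes "\<sigma> permutes UNIV"
  shows "invertible (perm_mat \<sigma>)"
proof -
  have "perm_mat \<sigma> ** perm_mat (inv \<sigma>) = mat 1"
    using assms by (simp add: perm_mat_def matrix_matrix_mult_def vec_eq_iff mat_def if_distrib[of "\<lambda>x. x * _"]
        permutes_inverses cong: if_cong)
  then show ?thesis using matrix_left_right_inverse unfolding invertible_def by blast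
qed

lemma diagm_mult_entry: "(diagm \<theta> ** A) $ i $ j = \<theta>$i * A$i$j"
  by (simp add: diagm_def matrix_matrix_mult_def if_distrib[of "\<lambda>x. x * _"] cong: if_cong)

lemma mult_diagm_entry: "(A ** diagm \<theta>) $ i $ j = A$i$j * \<theta>$j"
  by (simp add: diagm_def matrix_matrix_mult_def if_distrib[of "\<lambda>x. _ * x"] cong: if_cong)

lemma perm_mat_conj:
  fixes \<sigma> :: "'n::finite \<Rightarrow> 'n"
  assumes "\<sigma> permutes UNIV"
  shows "perm_mat \<sigma> ** diagm \<theta> ** matrix_inv (perm_mat \<sigma>) = diagm (\<chi> i. \<theta>$\<sigma> i)"
proof -
  have "perm_mat \<sigma> ** diagm \<theta> = diagm (\<chi> i. \<theta>$\<sigma> i) ** perm_mat \<sigma>"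
    by (simp add: vec_eq_iff diagm_mult_entry mult_diagm_entry perm_mat_def)
  then show ?thesis
    by (simp add: matrix_inv_mult(1)[OF invertible_perm_mat[OF assms]] flip: matrix_mul_assoc)
qed

text \<open>The adjugate is \<open>det g\<close> times the inverse, so for invertible
  \<open>g\<close> the matrix is the conjugate of the diagonal matrix of
  \<open>det g *s \<theta>\<close>. The first argument is rescaled in the same way, which keeps it
  minus the value of \<open>w\<close> on that diagonal matrix.\<close>

definition conj_eval :: "('n::{finite,linorder}) var mpoly \<Rightarrow> 'n cvec \<Rightarrow> 'n cmat \<times> 'n cvec \<Rightarrow> complex" where
  "conj_eval Q w = (\<lambda>(g, \<theta>). peval Q (assign (- pair w (det g *s \<theta>)) (g ** diagm \<theta> ** adjm g)))"

lemma conj_eval_eq: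
  assumes "invertible g"
  shows "conj_eval Q w (g, \<theta>) =
    peval Q (assign (- pair w (det g *s \<theta>)) (g ** diagm (det g *s \<theta>) ** matrix_inv g))"
  using assms
  by (simp add: conj_eval_def adjm_eq invertible_det_nz cscale_mult_right cscale_mult_left flip: cscale_diagm)

lemma poly_on_lines_conj_eval: "poly_on_lines S (conj_eval Q w)"
  unfolding poly_on_lines_def
proof (intro ballI)
  fix a b :: "('a::{finite,linorder}) cmat \<times> 'a cvec"
  obtain g \<theta> h \<eta> where ab: "a = (g, \<theta>)" "b = (h, \<eta>)" by force
  have g: "poly_curve (\<lambda>t. (g + t *\<^sub>R h) $ i $ j)" and t: "poly_curve (\<lambda>t. (\<theta> + t *\<^sub>R \<eta>) $ i)" for i j
    by (simp_all add: scaleR_conv_of_real[where 'a = complex] poly_curve_add poly_curve_mult poly_curve_const poly_curve_id)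
  have d: "poly_curve (\<lambda>t. diagm (\<theta> + t *\<^sub>R \<eta>) $ i $ j)" for i j
    using t by (simp add: diagm_def poly_curve_if poly_curve_const)
  have p: "poly_curve (\<lambda>t. pair w (det (g + t *\<^sub>R h) *s (\<theta> + t *\<^sub>R \<eta>)))"
    unfolding pair_scale unfolding pair_def by (intro poly_curve_mult poly_curve_sum poly_curve_const poly_curve_det g t)
  show "poly_curve (\<lambda>t. conj_eval Q w (a + t *\<^sub>R b))"
    unfolding ab conj_eval_def scaleR_Pair add_Pair prod.case
    by (intro poly_curve_peval poly_curve_assign poly_curve_matrix_mult poly_curve_adjm poly_curve_minus p g d)
qed

lemma total_degree_ge_if_conj_eval_vanishes:
  fixes w :: "('n::{finite,linorder}) cvec"
  assumes fac: "orbital_factor w = Q * R"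
    and van: "\<And>g \<theta>. (\<Sum>i\<in>UNIV. \<theta>$i) = 0 \<Longrightarrow> conj_eval Q w (g, \<theta>) = 0"
  shows "card (orbit w) \<le> total_degree Q"
proof -
  have zero: "peval Q (assign (- pair \<nu> \<eta>) (diagm \<eta>)) = 0"
    if \<eta>: "(\<Sum>i\<in>UNIV. \<eta>$i) = 0" and "\<nu> \<in> orbit w" for \<eta> \<nu>
  proof -
    obtain \<sigma> where \<sigma>: "\<sigma> permutes UNIV" "\<nu> = (\<chi> i. w$\<sigma> i)"
      using \<open>\<nu> \<in> orbit w\<close> by (auto simp: orbit_def)
    \<comment> \<open>Permuting \<open>\<eta>\<close> backwards makes conjugation by the permutation
      matrix produce \<open>diagm \<eta>\<close> itself.\<close>
    define \<theta> where "\<theta> = (\<chi> i. \<eta>$inv \<sigma> i)"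
    let ?g = "perm_mat \<sigma>"
    have inv: "invertible ?g" "det ?g \<noteq> 0"
      using invertible_perm_mat[OF \<sigma>(1)] invertible_det_nz by auto
    have \<theta>\<sigma>: "(\<chi> i. \<theta>$\<sigma> i) = \<eta>" using \<sigma>(1) by (simp add: \<theta>_def permutes_inverses vec_eq_iff)
    \<comment> \<open>Dividing by the determinant cancels the factor built into
      \<open>conj_eval\<close>.\<close>
    have "(\<Sum>i\<in>UNIV. ((1 / det ?g) *s \<theta>)$i) = 0"
      using \<eta> sum.permute[OF permutes_inv[OF \<sigma>(1)], of "\<lambda>i. \<eta>$i"]
      by (simp add: \<theta>_def comp_def flip: sum_divide_distrib)
    from van[OF this, of ?g] have "peval Q (assign (- pair w \<theta>) (diagm \<eta>)) = 0"
      using inv by (simp add: conj_eval_eq perm_mat_conj[OF \<sigma>(1)] \<theta>\<sigma> vector_smult_assoc)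
    then show ?thesis using pair_permute[OF \<sigma>(1), of w \<theta>] \<sigma>(2) \<theta>\<sigma> by simp
  qed
  \<comment> \<open>\<open>\<eta>\<close> separates the orbit, so the zeros found above are as many
    distinct roots as the orbit has elements.\<close>
  obtain \<eta> where \<eta>: "(\<Sum>i\<in>UNIV. \<eta>$i) = 0" "inj_on (\<lambda>\<nu>. pair \<nu> \<eta>) (orbit w)"
    using generic_separating[OF finite_orbit sum_orbit] by blast
  obtain q where q: "\<And>x. poly q x = peval Q ((assign 0 (diagm \<eta>))(Z0 := x))" "degree q \<le> total_degree Q"
    using univariate_specialization[of Q "assign 0 (diagm \<eta>)" Z0] by metis
  have "(assign 0 (diagm \<eta>))(Z0 := x) = assign x (diagm \<eta>)" for x
    by (auto simp: assign_def fun_eq_iff split: var.split)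
  then have q1: "poly q x = peval Q (assign x (diagm \<eta>))" for x using q(1) by simp
  \<comment> \<open>If \<open>q\<close> were 0, the whole orbital factor would vanish at
    \<open>diagm \<eta>\<close> for every \<open>z\<close>, whereas its roots there are finitely
    many.\<close>
  have "q \<noteq> 0"
  proof
    assume "q = 0"
    have "infinite (UNIV - (\<lambda>\<nu>. - pair \<nu> \<eta>) ` orbit w)"
      using finite_orbit[of w] infinite_UNIV_char_0[where 'a = complex] by (meson Diff_infinite_finite finite_imageI)
    then obtain x where x: "x \<notin> (\<lambda>\<nu>. - pair \<nu> \<eta>) ` orbit w"
      by (metis DiffD2 ex_in_conv finite.emptyI)
    have "(\<Prod>\<nu>\<in>orbit w. x + pair \<nu> \<eta>) = peval (orbital_factor w) (assign x (diagm \<eta>))"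
      by (rule orbital_factor_spec(2)[symmetric]) (simp_all add: diagm_in_sl \<eta> diagonalizable_diagm)
    also have "\<dots> = 0" using q1[of x] \<open>q = 0\<close> by (simp add: fac peval_mult)
    finally have "\<exists>\<nu>\<in>orbit w. x + pair \<nu> \<eta> = 0" using finite_orbit[of w] by (simp add: prod_zero_iff)
    then show False using x by (auto simp flip: eq_neg_iff_add_eq_0)
  qed
  have "card (orbit w) = card ((\<lambda>\<nu>. - pair \<nu> \<eta>) ` orbit w)"
    using \<eta>(2) by (subst card_image) (auto simp: inj_on_def)
  also have "\<dots> \<le> card {x. poly q x = 0}"
    using q1 zero[OF \<eta>(1)] by (intro card_mono poly_roots_finite[OF \<open>q \<noteq> 0\<close>]) auto
  also have "\<dots> \<le> degree q" using \<open>q \<noteq> 0\<close> by (rule card_poly_roots_bound)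
  finally show ?thesis using q(2) by simp
qed

lemma conj_eval_factor_vanishes:
  fixes w :: "('n::{finite,linorder}) cvec"
  assumes fac: "orbital_factor w = Q * R"
  shows "(\<forall>g \<theta>. (\<Sum>i\<in>UNIV. \<theta>$i) = 0 \<longrightarrow> conj_eval Q w (g, \<theta>) = 0) \<or>
         (\<forall>g \<theta>. (\<Sum>i\<in>UNIV. \<theta>$i) = 0 \<longrightarrow> conj_eval R w (g, \<theta>) = 0)"
proof -
  define S where "S = (UNIV :: 'n cmat set) \<times> {\<theta> :: 'n cvec. (\<Sum>i\<in>UNIV. \<theta>$i) = 0}"
  have S: "subspace S" unfolding S_def by (intro subspace_Times subspace_UNIV subspace_sum_zero)
  \<comment> \<open>The product of the two factors is known to vanish only for invertible
    \<open>g\<close>. The determinant makes the identity hold on all of \<open>S\<close>; since it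
    is nonzero at the identity matrix, it is split off again at the end.\<close>
  have zero: "conj_eval Q w x * (conj_eval R w x * det (fst x)) = 0" if x: "x \<in> S" for x
  proof (cases "det (fst x) = 0")
    case False
    obtain g \<theta> where gt: "x = (g, \<theta>)" by force
    then have inv: "invertible g" using False by (simp add: invertible_det_nz)
    let ?L = "g ** diagm (det g *s \<theta>) ** matrix_inv g"
    have "(\<Sum>i\<in>UNIV. \<theta>$i) = 0" using x gt by (simp add: S_def)
    then have "?L \<in> sl"
      using inv by (simp add: sl_eq_trace trace_conj trace_diagm flip: sum_distrib_left)
    moreover have "diagonalizable ?L (det g *s \<theta>)" using inv by (auto simp: diagonalizable_def)
    ultimately have "peval (orbital_factor w) (assign (- pair w (det g *s \<theta>)) ?L) =
        (\<Prod>\<nu>\<in>orbit w. - pair w (det g *s \<theta>) + pair \<nu> (det g *s \<theta>))"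
      by (rule orbital_factor_spec(2))
    also have "\<dots> = 0" by (intro prod_zero finite_orbit bexI[of _ w] orbit_refl) simp
    finally have "conj_eval Q w x * conj_eval R w x = 0"
      unfolding gt conj_eval_eq[OF inv] fac peval_mult .
    then show ?thesis by auto
  qed simp
  have pol: "poly_on_lines S (\<lambda>x. det (fst x))"
    unfolding poly_on_lines_def
    by (intro ballI poly_curve_det)
       (simp add: scaleR_conv_of_real[where 'a = complex] poly_curve_add poly_curve_mult poly_curve_const poly_curve_id)
  have "poly_on_lines S (\<lambda>x. conj_eval R w x * det (fst x))"
    using pol poly_on_lines_conj_eval[of S R w] by (simp add: poly_on_lines_def poly_curve_mult)
  from poly_on_lines_mult_eq_0[OF S poly_on_lines_conj_eval this zero]
  consider "\<forall>x\<in>S. conj_eval Q w x = 0" | "\<forall>x\<in>S. conj_eval R w x * det (fst x) = 0" by blast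
  then show ?thesis
  proof cases
    case 2
    have "(mat 1, 0) \<in> S" by (simp add: S_def)
    then have "\<not> (\<forall>x\<in>S. det (fst x) = 0)" by force
    moreover from 2 have "(\<forall>x\<in>S. conj_eval R w x = 0) \<or> (\<forall>x\<in>S. det (fst x) = 0)"
      by (intro poly_on_lines_mult_eq_0[OF S poly_on_lines_conj_eval pol]) blast
    ultimately have "\<forall>x\<in>S. conj_eval R w x = 0" by blast
    then show ?thesis by (simp add: S_def)
  qed (simp add: S_def)
qed

lemma irreducible_orbital_factor: "irreducible (orbital_factor w)"
proof (rule irreducibleI)
  have k: "0 < card (orbit w)" using orbit_refl finite_orbit card_gt_0_iff by blast
  show "orbital_factor w \<noteq> 0" by (rule orbital_factor_nonzero)
  show "\<not> orbital_factor w dvd 1"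
  proof
    assume "orbital_factor w dvd 1"
    then obtain q where q: "1 = orbital_factor w * q" by blast
    then have "q \<noteq> 0" by auto
    then have "card (orbit w) + total_degree q \<le> total_degree (1 :: 'a var mpoly)"
      using total_degree_mult_ge[OF orbital_factor_nonzero, of q w] q by (simp add: total_degree_orbital_factor)
    then show False using k by (simp add: total_degree_def)
  qed
  fix Q R assume fac: "orbital_factor w = Q * R"
  then have nz: "Q \<noteq> 0" "R \<noteq> 0" using orbital_factor_nonzero[of w] by auto
  then have le: "total_degree Q + total_degree R \<le> card (orbit w)"
    using total_degree_mult_ge[of Q R] total_degree_orbital_factor[of w] fac by simp
  have fac': "orbital_factor w = R * Q" using fac by (simp add: mult.commute)
  from conj_eval_factor_vanishes[OF fac] show "Q dvd 1 \<or> R dvd 1"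
  proof
    assume "\<forall>g \<theta>. (\<Sum>i\<in>UNIV. \<theta>$i) = 0 \<longrightarrow> conj_eval Q w (g, \<theta>) = 0"
    then have "total_degree R = 0"
      using total_degree_ge_if_conj_eval_vanishes[OF fac] le by force
    then show ?thesis using unit_if_total_degree_0 nz by blast
  next
    assume "\<forall>g \<theta>. (\<Sum>i\<in>UNIV. \<theta>$i) = 0 \<longrightarrow> conj_eval R w (g, \<theta>) = 0"
    then have "total_degree Q = 0"
      using total_degree_ge_if_conj_eval_vanishes[OF fac'] le by force
    then show ?thesis using unit_if_total_degree_0 nz by blast
  qed
qed

section \<open>Conjugation invariance of the characteristic determinant\<close>

lemma cscale_1 [simp]: "cscale 1 A = A"
  by (simp add: cscale_def vec_eq_iff)

lemma bounded_bilinear_matrix_mult: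
  "bounded_bilinear ((**) :: complex^'n^'m \<Rightarrow> complex^'k^'n \<Rightarrow> complex^'k^'m)"
  unfolding bilinear_conv_bounded_bilinear[symmetric] bilinear_def
  by (auto intro!: linearI simp: vec_eq_iff matrix_matrix_mult_def algebra_simps sum.distrib scaleR_sum_right)

lemmas matrix_mult_bilinear =
  bounded_bilinear.add_left[OF bounded_bilinear_matrix_mult]
  bounded_bilinear.add_right[OF bounded_bilinear_matrix_mult]
  bounded_bilinear.diff_left[OF bounded_bilinear_matrix_mult]
  bounded_bilinear.diff_right[OF bounded_bilinear_matrix_mult]
  bounded_bilinear.scaleR_left[OF bounded_bilinear_matrix_mult]
  bounded_bilinear.scaleR_right[OF bounded_bilinear_matrix_mult]

text \<open>A spanning family of \<open>sl\<close> indexed by all pairs. The diagonal members are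
  corrected at one fixed index, for which \<open>undefined\<close> serves; the member at that index
  is 0.\<close>

definition sl_gen :: "'n \<Rightarrow> 'n \<Rightarrow> complex^'n^'n" where
  "sl_gen i j = Emat i j - (if i = j then Emat undefined undefined else 0)"

lemma sl_gen_in_sl: "sl_gen i j \<in> sl"
proof -
  have "trace (Emat i j :: complex^'a^'a) = (if i = j then 1 else 0)" for i j
    unfolding trace_def Emat_def by (cases "i = j") (auto intro!: sum.neutral)
  moreover have "trace (0 :: complex^'a^'a) = 0" by (simp add: trace_def)
  ultimately show ?thesis by (simp add: sl_eq_trace sl_gen_def trace_sub)
qed

lemma zero_in_sl: "0 \<in> sl"
  by (simp add: sl_def)

lemma add_in_sl: "A \<in> sl \<Longrightarrow> B \<in> sl \<Longrightarrow> A + B \<in> sl"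
  by (simp add: sl_def sum.distrib)

lemma sum_in_sl: "(\<And>x. x \<in> S \<Longrightarrow> M x \<in> sl) \<Longrightarrow> sum M S \<in> sl"
  by (induction S rule: infinite_finite_induct) (simp_all add: zero_in_sl add_in_sl)

text \<open>The corrections at the fixed index add up to the trace of \<open>L\<close>, which is
  0.\<close>

lemma sl_expand:
  fixes L :: "complex^'n^'n"
  assumes "L \<in> sl"
  shows "L = (\<Sum>(i, j)\<in>UNIV. cscale (L$i$j) (sl_gen i j))"
proof -
  have "(\<Sum>(i, j)\<in>UNIV. cscale (L$i$j) (sl_gen i j)) $ k $ l = L $ k $ l" for k l
  proof -
    have "(\<Sum>(i, j)\<in>UNIV. cscale (L$i$j) (sl_gen i j)) $ k $ l =
        (\<Sum>i\<in>UNIV. \<Sum>j\<in>UNIV. L$i$j * (sl_gen i j $ k $ l))"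
      by (simp add: sum_component case_prod_beta cscale_def sum.cartesian_product flip: UNIV_Times_UNIV)
    also have "\<dots> = (\<Sum>i\<in>UNIV. \<Sum>j\<in>UNIV. (if l = j then (if k = i then L$i$j else 0) else 0) -
        (if i = j then (if k = undefined \<and> l = undefined then L$i$i else 0) else 0))"
      by (intro sum.cong refl) (auto simp: sl_gen_def Emat_def)
    also have "\<dots> = L$k$l - (\<Sum>i\<in>UNIV. if k = undefined \<and> l = undefined then L$i$i else 0)"
      by (simp add: sum_subtractf)
    also have "\<dots> = L$k$l"
      using assms by (cases "k = undefined \<and> l = undefined") (auto simp: sl_def)
    finally show ?thesis .
  qed
  then show ?thesis by (simp add: vec_eq_iff)
qed

lemma rep_zero: "is_rep \<phi> \<Longrightarrow> \<phi> 0 = 0"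
proof -
  assume "is_rep \<phi>"
  then have "\<phi> (cscale 1 0 + 0) = cscale 1 (\<phi> 0) + \<phi> 0"
    using zero_in_sl unfolding is_rep_def by blast
  then show ?thesis by simp
qed

lemma rep_sum:
  assumes "is_rep \<phi>" "finite S" "\<And>x. x \<in> S \<Longrightarrow> M x \<in> sl"
  shows "\<phi> (\<Sum>x\<in>S. cscale (c x) (M x)) = (\<Sum>x\<in>S. cscale (c x) (\<phi> (M x)))"
  using assms(2,3)
proof (induction S rule: finite_induct)
  case empty
  then show ?case using rep_zero[OF assms(1)] by simp
next
  case (insert x S)
  have "(\<Sum>x\<in>S. cscale (c x) (M x)) \<in> sl" using insert by (intro sum_in_sl cscale_in_sl) auto
  then have "\<phi> (cscale (c x) (M x) + (\<Sum>x\<in>S. cscale (c x) (M x))) =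
      cscale (c x) (\<phi> (M x)) + \<phi> (\<Sum>x\<in>S. cscale (c x) (M x))"
    using assms(1) insert.prems[of x] unfolding is_rep_def by blast
  then show ?case using insert by simp
qed

text \<open>A representation is constrained only on \<open>sl\<close>; this is a linear map on all matrices agreeing with it there.\<close>

definition lin_ext :: "(complex^'n^'n \<Rightarrow> complex^'d^'d) \<Rightarrow> complex^'n^'n \<Rightarrow> complex^'d^'d" where
  "lin_ext \<phi> L = (\<Sum>(i, j)\<in>UNIV. cscale (L$i$j) (\<phi> (sl_gen i j)))"

lemma lin_ext_eq:
  assumes "is_rep \<phi>" "L \<in> sl"
  shows "lin_ext \<phi> L = \<phi> L"
proof -
  have "\<phi> L = \<phi> (\<Sum>p\<in>UNIV. cscale (L$fst p$snd p) (sl_gen (fst p) (snd p)))"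
    using sl_expand[OF assms(2)] by (simp add: case_prod_beta)
  also have "\<dots> = lin_ext \<phi> L"
    by (subst rep_sum[OF assms(1)]) (simp_all add: sl_gen_in_sl lin_ext_def case_prod_beta)
  finally show ?thesis by simp
qed

lemma lin_ext_entry: "lin_ext \<phi> L $ a $ b = (\<Sum>(i, j)\<in>UNIV. L$i$j * \<phi> (sl_gen i j) $ a $ b)"
  by (simp add: lin_ext_def sum_component case_prod_beta cscale_def)

lemma lin_ext_cscale: "lin_ext \<phi> (cscale c L) = cscale c (lin_ext \<phi> L)"
  by (simp add: vec_eq_iff lin_ext_entry cscale_def sum_distrib_left case_prod_beta mult_ac)

lemma bounded_linear_lin_ext: "bounded_linear (lin_ext \<phi>)"
  unfolding linear_conv_bounded_linear[symmetric]
  by (rule linearI)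
     (simp_all add: vec_eq_iff lin_ext_entry case_prod_beta sum.distrib algebra_simps scaleR_right.sum)

lemma realizable_char_det:
  fixes \<phi> :: "('n::{finite,linorder}) cmat \<Rightarrow> ('d::finite) cmat"
  assumes "is_rep \<phi>"
  shows "realizable (\<lambda>z L. det (mat z + \<phi> L))"
proof -
  have "realizable (\<lambda>z L. det (mat z + lin_ext \<phi> L))"
  proof (rule realizable_det)
    fix i j :: 'd
    have "realizable (\<lambda>z (L :: 'n cmat). mat z $ i $ j :: complex)"
      by (cases "i = j") (simp_all add: mat_def realizable_z realizable_const)
    then show "realizable (\<lambda>z L. (mat z + lin_ext \<phi> L) $ i $ j)"
      by (simp add: lin_ext_entry case_prod_beta realizable_add realizable_sum realizable_mult
          realizable_entry realizable_const)
  qed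
  then show ?thesis by (rule realizable_cong) (simp add: lin_ext_eq assms)
qed

text \<open>A polynomial with the right values on all of \<open>sl\<close> exists by
  \<open>realizable_char_det\<close>; by density it equals any \<open>P\<close> that is correct on
  the diagonalizable matrices.\<close>

lemma f_phi_eqI:
  fixes \<phi> :: "('n::{finite,linorder}) cmat \<Rightarrow> ('d::finite) cmat"
  assumes rep: "is_rep \<phi>" and P: "pvars P \<subseteq> valid_vars"
    and eq: "\<And>z L \<theta>. L \<in> sl \<Longrightarrow> diagonalizable L \<theta> \<Longrightarrow> peval P (assign z L) = det (mat z + \<phi> L)"
  shows "f_phi \<phi> = P"
proof -
  obtain Q where Q: "pvars Q \<subseteq> valid_vars" "\<And>z L. L \<in> sl \<Longrightarrow> peval Q (assign z L) = det (mat z + \<phi> L)"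
    using realizable_char_det[OF rep] unfolding realizable_def by blast
  have "P = Q" using P Q eq by (intro diagonalizable_dense) auto
  moreover have "f_phi \<phi> = Q"
    unfolding f_phi_def
  proof (rule the_equality)
    fix R assume "pvars R \<subseteq> valid_vars \<and> (\<forall>z0 L. L \<in> sl \<longrightarrow> peval R (assign z0 L) = det (mat z0 + \<phi> L))"
    then show "R = Q" using Q by (intro peval_assign_unique) auto
  qed (use Q in auto)
  ultimately show ?thesis by simp
qed

lemma det_differentiable: "det differentiable (at (M :: complex^'d^'d))"
proof -
  have e: "(\<lambda>A :: complex^'d^'d. A $ i $ j) differentiable (at M)" for i j
    by (intro bounded_linear_imp_differentiable bounded_linear_compose[OF bounded_linear_vec_nth bounded_linear_vec_nth])
  have p: "(\<lambda>A :: complex^'d^'d. \<Prod>i\<in>I. A $ i $ \<sigma> i) differentiable (at M)" for I \<sigma>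
    by (induction I rule: infinite_finite_induct) (simp_all add: e differentiable_mult)
  show ?thesis
    unfolding det_def
    by (intro differentiable_sum differentiable_mult differentiable_const p ballI finite_permutations) auto
qed

text \<open>The curve \<open>s \<mapsto> det ((1 + s X) M (1 - s X))\<close> is even in \<open>s\<close> and has the bracket as its velocity at 0.\<close>

lemma det_derivative_bracket:
  fixes M X :: "complex^'d^'d"
  assumes "(det has_derivative D) (at M)"
  shows "D (X ** M - M ** X) = 0"
proof -
  define h where "h s = (mat 1 + s *\<^sub>R X) ** M ** (mat 1 - s *\<^sub>R X)" for s :: real
  define e where "e s = det (h s)" for s
  have h: "h s = M + s *\<^sub>R (X ** M - M ** X) - s\<^sup>2 *\<^sub>R (X ** M ** X)" for s
    by (simp add: h_def matrix_mult_bilinear matrix_mul_assoc power2_eq_square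
        algebra_simps)
  have "(h has_vector_derivative (X ** M - M ** X)) (at 0)"
    unfolding h by (auto intro!: derivative_eq_intros simp: has_vector_derivative_def)
  moreover have "h 0 = M" by (simp add: h)
  ultimately have "(e has_vector_derivative D (X ** M - M ** X)) (at 0)"
    unfolding e_def using assms
    by (intro vector_derivative_diff_chain_within[of h _ 0 UNIV det D, unfolded comp_def])
       (simp_all add: has_derivative_at_withinI)
  moreover have "(\<lambda>s. e (- s)) = e"
    by (simp add: fun_eq_iff e_def h_def det_mul mult_ac)
  moreover have "((\<lambda>s. e (- s)) has_vector_derivative - v) (at 0)" if "(e has_vector_derivative v) (at 0)" for v
  proof -
    have "(uminus has_vector_derivative (-1)) (at (0::real))"
      using has_vector_derivative_minus[OF has_vector_derivative_id[of "at (0::real)"]] by simp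
    then show ?thesis using that vector_diff_chain_at[of uminus "-1" 0 e v] by (simp add: comp_def)
  qed
  ultimately have "(e has_vector_derivative - D (X ** M - M ** X)) (at 0)" by metis
  then have "- D (X ** M - M ** X) = D (X ** M - M ** X)"
    using \<open>(e has_vector_derivative D (X ** M - M ** X)) (at 0)\<close> by (rule vector_derivative_unique_at)
  then show ?thesis by simp
qed

lemma rep_bracket:
  assumes "is_rep \<phi>" "A \<in> sl" "B \<in> sl"
  shows "\<phi> (bracket A B) = bracket (\<phi> A) (\<phi> B)"
  using assms unfolding is_rep_def by blast

lemma bracket_in_sl: "bracket A B \<in> sl"
  by (simp add: sl_eq_trace bracket_def trace_sub trace_mul_sym[of A B])

lemma mat_commute: "mat c ** A = A ** (mat c :: complex^'n^'n)"
  by (simp add: vec_eq_iff matrix_matrix_mult_def mat_def if_distrib[of "\<lambda>x. x * _"]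
      if_distrib[of "\<lambda>x. _ * x"] mult.commute cong: if_cong)

text \<open>The representation carries the velocity of \<open>L\<close> to a bracket with
  \<open>\<phi> X\<close>. The scalar matrix \<open>mat z\<close> commutes with everything, so the
  same bracket is the velocity of the whole matrix, and \<open>det_derivative_bracket\<close>
  applies.\<close>

lemma char_det_derivative_zero:
  fixes L :: "real \<Rightarrow> complex^'n^'n" and \<phi> :: "complex^'n^'n \<Rightarrow> complex^'d^'d"
  assumes rep: "is_rep \<phi>" and X: "X \<in> sl" and L: "L s \<in> sl"
    and der: "(L has_vector_derivative bracket X (L s)) (at s)"
  shows "((\<lambda>s. det (mat z + lin_ext \<phi> (L s))) has_vector_derivative 0) (at s)"
proof -
  define M where "M = mat z + lin_ext \<phi> (L s)"
  obtain D where D: "(det has_derivative D) (at M)" using det_differentiable by (auto simp: differentiable_def)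
  have "((\<lambda>s. mat z + lin_ext \<phi> (L s)) has_vector_derivative 0 + lin_ext \<phi> (bracket X (L s))) (at s)"
    by (intro has_vector_derivative_add has_vector_derivative_const
        bounded_linear.has_vector_derivative[OF bounded_linear_lin_ext der])
  moreover have "lin_ext \<phi> (bracket X (L s)) = bracket (\<phi> X) (lin_ext \<phi> (L s))"
    using assms by (simp add: lin_ext_eq bracket_in_sl rep_bracket)
  moreover have "bracket (\<phi> X) (lin_ext \<phi> (L s)) = \<phi> X ** M - M ** \<phi> X"
    by (simp add: M_def bracket_def matrix_mult_bilinear mat_commute)
  ultimately have "((\<lambda>s. mat z + lin_ext \<phi> (L s)) has_vector_derivative (\<phi> X ** M - M ** \<phi> X)) (at s)"
    by simp
  then have "((\<lambda>s. det (mat z + lin_ext \<phi> (L s))) has_vector_derivative D (\<phi> X ** M - M ** \<phi> X)) (at s)"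
    using D unfolding M_def
    by (intro vector_derivative_diff_chain_within[of _ _ s UNIV det D, unfolded comp_def])
       (simp_all add: has_derivative_at_withinI)
  then show ?thesis by (simp add: det_derivative_bracket[OF D])
qed

lemma has_vector_derivative_entrywise:
  fixes L :: "real \<Rightarrow> complex^'n^'n"
  assumes "\<And>i j. \<exists>d. ((\<lambda>s. L s $ i $ j) has_vector_derivative d) (at s)"
  shows "\<exists>d. (L has_vector_derivative d) (at s)"
proof -
  obtain d where d: "\<And>i j. ((\<lambda>s. L s $ i $ j) has_vector_derivative d i j) (at s)"
    using assms by metis
  have lin: "bounded_linear (\<lambda>c. cscale c A)" for A :: "complex^'n^'n"
    unfolding linear_conv_bounded_linear[symmetric]
    by (rule linearI) (simp_all add: cscale_def vec_eq_iff algebra_simps)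
  have "L s = (\<Sum>i\<in>UNIV. \<Sum>j\<in>UNIV. cscale (L s $ i $ j) (Emat i j))" for s
  proof -
    have "(\<Sum>i\<in>UNIV. \<Sum>j\<in>UNIV. cscale (L s $ i $ j) (Emat i j)) $ k $ l = L s $ k $ l" for k l
    proof -
      have "(\<Sum>i\<in>UNIV. \<Sum>j\<in>UNIV. cscale (L s $ i $ j) (Emat i j)) $ k $ l =
          (\<Sum>i\<in>UNIV. \<Sum>j\<in>UNIV. if l = j then (if k = i then L s $ i $ j else 0) else 0)"
        unfolding sum_component by (intro sum.cong refl) (auto simp: cscale_def Emat_def)
      then show ?thesis by simp
    qed
    then show ?thesis by (simp add: vec_eq_iff)
  qed
  then have "L = (\<lambda>s. \<Sum>i\<in>UNIV. \<Sum>j\<in>UNIV. cscale (L s $ i $ j) (Emat i j))" by blast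
  moreover have "((\<lambda>s. \<Sum>i\<in>UNIV. \<Sum>j\<in>UNIV. cscale (L s $ i $ j) (Emat i j)) has_vector_derivative
      (\<Sum>i\<in>UNIV. \<Sum>j\<in>UNIV. cscale (d i j) (Emat i j))) (at s)"
    by (intro has_vector_derivative_sum bounded_linear.has_vector_derivative[OF lin d])
  ultimately show ?thesis by metis
qed

lemma poly_curve_has_vector_derivative:
  assumes "poly_curve c"
  shows "\<exists>d. (c has_vector_derivative d) (at s)"
proof -
  obtain p where p: "c = (\<lambda>t. poly p (of_real t))"
    using assms by (auto simp: poly_curve_def)
  have "((\<lambda>t. poly p (of_real t)) has_vector_derivative poly (pderiv p) (of_real s)) (at s)"
    by (intro has_vector_derivative_real_field poly_DERIV)
  then show ?thesis using p by blast
qed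

lemma det_cscale: "det (cscale c (A :: complex^'n^'n)) = c ^ CARD('n) * det A"
  by (simp add: det_def cscale_def prod.distrib sum_distrib_left mult_ac)

lemma cscale_mat: "cscale c (mat z) = mat (c * z)"
  by (simp add: cscale_def mat_def vec_eq_iff)

lemma cscale_add: "cscale c (A + B) = cscale c A + cscale c B"
  by (simp add: cscale_def vec_eq_iff algebra_simps)

lemma cscale_cscale: "cscale c (cscale d A) = cscale (c * d) A"
  by (simp add: cscale_def vec_eq_iff)

text \<open>Once the adjugate formula shows that \<open>L\<close> is differentiable, the relation
  \<open>L s ** A s = A s ** L0\<close>, valid near the given point, is differentiated. Solving for
  the velocity gives the bracket with \<open>A'\<close> times the inverse of \<open>A s\<close>, and
  the inverse itself never has to be differentiated.\<close>

lemma conj_curve_derivative: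
  fixes A :: "real \<Rightarrow> complex^'n^'n" and L0 :: "complex^'n^'n"
  defines "L \<equiv> \<lambda>s. cscale (1 / det (A s)) (A s ** L0 ** adjm (A s))"
  assumes A: "\<And>i j. poly_curve (\<lambda>s. A s $ i $ j)" and nz: "\<And>s. s \<in> S \<Longrightarrow> det (A s) \<noteq> 0"
    and S: "open S" "s \<in> S"
  shows "\<exists>X\<in>sl. (L has_vector_derivative bracket X (L s)) (at s)"
proof -
  have inv: "L s = A s ** L0 ** matrix_inv (A s)" "matrix_inv (A s) ** A s = mat 1" "A s ** matrix_inv (A s) = mat 1"
    if "s \<in> S" for s
    using nz[OF that] matrix_inv_mult[of "A s"]
    by (auto simp: L_def adjm_eq cscale_mult_right cscale_cscale invertible_det_nz)
  have "\<exists>d. (L has_vector_derivative d) (at s)"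
  proof (rule has_vector_derivative_entrywise)
    fix i j
    have "poly_curve (\<lambda>s. det (A s))" "poly_curve (\<lambda>s. (A s ** L0 ** adjm (A s)) $ i $ j)"
      by (intro poly_curve_det poly_curve_matrix_mult poly_curve_adjm poly_curve_const A)+
    from this[THEN poly_curve_has_vector_derivative, of s]
    have "(\<lambda>s. det (A s)) differentiable (at s)" "(\<lambda>s. (A s ** L0 ** adjm (A s)) $ i $ j) differentiable (at s)"
      by (auto intro: differentiableI_vector)
    then have "(\<lambda>s. (A s ** L0 ** adjm (A s)) $ i $ j / det (A s)) differentiable (at s)"
      using nz[OF S(2)] by (intro differentiable_divide)
    then show "\<exists>d. ((\<lambda>s. L s $ i $ j) has_vector_derivative d) (at s)"
      unfolding vector_derivative_works L_def cscale_def by auto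
  qed
  then obtain L' where L': "(L has_vector_derivative L') (at s)" by blast
  obtain A' where A': "(A has_vector_derivative A') (at s)"
    using has_vector_derivative_entrywise[of A s] poly_curve_has_vector_derivative[OF A] by blast
  have "((\<lambda>s. L s ** A s) has_vector_derivative (L s ** A' + L' ** A s)) (at s)"
    by (rule bounded_bilinear.has_vector_derivative[OF bounded_bilinear_matrix_mult L' A'])
  moreover have "((\<lambda>s. A s ** L0) has_vector_derivative (A s ** 0 + A' ** L0)) (at s)"
    by (rule bounded_bilinear.has_vector_derivative[OF bounded_bilinear_matrix_mult A' has_vector_derivative_const])
  then have "((\<lambda>s. L s ** A s) has_vector_derivative (A s ** 0 + A' ** L0)) (at s)"
    by (rule has_vector_derivative_transform_within_open[OF _ S])
       (metis inv(1,2) matrix_mul_assoc matrix_mul_rid)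
  ultimately have eq: "L s ** A' + L' ** A s = A' ** L0"
    using vector_derivative_unique_at by fastforce
  define Y where "Y = A' ** matrix_inv (A s)"
  \<comment> \<open>Subtracting the scalar part puts the matrix into \<open>sl\<close> and leaves
    the bracket unchanged.\<close>
  define X where "X = Y - mat (trace Y / of_nat CARD('n))"
  have "(L s ** A' + L' ** A s) ** matrix_inv (A s) = L s ** Y + L'"
    using inv(3)[OF S(2)] by (simp add: Y_def matrix_mult_bilinear flip: matrix_mul_assoc)
  moreover have "A' ** L0 ** matrix_inv (A s) = Y ** L s"
    unfolding Y_def inv(1)[OF S(2)] using inv(2)[OF S(2)] by (metis matrix_mul_assoc matrix_mul_lid)
  ultimately have "L' = Y ** L s - L s ** Y"
    using eq by (simp add: algebra_simps)
  also have "\<dots> = bracket X (L s)"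
    by (simp add: bracket_def X_def matrix_mult_bilinear mat_commute)
  finally have "L' = bracket X (L s)" .
  moreover have "X \<in> sl" by (simp add: sl_eq_trace X_def trace_sub) (simp add: trace_def mat_def)
  ultimately show ?thesis using L' by blast
qed

lemma conj_in_sl:
  fixes g L :: "complex^'n^'n"
  assumes "invertible g" "L \<in> sl"
  shows "g ** L ** matrix_inv g \<in> sl"
  using assms by (simp add: sl_eq_trace trace_conj)

text \<open>The segment from 1 to \<open>g\<close> may leave the invertible matrices, but after clearing denominators
  the claim is a polynomial identity along it, which only has to be checked near 1.\<close>

lemma char_det_conj_invariant:
  fixes \<phi> :: "complex^'n^'n \<Rightarrow> complex^'d^'d" and g L0 :: "complex^'n^'n"
  assumes rep: "is_rep \<phi>" and g: "invertible g" and L0: "L0 \<in> sl"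
  shows "det (mat z + \<phi> (g ** L0 ** matrix_inv g)) = det (mat z + \<phi> L0)"
proof -
  define A where "A s = mat 1 + s *\<^sub>R (g - mat 1)" for s :: real
  define L where "L s = cscale (1 / det (A s)) (A s ** L0 ** adjm (A s))" for s
  \<comment> \<open>The exponent is the dimension of the representation: rescaling a matrix of that
    size by \<open>det (A s)\<close> multiplies its determinant by this power.\<close>
  define \<Psi> where "\<Psi> s = det (mat (det (A s) * z) + lin_ext \<phi> (A s ** L0 ** adjm (A s)))
      - det (A s) ^ CARD('d) * det (mat z + lin_ext \<phi> L0)" for s
  have A: "poly_curve (\<lambda>s. A s $ i $ j)" for i j
    unfolding A_def
    by (simp add: scaleR_conv_of_real[where 'a = complex] poly_curve_add poly_curve_mult poly_curve_const poly_curve_id)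
  have detA: "poly_curve (\<lambda>s. det (A s))" by (rule poly_curve_det[OF A])
  have \<Psi>: "\<Psi> s = det (A s) ^ CARD('d) * (det (mat z + lin_ext \<phi> (L s)) - det (mat z + lin_ext \<phi> L0))"
    if "det (A s) \<noteq> 0" for s
  proof -
    have "A s ** L0 ** adjm (A s) = cscale (det (A s)) (L s)" using that by (simp add: L_def cscale_cscale)
    then have "mat (det (A s) * z) + lin_ext \<phi> (A s ** L0 ** adjm (A s)) =
        cscale (det (A s)) (mat z + lin_ext \<phi> (L s))"
      by (simp add: lin_ext_cscale cscale_add cscale_mat)
    then show ?thesis by (simp add: \<Psi>_def det_cscale right_diff_distrib)
  qed
  have Ls: "L s = A s ** L0 ** matrix_inv (A s)" "L s \<in> sl" if "det (A s) \<noteq> 0" for s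
  proof -
    show "L s = A s ** L0 ** matrix_inv (A s)"
      using that by (simp add: L_def adjm_eq cscale_mult_right cscale_cscale)
    then show "L s \<in> sl" using that L0 by (simp add: conj_in_sl invertible_det_nz)
  qed
  have "open {s. det (A s) \<noteq> 0}"
    using poly_curve_continuous[OF detA] by (intro open_Collect_neq continuous_on_const) auto
  moreover have A0: "det (A 0) = 1" by (simp add: A_def)
  ultimately obtain \<epsilon> where \<epsilon>: "\<epsilon> > 0" "ball 0 \<epsilon> \<subseteq> {s. det (A s) \<noteq> 0}"
    by (metis (mono_tags, lifting) mem_Collect_eq openE zero_neq_one)
  define S :: "real set" where "S = ball 0 \<epsilon>"
  have nz: "det (A s) \<noteq> 0" if "s \<in> S" for s using \<epsilon>(2) that by (auto simp: S_def)
  have "((\<lambda>s. det (mat z + lin_ext \<phi> (L s))) has_vector_derivative 0) (at s within S)" if s: "s \<in> S" for s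
  proof -
    obtain X where "X \<in> sl" "(L has_vector_derivative bracket X (L s)) (at s)"
      using conj_curve_derivative[of A S s L0] A nz s unfolding L_def S_def by auto
    then show ?thesis
      by (intro has_vector_derivative_at_within[OF char_det_derivative_zero[OF rep]]) (use Ls(2) nz[OF s] in auto)
  qed
  then obtain c where c: "\<And>s. s \<in> S \<Longrightarrow> det (mat z + lin_ext \<phi> (L s)) = c"
    using has_vector_derivative_zero_constant[of S "\<lambda>s. det (mat z + lin_ext \<phi> (L s))"]
    by (auto simp: S_def)
  have "L 0 = L0"
  proof -
    have "A 0 = mat 1" by (simp add: A_def)
    moreover from this matrix_inv_mult(1)[of "A 0"] have "matrix_inv (A 0) = mat 1"
      using A0 by (simp add: invertible_det_nz)
    ultimately show ?thesis using Ls(1)[of 0] A0 by simp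
  qed
  then have "det (mat z + lin_ext \<phi> L0) = c" using c[of 0] \<epsilon>(1) by (simp add: S_def)
  then have "\<Psi> s = 0" if "s \<in> S" for s
    using \<Psi>[OF nz[OF that]] c[OF that] by simp
  then have "S \<subseteq> {s. \<Psi> s = 0}" by auto
  moreover have "infinite S" using \<epsilon>(1) by (simp add: S_def ball_eq_greaterThanLessThan infinite_Ioo)
  ultimately have "infinite {s. \<Psi> s = 0}" by (rule infinite_super)
  moreover have "poly_curve \<Psi>"
  proof -
    have "poly_curve (\<lambda>s. (A s ** L0 ** adjm (A s)) $ i $ j)" for i j
      by (intro poly_curve_matrix_mult poly_curve_adjm poly_curve_const A)
    then have "poly_curve (\<lambda>s. (mat (det (A s) * z) + lin_ext \<phi> (A s ** L0 ** adjm (A s))) $ i $ j)" for i j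
      by (cases "i = j") (simp_all add: mat_def lin_ext_entry case_prod_beta poly_curve_intros detA)
    then show ?thesis unfolding \<Psi>_def
      by (intro poly_curve_diff poly_curve_mult poly_curve_power poly_curve_det detA poly_curve_const)
  qed
  ultimately have "\<Psi> 1 = 0" using poly_curve_eq_0 by blast
  moreover have "A 1 = g" by (simp add: A_def)
  moreover have "det g \<noteq> 0" using g by (simp add: invertible_det_nz)
  ultimately have "det (mat z + lin_ext \<phi> (L 1)) = det (mat z + lin_ext \<phi> L0)"
    using \<Psi>[of 1] by simp
  then show ?thesis
    using Ls[of 1] \<open>A 1 = g\<close> \<open>det g \<noteq> 0\<close> L0 rep by (simp add: lin_ext_eq)
qed

section \<open>Weights\<close>

lemma rep_cscale:
  assumes "is_rep \<phi>" "A \<in> sl"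
  shows "\<phi> (cscale c A) = cscale c (\<phi> A)"
proof -
  have "\<phi> (cscale c A + 0) = cscale c (\<phi> A) + \<phi> 0"
    using assms zero_in_sl unfolding is_rep_def by blast
  then show ?thesis using rep_zero[OF assms(1)] by simp
qed

lemma cscale_vector_mult: "cscale c A *v v = c *s (A *v v)"
  by (simp add: cscale_def matrix_vector_mult_def vec_eq_iff sum_distrib_left mult_ac)

lemma Emat_in_sl: "i \<noteq> j \<Longrightarrow> Emat i j \<in> sl"
  using sl_gen_in_sl[of i j] by (simp add: sl_gen_def)

lemma bracket_diagm_Emat: "bracket (diagm \<theta>) (Emat i j) = cscale (\<theta>$i - \<theta>$j) (Emat i j)"
  by (simp add: bracket_def vec_eq_iff diagm_mult_entry mult_diagm_entry Emat_def cscale_def algebra_simps)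

lemma pair_axis: "pair (axis i 1) \<theta> = \<theta>$i"
  by (simp add: pair_def axis_def if_distrib[of "\<lambda>x. x * _"] cong: if_cong)

lemma Emat_shifts_weight:
  assumes rep: "is_rep \<phi>" and "i \<noteq> j" and v: "v \<in> weight_space \<phi> w"
  shows "\<phi> (Emat i j) *v v \<in> weight_space \<phi> (w + (axis i 1 - axis j 1))"
  unfolding weight_space_def
proof (intro CollectI allI impI)
  fix \<theta> :: "complex^'a" assume \<theta>: "(\<Sum>i\<in>UNIV. \<theta>$i) = 0"
  let ?D = "\<phi> (diagm \<theta>)" and ?E = "\<phi> (Emat i j)"
  have "?D ** ?E - ?E ** ?D = cscale (\<theta>$i - \<theta>$j) ?E"
    using rep_bracket[OF rep, of "diagm \<theta>" "Emat i j"] \<theta> \<open>i \<noteq> j\<close>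
    by (simp add: bracket_diagm_Emat diagm_in_sl Emat_in_sl rep_cscale[OF rep]) (simp add: bracket_def)
  then have "(?D ** ?E) *v v = (?E ** ?D + cscale (\<theta>$i - \<theta>$j) ?E) *v v"
    by (simp add: algebra_simps)
  moreover have "?D *v v = pair w \<theta> *s v" using v \<theta> by (simp add: weight_space_def)
  ultimately show "?D *v (?E *v v) = pair (w + (axis i 1 - axis j 1)) \<theta> *s (?E *v v)"
    by (simp add: matrix_vector_mul_assoc[symmetric] matrix_vector_mult_add_rdistrib cscale_vector_mult
        vector_scalar_commute pair_add_left pair_diff_left pair_axis vec.scale_left_distrib)
qed

lemma subspace_weight_space: "vec.subspace (weight_space \<phi> w)"
  unfolding vec.subspace_def weight_space_def
  by (auto simp: matrix_vector_right_distrib vec.scale_right_distrib vector_scalar_commute mult.commute)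

lemma sl_gen_weight_space:
  assumes rep: "is_rep \<phi>" and v: "v \<in> weight_space \<phi> w"
  shows "\<exists>i' j'. \<phi> (sl_gen i j) *v v \<in> weight_space \<phi> (w + (axis i' 1 - axis j' 1))"
proof (cases "i = j")
  case False
  then show ?thesis using Emat_shifts_weight[OF rep False v] by (auto simp: sl_gen_def)
next
  case True
  have "sl_gen i j = diagm (axis i 1 - axis undefined 1)"
    using True by (auto simp: sl_gen_def Emat_def diagm_def vec_eq_iff axis_def)
  then have "\<phi> (sl_gen i j) *v v = pair w (axis i 1 - axis undefined 1) *s v"
    using v sl_gen_in_sl[of i j] by (simp add: weight_space_def diagm_in_sl)
  \<comment> \<open>A diagonal generator preserves the weight; the shift is written as a zero
    difference so that both cases have the same shape.\<close>
  then have "\<phi> (sl_gen i j) *v v \<in> weight_space \<phi> (w + (axis i 1 - axis i 1))"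
    using v vec.subspace_scale[OF subspace_weight_space] by simp
  then show ?thesis by blast
qed

text \<open>The span is invariant, because every generator of \<open>sl\<close> moves a weight space
  with weight in \<open>R\<close> into another such space, and it contains \<open>v0\<close>.
  Irreducibility then leaves only the full space. Keeping \<open>R\<close> arbitrary allows
  arithmetic information about weights to be built into it.\<close>

lemma span_weight_spaces:
  fixes \<phi> :: "complex^'n^'n \<Rightarrow> complex^'d^'d"
  assumes irr: "irreducible_rep \<phi>" and w0: "w0 \<in> R" "v0 \<in> weight_space \<phi> w0" "v0 \<noteq> 0"
    and R: "\<And>w i j. w \<in> R \<Longrightarrow> w + (axis i 1 - axis j 1) \<in> R"
  shows "vec.span (\<Union>w\<in>R. weight_space \<phi> w) = UNIV"
proof -
  let ?G = "\<Union>w\<in>R. weight_space \<phi> w"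
  let ?U = "vec.span ?G"
  have rep: "is_rep \<phi>" using irr by (simp add: irreducible_rep_def)
  have inv: "\<phi> A *v v \<in> ?U" if A: "A \<in> sl" and v: "v \<in> ?U" for A v
  proof -
    have "?U \<subseteq> {v. \<phi> A *v v \<in> ?U}"
    proof (rule vec.span_minimal)
      show "vec.subspace {v. \<phi> A *v v \<in> ?U}"
        unfolding vec.subspace_def
        by (auto simp: matrix_vector_right_distrib vector_scalar_commute vec.span_add vec.span_scale vec.span_zero)
      show "?G \<subseteq> {v. \<phi> A *v v \<in> ?U}"
      proof
        fix v assume "v \<in> ?G"
        then obtain w where w: "w \<in> R" "v \<in> weight_space \<phi> w" by blast
        have "\<phi> A *v v = lin_ext \<phi> A *v v" using lin_ext_eq[OF rep A] by simp
        also have "\<dots> = (\<Sum>p\<in>UNIV. A$fst p$snd p *s (\<phi> (sl_gen (fst p) (snd p)) *v v))"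
        proof -
          have "(\<Sum>p\<in>S. M p) *v v = (\<Sum>p\<in>S. M p *v v)" for S and M :: "'n \<times> 'n \<Rightarrow> complex^'d^'d"
            by (induction S rule: infinite_finite_induct) (simp_all add: matrix_vector_mult_add_rdistrib)
          then show ?thesis by (simp add: lin_ext_def case_prod_beta cscale_vector_mult)
        qed
        also have "\<dots> \<in> ?U"
        proof (intro vec.span_sum vec.span_scale)
          fix p :: "'n \<times> 'n"
          obtain i' j' where "\<phi> (sl_gen (fst p) (snd p)) *v v \<in> weight_space \<phi> (w + (axis i' 1 - axis j' 1))"
            using sl_gen_weight_space[OF rep w(2)] by blast
          then show "\<phi> (sl_gen (fst p) (snd p)) *v v \<in> ?U"
            using R[OF w(1)] by (intro vec.span_base) blast
        qed
        finally show "v \<in> {v. \<phi> A *v v \<in> ?U}" by simp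
      qed
    qed
    then show ?thesis using v by blast
  qed
  have "csubspace ?U"
    unfolding csubspace_def by (auto intro: vec.span_zero vec.span_add vec.span_scale)
  then have "?U = {0} \<or> ?U = UNIV" using irr inv unfolding irreducible_rep_def by blast
  moreover have "v0 \<in> ?U" using w0 by (intro vec.span_base) blast
  ultimately show ?thesis using w0(3) by blast
qed

text \<open>The basis is indexed by the coordinate type, so it can serve as the columns of a square
  matrix and the list \<open>wt\<close> records each weight with its multiplicity.\<close>

lemma weight_vector_basis:
  fixes \<phi> :: "complex^'n^'n \<Rightarrow> complex^'d^'d"
  assumes span: "vec.span (\<Union>w\<in>R. weight_space \<phi> w) = UNIV"
  obtains b :: "'d \<Rightarrow> complex^'d" and wt :: "'d \<Rightarrow> complex^'n" where
    "inj b" "vec.independent (range b)" "vec.span (range b) = UNIV"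
    "\<And>i. wt i \<in> R" "\<And>i. b i \<in> weight_space \<phi> (wt i)"
proof -
  obtain B where B: "B \<subseteq> (\<Union>w\<in>R. weight_space \<phi> w)" "vec.independent B"
      "(\<Union>w\<in>R. weight_space \<phi> w) \<subseteq> vec.span B"
    using vec.maximal_independent_subset by blast
  have spanB: "vec.span B = UNIV"
    using vec.span_minimal[OF B(3) vec.subspace_span] span by blast
  have "finite B" by (rule vec.finiteI_independent[OF B(2)])
  moreover have "card B = CARD('d)"
    using vec.dim_eq_card_independent[OF B(2)] vec.dim_span[of B] spanB by (simp add: vec_dim_card card_cart_basis)
  ultimately obtain b where b: "bij_betw b (UNIV :: 'd set) B"
    using finite_same_card_bij[of "UNIV :: 'd set" B] by auto
  then have rb: "range b = B" "inj b" by (auto simp: bij_betw_def)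
  have "\<forall>i. \<exists>w. w \<in> R \<and> b i \<in> weight_space \<phi> w" using rb(1) B(1) by blast
  then obtain wt where "\<And>i. wt i \<in> R \<and> b i \<in> weight_space \<phi> (wt i)" by metis
  then show ?thesis using that[of b wt] rb B(2) spanB by simp
qed

lemma pair_separates:
  fixes u :: "complex^'n"
  assumes "(\<Sum>i\<in>UNIV. u$i) = 0" "u \<noteq> 0"
  obtains \<theta> where "(\<Sum>i\<in>UNIV. \<theta>$i) = 0" "pair u \<theta> \<noteq> 0"
  using generic_nonzero[of "{u}"] assms by auto

text \<open>If the weight of a basis vector differs from \<open>w\<close>, some
  \<open>\<theta>\<close> separates the two. Applying \<open>\<phi> (diagm \<theta>)\<close> minus
  the scalar \<open>pair w \<theta>\<close> kills \<open>v\<close> but only rescales that basis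
  vector by a nonzero factor, so its coefficient in \<open>v\<close> is 0.\<close>

lemma weight_space_basis_span:
  fixes \<phi> :: "complex^'n^'n \<Rightarrow> complex^'d^'d" and b :: "'d \<Rightarrow> complex^'d"
  assumes b: "inj b" "vec.independent (range b)" "vec.span (range b) = UNIV"
    and wt: "\<And>i. b i \<in> weight_space \<phi> (wt i)" "\<And>i. (\<Sum>k\<in>UNIV. wt i $ k) = 0"
    and w: "(\<Sum>k\<in>UNIV. w$k) = 0"
  shows "weight_space \<phi> w = vec.span (b ` {i. wt i = w})"
proof
  show "vec.span (b ` {i. wt i = w}) \<subseteq> weight_space \<phi> w"
    by (rule vec.span_minimal[OF _ subspace_weight_space]) (use wt(1) in auto)
  show "weight_space \<phi> w \<subseteq> vec.span (b ` {i. wt i = w})"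
  proof
    fix v assume v: "v \<in> weight_space \<phi> w"
    have "v \<in> range (\<lambda>u. \<Sum>x\<in>range b. u x *s x)"
      using b(3) vec.span_finite[of "range b"] by auto
    then obtain u where "v = (\<Sum>x\<in>range b. u x *s x)" by blast
    then have vu: "v = (\<Sum>i\<in>UNIV. u (b i) *s b i)" using b(1) by (simp add: sum.reindex)
    have "u (b k) = 0" if k: "wt k \<noteq> w" for k
    proof -
      obtain \<theta> where \<theta>: "(\<Sum>i\<in>UNIV. \<theta>$i) = 0" "pair (wt k - w) \<theta> \<noteq> 0"
        using pair_separates[of "wt k - w"] k wt(2) w by (auto simp: sum_subtractf)
      define c where "c x = (pair (wt (inv b x)) \<theta> - pair w \<theta>) * u x" for x
      have "\<phi> (diagm \<theta>) *v v = (\<Sum>i\<in>UNIV. u (b i) *s (\<phi> (diagm \<theta>) *v b i))"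
        unfolding vu by (simp add: vec.linear_sum[OF matrix_vector_mul_linear_gen] vector_scalar_commute)
      also have "\<dots> = (\<Sum>i\<in>UNIV. (u (b i) * pair (wt i) \<theta>) *s b i)"
        using wt(1) \<theta>(1) by (simp add: weight_space_def)
      finally have "(\<Sum>i\<in>UNIV. (u (b i) * pair (wt i) \<theta>) *s b i) = pair w \<theta> *s v"
        using v \<theta>(1) by (simp add: weight_space_def)
      then have "(\<Sum>i\<in>UNIV. (u (b i) * pair (wt i) \<theta>) *s b i) - (\<Sum>i\<in>UNIV. (pair w \<theta> * u (b i)) *s b i) = 0"
        by (simp add: vu vec.scale_sum_right)
      moreover have "c (b i) = u (b i) * pair (wt i) \<theta> - pair w \<theta> * u (b i)" for i
        using b(1) by (simp add: c_def algebra_simps)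
      ultimately have "(\<Sum>i\<in>UNIV. c (b i) *s b i) = 0"
        by (simp only: vec.scale_left_diff_distrib sum_subtractf)
      then have "(\<Sum>x\<in>range b. c x *s x) = 0" using b(1) by (simp add: sum.reindex)
      then have "c (b k) = 0"
        by (intro vec.independentD[OF b(2), of "range b" c "b k"]) simp_all
      then show ?thesis using \<theta>(2) b(1) by (simp add: c_def pair_diff_left)
    qed
    then have "u (b i) *s b i \<in> vec.span (b ` {i. wt i = w})" for i
      by (cases "wt i = w") (simp_all add: vec.span_zero vec.span_scale vec.span_base)
    then show "v \<in> vec.span (b ` {i. wt i = w})"
      unfolding vu by (intro vec.span_sum)
  qed
qed

lemma det_mat_add_diagm: "det (mat z + diagm (\<chi> i. d i)) = (\<Prod>i\<in>UNIV. z + d i)"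
  by (subst det_diagonal) (simp_all add: mat_def diagm_def)

lemma det_conj:
  fixes P :: "complex^'d^'d"
  assumes "invertible P"
  shows "det (mat z + P ** D ** matrix_inv P) = det (mat z + D)"
proof -
  have "P ** (mat z + D) ** matrix_inv P = mat z ** (P ** matrix_inv P) + P ** D ** matrix_inv P"
    by (simp add: matrix_mult_bilinear mat_commute[symmetric] matrix_mul_assoc)
  then have "mat z + P ** D ** matrix_inv P = P ** (mat z + D) ** matrix_inv P"
    by (simp add: matrix_inv_mult[OF assms])
  moreover have "det P * det (matrix_inv P) = 1"
    using det_mul[of P "matrix_inv P"] by (simp add: matrix_inv_mult[OF assms])
  ultimately show ?thesis by (simp add: det_mul mult_ac)
qed

lemma char_det_weight_basis:
  fixes \<phi> :: "complex^'n^'n \<Rightarrow> complex^'d^'d" and b :: "'d \<Rightarrow> complex^'d"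
  assumes b: "vec.span (range b) = UNIV" and wt: "\<And>i. b i \<in> weight_space \<phi> (wt i)"
    and \<theta>: "(\<Sum>i\<in>UNIV. \<theta>$i) = 0"
  shows "det (mat z + \<phi> (diagm \<theta>)) = (\<Prod>i\<in>UNIV. z + pair (wt i) \<theta>)"
proof -
  define P :: "complex^'d^'d" where "P = (\<chi> k i. b i $ k)"
  have "columns P = range b"
    by (auto simp: columns_def column_def P_def vec_lambda_eta)
  then have "\<exists>B. P ** B = mat 1" using b matrix_right_invertible_span_columns[of P] by simp
  then have inv: "invertible P" using matrix_left_right_inverse unfolding invertible_def by blast
  have "\<phi> (diagm \<theta>) ** P = P ** diagm (\<chi> i. pair (wt i) \<theta>)"
  proof -
    have "(\<phi> (diagm \<theta>) ** P) $ k $ i = (\<phi> (diagm \<theta>) *v b i) $ k" for k i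
      by (simp add: P_def matrix_matrix_mult_def matrix_vector_mult_def)
    moreover have "\<phi> (diagm \<theta>) *v b i = pair (wt i) \<theta> *s b i" for i
      using wt \<theta> by (simp add: weight_space_def)
    ultimately show ?thesis by (simp add: vec_eq_iff mult_diagm_entry) (simp add: P_def mult.commute)
  qed
  then have "\<phi> (diagm \<theta>) = P ** diagm (\<chi> i. pair (wt i) \<theta>) ** matrix_inv P"
    by (metis inv matrix_inv_mult(1) matrix_mul_assoc matrix_mul_rid)
  then show ?thesis by (simp add: det_conj[OF inv] det_mat_add_diagm)
qed

text \<open>The list of weights with multiplicity, together with all that is needed later once the
  basis itself is forgotten.\<close>

definition weight_family :: "(complex^'n^'n \<Rightarrow> complex^'d^'d) \<Rightarrow> ('d \<Rightarrow> complex^'n) \<Rightarrow> bool" where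
  "weight_family \<phi> wt \<longleftrightarrow> (\<forall>i. (\<Sum>k\<in>UNIV. wt i $ k) = 0) \<and>
     (\<forall>z \<theta>. (\<Sum>k\<in>UNIV. \<theta>$k) = 0 \<longrightarrow> det (mat z + \<phi> (diagm \<theta>)) = (\<Prod>i\<in>UNIV. z + pair (wt i) \<theta>)) \<and>
     (\<forall>w. (\<Sum>k\<in>UNIV. w$k) = 0 \<longrightarrow> wmult \<phi> w = card {i. wt i = w}) \<and>
     weights \<phi> = range wt"

lemma weight_family_exists:
  fixes \<phi> :: "complex^'n^'n \<Rightarrow> complex^'d^'d"
  assumes irr: "irreducible_rep \<phi>" and lam: "(\<Sum>k\<in>UNIV. lam$k) = 0"
    and v0: "v0 \<in> weight_space \<phi> lam" "v0 \<noteq> 0"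
  obtains wt where "weight_family \<phi> wt" "\<And>i k. (wt i - lam)$k \<in> \<int>"
proof -
  \<comment> \<open>The coset of \<open>lam\<close> modulo the root lattice, which consists of the
    integer vectors with sum 0. It is closed under adding roots, and membership yields the
    integrality claim.\<close>
  define R where "R = {w. (\<Sum>k\<in>UNIV. w$k) = 0 \<and> (\<forall>k. (w - lam)$k \<in> \<int>)}"
  have R: "w + (axis i 1 - axis j 1) \<in> R" if "w \<in> R" for w i j
  proof -
    have "(\<Sum>k\<in>UNIV. (w + (axis i 1 - axis j 1))$k) = 0"
      using that by (simp add: R_def sum.distrib sum_subtractf axis_def)
    moreover have "(w + (axis i 1 - axis j 1) - lam)$k \<in> \<int>" for k
    proof -
      have "(w + (axis i 1 - axis j 1) - lam)$k = (w - lam)$k + (axis i 1 $ k - axis j 1 $ k)" by simp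
      also have "\<dots> \<in> \<int>" using that by (intro Ints_add Ints_diff) (auto simp: R_def axis_def)
      finally show ?thesis .
    qed
    ultimately show ?thesis by (simp add: R_def)
  qed
  have "lam \<in> R" using lam by (simp add: R_def)
  then have "vec.span (\<Union>w\<in>R. weight_space \<phi> w) = UNIV"
    using span_weight_spaces[OF irr _ v0] R by blast
  then obtain b :: "'d \<Rightarrow> complex^'d" and wt :: "'d \<Rightarrow> complex^'n" where
    b: "inj b" "vec.independent (range b)" "vec.span (range b) = UNIV"
    and wt: "\<And>i. wt i \<in> R" "\<And>i. b i \<in> weight_space \<phi> (wt i)"
    using weight_vector_basis by blast
  have s0: "(\<Sum>k\<in>UNIV. wt i $ k) = 0" for i using wt(1) by (simp add: R_def)
  note ws = weight_space_basis_span[OF b wt(2) s0]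
  have "wmult \<phi> w = card {i. wt i = w}" if "(\<Sum>k\<in>UNIV. w$k) = 0" for w
  proof -
    have "vec.independent (b ` {i. wt i = w})" using b(2) by (rule vec.independent_mono) auto
    then have "vec.dim (vec.span (b ` {i. wt i = w})) = card (b ` {i. wt i = w})"
      by (rule vec.dim_span_eq_card_independent)
    also have "\<dots> = card {i. wt i = w}" using b(1) by (intro card_image) (auto simp: inj_def inj_on_def)
    finally show ?thesis by (simp add: wmult_def cdim_def ws[OF that])
  qed
  moreover have "weights \<phi> = range wt"
  proof
    show "weights \<phi> \<subseteq> range wt"
    proof
      fix w assume "w \<in> weights \<phi>"
      then have "vec.span (b ` {i. wt i = w}) \<noteq> {0}" using ws[of w] by (auto simp: weights_def)
      then have "{i. wt i = w} \<noteq> {}" by (metis image_empty vec.span_empty)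
      then show "w \<in> range wt" by auto
    qed
    have "b i \<noteq> 0" for i using b(2) vec.dependent_zero[of "range b"] by (metis rangeI)
    then show "range wt \<subseteq> weights \<phi>" using wt(2) s0 by (auto simp: weights_def)
  qed
  ultimately have "weight_family \<phi> wt"
    unfolding weight_family_def using s0 char_det_weight_basis[OF b(3) wt(2)] by blast
  moreover have "(wt i - lam)$k \<in> \<int>" for i k using wt(1) by (simp add: R_def)
  ultimately show ?thesis using that by blast
qed

section \<open>Weyl symmetry of the multiplicities\<close>

text \<open>Both products are the same polynomial in \<open>z\<close>, and the number of indices
  with value \<open>x\<close> is the multiplicity of its root \<open>-x\<close>.\<close>

lemma card_roots_eq:
  fixes a c :: "'i::finite \<Rightarrow> complex"
  assumes "\<And>z. (\<Prod>i\<in>UNIV. z + a i) = (\<Prod>i\<in>UNIV. z + c i)"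
  shows "card {i. a i = x} = card {i. c i = x}"
proof -
  have eq: "(\<Prod>i\<in>UNIV. [:a i, 1:]) = (\<Prod>i\<in>UNIV. [:c i, 1:])"
    by (rule poly_ext) (use assms in \<open>simp add: poly_prod add.commute\<close>)
  have "count (proots (\<Prod>i\<in>UNIV. [:e i, 1:])) (- x) = card {i. e i = x}" for e :: "'i \<Rightarrow> complex"
  proof -
    have "count (proots (\<Prod>i\<in>UNIV. [:e i, 1:])) (- x) = (\<Sum>i\<in>UNIV. count {#- e i#} (- x))"
      by (subst proots_prod) (simp_all add: count_sum)
    also have "\<dots> = (\<Sum>i\<in>UNIV. if e i = x then 1 else 0)" by (rule sum.cong) auto
    also have "\<dots> = card {i. e i = x}" by (simp flip: sum.inter_filter)
    finally show ?thesis .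
  qed
  then show ?thesis using eq by metis
qed

text \<open>Conjugation by a permutation matrix permutes a diagonal matrix, so the weights and the
  permuted weights give the same characteristic determinant. At a generic point equal roots mean
  equal weights, and the multiplicities can be compared.\<close>

lemma card_weight_permute:
  fixes \<phi> :: "complex^'n^'n \<Rightarrow> complex^'d^'d"
  assumes rep: "is_rep \<phi>" and wf: "weight_family \<phi> wt" and \<sigma>: "\<sigma> permutes (UNIV :: 'n set)"
    and w: "(\<Sum>k\<in>UNIV. w$k) = 0"
  shows "card {i. wt i = (\<chi> k. w$\<sigma> k)} = card {i. wt i = w}"
proof -
  define wt' where "wt' i = (\<chi> k. wt i $ inv \<sigma> k)" for i
  \<comment> \<open>All vectors that have to be told apart by their values at a single
    point.\<close>
  define X where "X = insert w (range wt \<union> range wt')"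
  have s0: "(\<Sum>k\<in>UNIV. wt i $ k) = 0" for i using wf by (simp add: weight_family_def)
  have "(\<Sum>k\<in>UNIV. wt' i $ k) = 0" for i
    using s0[of i] sum.permute[OF permutes_inv[OF \<sigma>], of "\<lambda>k. wt i $ k"] by (simp add: wt'_def comp_def)
  then have "finite X" "\<And>u. u \<in> X \<Longrightarrow> (\<Sum>k\<in>UNIV. u$k) = 0" using s0 w by (auto simp: X_def)
  then obtain \<theta> where \<theta>: "(\<Sum>k\<in>UNIV. \<theta>$k) = 0" "inj_on (\<lambda>u. pair u \<theta>) X"
    by (rule generic_separating)
  have \<theta>\<sigma>: "(\<Sum>k\<in>UNIV. (\<chi> k. \<theta>$\<sigma> k)$k) = 0"
    using \<theta>(1) sum.permute[OF \<sigma>, of "\<lambda>k. \<theta>$k"] by (simp add: comp_def)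
  have "(\<Prod>i\<in>UNIV. z + pair (wt' i) \<theta>) = (\<Prod>i\<in>UNIV. z + pair (wt i) \<theta>)" for z
  proof -
    have "pair (wt' i) \<theta> = pair (wt i) (\<chi> k. \<theta>$\<sigma> k)" for i
      using pair_permute[OF \<sigma>, of "wt' i" \<theta>] \<sigma> by (simp add: wt'_def permutes_inverses)
    then have "(\<Prod>i\<in>UNIV. z + pair (wt' i) \<theta>) = det (mat z + \<phi> (diagm (\<chi> k. \<theta>$\<sigma> k)))"
      using wf \<theta>\<sigma> by (simp add: weight_family_def)
    also have "\<dots> = det (mat z + \<phi> (diagm \<theta>))"
      using char_det_conj_invariant[OF rep invertible_perm_mat[OF \<sigma>], of "diagm \<theta>" z] \<theta>(1)
      by (simp add: perm_mat_conj[OF \<sigma>] diagm_in_sl)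
    also have "\<dots> = (\<Prod>i\<in>UNIV. z + pair (wt i) \<theta>)" using wf \<theta>(1) by (simp add: weight_family_def)
    finally show ?thesis .
  qed
  then have "card {i. pair (wt' i) \<theta> = pair w \<theta>} = card {i. pair (wt i) \<theta> = pair w \<theta>}"
    by (rule card_roots_eq)
  moreover have "pair (wt i) \<theta> = pair w \<theta> \<longleftrightarrow> wt i = w" "pair (wt' i) \<theta> = pair w \<theta> \<longleftrightarrow> wt' i = w" for i
    using inj_on_eq_iff[OF \<theta>(2), of "wt i" w] inj_on_eq_iff[OF \<theta>(2), of "wt' i" w] by (simp_all add: X_def)
  moreover have "wt' i = w \<longleftrightarrow> wt i = (\<chi> k. w$\<sigma> k)" for i
  proof
    assume "wt' i = w"
    then have "w = (\<chi> k. wt i $ inv \<sigma> k)" by (simp add: wt'_def)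
    then show "wt i = (\<chi> k. w$\<sigma> k)" using \<sigma> by (simp add: vec_eq_iff permutes_inverses)
  next
    assume "wt i = (\<chi> k. w$\<sigma> k)"
    then show "wt' i = w" using \<sigma> by (simp add: wt'_def vec_eq_iff permutes_inverses)
  qed
  ultimately show ?thesis by simp
qed

section \<open>Dominant representatives of orbits\<close>

lemma sort_permutation:
  fixes f :: "'n::{finite,linorder} \<Rightarrow> real"
  obtains \<sigma> where "\<sigma> permutes (UNIV :: 'n set)" "\<And>i j. i < j \<Longrightarrow> f (\<sigma> j) \<le> f (\<sigma> i)"
proof -
  define xs where "xs = sorted_list_of_set (UNIV :: 'n set)"
  define ys where "ys = sort_key (\<lambda>i. - f i) xs"
  have xs: "distinct xs" "set xs = UNIV" "sorted xs" by (auto simp: xs_def)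
  have ys: "distinct ys" "set ys = UNIV" "length ys = length xs" "sorted (map (\<lambda>i. - f i) ys)"
    using xs by (auto simp: ys_def)
  have bx: "bij_betw ((!) xs) {..<length xs} UNIV" and bY: "bij_betw ((!) ys) {..<length xs} UNIV"
    using xs ys by (auto intro!: bij_betw_nth)
  \<comment> \<open>\<open>k i\<close> is the rank of \<open>i\<close> in the order of the index
    type; the permutation sends \<open>i\<close> to the element of that rank by decreasing
    \<open>f\<close>.\<close>
  define k where "k = inv_into {..<length xs} ((!) xs)"
  have bk: "bij_betw k UNIV {..<length xs}" unfolding k_def by (rule bij_betw_inv_into[OF bx])
  have k: "k i < length xs" "xs ! k i = i" for i
    using bk bx by (auto simp: k_def bij_betw_def f_inv_into_f)
  define \<sigma> where "\<sigma> = (!) ys \<circ> k"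
  have "bij \<sigma>" unfolding \<sigma>_def by (rule bij_betw_trans[OF bk bY])
  then have "\<sigma> permutes UNIV" by (auto intro: bij_imp_permutes)
  moreover have "f (\<sigma> j) \<le> f (\<sigma> i)" if "i < j" for i j
  proof -
    have "k i \<le> k j"
    proof (rule ccontr)
      assume "\<not> k i \<le> k j"
      then have "xs ! k j \<le> xs ! k i" using xs(3) k(1) by (intro sorted_nth_mono) auto
      then show False using k(2) that by simp
    qed
    then have "map (\<lambda>i. - f i) ys ! k i \<le> map (\<lambda>i. - f i) ys ! k j"
      using ys(3,4) k(1) by (intro sorted_nth_mono) auto
    then show ?thesis using k(1) ys(3) by (simp add: \<sigma>_def)
  qed
  ultimately show ?thesis using that by blast
qed

text \<open>Dominance speaks of consecutive indices only; larger differences are split at an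
  intermediate index.\<close>

lemma dominant_diff:
  fixes w :: "('n::{finite,linorder}) cvec"
  assumes "dominant w"
  shows "i < j \<Longrightarrow> w$i - w$j \<in> \<nat>"
proof (induction "card {i<..<j}" arbitrary: i j rule: less_induct)
  case less
  show ?case
  proof (cases "\<exists>k. i < k \<and> k < j")
    case False
    then show ?thesis using assms less.prems unfolding dominant_def by blast
  next
    case True
    then obtain k where k: "i < k" "k < j" by blast
    have "card {i<..<k} < card {i<..<j}" "card {k<..<j} < card {i<..<j}"
      using k by (auto intro!: psubset_card_mono)
    then have "(w$i - w$k) + (w$k - w$j) \<in> \<nat>" using less.hyps k by (intro Nats_add) auto
    then show ?thesis by simp
  qed
qed

text \<open>Only the differences of entries are integers, since the normalization to sum 0 can make
  the entries themselves fractional. Integer differences are determined by real parts, so sorting by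
  real part suffices.\<close>

lemma dominant_in_orbit:
  fixes w :: "('n::{finite,linorder}) cvec"
  assumes "\<And>i j. w$i - w$j \<in> \<int>"
  shows "\<exists>\<mu>\<in>orbit w. dominant \<mu>"
proof -
  obtain \<sigma> where \<sigma>: "\<sigma> permutes (UNIV :: 'n set)" "\<And>i j. i < j \<Longrightarrow> Re (w$\<sigma> j) \<le> Re (w$\<sigma> i)"
    using sort_permutation[of "\<lambda>i. Re (w$i)"] by blast
  have "dominant (\<chi> i. w$\<sigma> i)"
    unfolding dominant_def
  proof (intro allI impI)
    fix i j :: 'n assume "i < j \<and> \<not> (\<exists>k>i. k < j)"
    then have ge: "Re (w$\<sigma> j) \<le> Re (w$\<sigma> i)" using \<sigma>(2) by blast
    obtain m where m: "w$\<sigma> i - w$\<sigma> j = of_int m" using assms[of "\<sigma> i" "\<sigma> j"] by (auto elim: Ints_cases)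
    then have "0 \<le> m" using ge by (metis Re_complex_of_real diff_ge_0_iff_ge minus_complex.simps(1) of_int_0_le_iff of_real_of_int_eq)
    then have "w$\<sigma> i - w$\<sigma> j = of_nat (nat m)" using m by simp
    then show "(\<chi> i. w$\<sigma> i)$i - (\<chi> i. w$\<sigma> i)$j \<in> \<nat>" by simp
  qed
  then show ?thesis using \<sigma>(1) by (auto simp: orbit_def)
qed

text \<open>The real parts of both vectors are decreasing arrangements of the same multiset, hence
  equal. The imaginary parts are constant across indices, because natural numbers are real.\<close>

lemma dominant_orbit_unique:
  fixes \<mu> :: "('n::{finite,linorder}) cvec"
  assumes "dominant \<mu>" "dominant \<mu>'" "\<mu>' \<in> orbit \<mu>"
  shows "\<mu>' = \<mu>"
proof -
  obtain \<sigma> where \<sigma>: "\<sigma> permutes (UNIV :: 'n set)" "\<mu>' = (\<chi> i. \<mu>$\<sigma> i)"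
    using assms(3) by (auto simp: orbit_def)
  define xs where "xs = sorted_list_of_set (UNIV :: 'n set)"
  have xs: "distinct xs" "set xs = UNIV" "sorted_wrt (<) xs" by (auto simp: xs_def)
  have sorted: "sorted (map (\<lambda>i. - Re (w$i)) xs)" if "dominant w" for w :: "'n cvec"
    unfolding sorted_map
  proof (rule sorted_wrt_mono_rel[OF _ xs(3)])
    fix i j :: 'n assume "i < j"
    then have "w$i - w$j \<in> \<nat>" using dominant_diff[OF that] by blast
    then obtain n where "w$i - w$j = of_nat n" by (rule Nats_cases)
    from arg_cong[OF this, of Re] show "- Re (w$i) \<le> - Re (w$j)" by simp
  qed
  have "mset (map (\<lambda>i. - Re (\<mu>'$i)) xs) = image_mset (\<lambda>i. - Re (\<mu>$i)) (image_mset \<sigma> (mset_set UNIV))"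
    using mset_set_set[OF xs(1)] xs(2) \<sigma>(2) by (simp add: multiset.map_comp comp_def)
  also have "image_mset \<sigma> (mset_set UNIV) = mset_set UNIV"
    using \<sigma>(1) by (simp add: image_mset_mset_set permutes_inj permutes_image)
  also have "image_mset (\<lambda>i. - Re (\<mu>$i)) (mset_set UNIV) = mset (map (\<lambda>i. - Re (\<mu>$i)) xs)"
    using mset_set_set[OF xs(1)] xs(2) by simp
  finally have "map (\<lambda>i. - Re (\<mu>'$i)) xs = map (\<lambda>i. - Re (\<mu>$i)) xs"
    using sorted[OF assms(1)] sorted[OF assms(2)] by (metis properties_for_sort)
  then have Re: "Re (\<mu>'$i) = Re (\<mu>$i)" for i using xs(2) by (auto simp: map_eq_conv)
  have "Im (\<mu>$i) = Im (\<mu>$j)" if "i < j" for i j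
    using dominant_diff[OF assms(1) that] by (auto elim!: Nats_cases simp: complex_eq_iff)
  then have "Im (\<mu>$i) = Im (\<mu>$j)" for i j by (metis linorder_cases)
  then show ?thesis using Re \<sigma>(2) by (simp add: vec_eq_iff complex_eq_iff)
qed

lemma orbit_sym: "\<nu> \<in> orbit w \<Longrightarrow> w \<in> orbit \<nu>"
proof -
  assume "\<nu> \<in> orbit w"
  then obtain \<sigma> where \<sigma>: "\<sigma> permutes UNIV" "\<nu> = (\<chi> i. w$\<sigma> i)" by (auto simp: orbit_def)
  then have "w = (\<chi> i. \<nu>$inv \<sigma> i)" by (simp add: permutes_inverses vec_eq_iff)
  then show ?thesis using permutes_inv[OF \<sigma>(1)] unfolding orbit_def by blast
qed

lemma orbit_trans: "\<nu> \<in> orbit w \<Longrightarrow> w \<in> orbit u \<Longrightarrow> \<nu> \<in> orbit u"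
  unfolding orbit_def[of w] using orbit_permute by blast

theorem theorem3p12:
  fixes \<phi> :: "complex^('n::{finite,linorder})^('n::{finite,linorder}) \<Rightarrow> complex^('d::finite)^('d::finite)"
    and lam :: "complex^('n::{finite,linorder})"
  assumes "CARD('n) \<ge> 2"
    and "irreducible_rep \<phi>"
    and "has_highest_weight \<phi> lam"
  shows "f_phi \<phi> = (\<Prod>\<mu>\<in>dominant_weights \<phi>. (orbital_factor \<mu>) ^ (wmult \<phi> \<mu>))
         \<and> (\<forall>\<mu>\<in>dominant_weights \<phi>. irreducible (orbital_factor \<mu>)
                \<and> total_degree (orbital_factor \<mu>) = card (orbit \<mu>))"
proof (intro conjI ballI irreducible_orbital_factor total_degree_orbital_factor)
  have rep: "is_rep \<phi>" using assms(2) by (simp add: irreducible_rep_def)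
  obtain v0 where lam: "(\<Sum>i\<in>UNIV. lam$i) = 0" "v0 \<noteq> 0" "v0 \<in> weight_space \<phi> lam"
    using assms(3) by (auto simp: has_highest_weight_def)
  obtain wt where wf: "weight_family \<phi> wt" and int: "\<And>i k. (wt i - lam)$k \<in> \<int>"
    using weight_family_exists[OF assms(2) lam(1,3,2)] by blast
  have s0: "(\<Sum>k\<in>UNIV. wt i $ k) = 0" for i using wf by (simp add: weight_family_def)
  have wts: "weights \<phi> = range wt" using wf by (simp add: weight_family_def)
  have mult: "wmult \<phi> w = card {i. wt i = w}" if "(\<Sum>k\<in>UNIV. w$k) = 0" for w
    using wf that by (simp add: weight_family_def)
  have perm: "wmult \<phi> \<nu> = wmult \<phi> w" if w: "(\<Sum>k\<in>UNIV. w$k) = 0" "\<nu> \<in> orbit w" for w \<nu>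
  proof -
    obtain \<sigma> where "\<sigma> permutes UNIV" "\<nu> = (\<chi> k. w$\<sigma> k)" using w(2) by (auto simp: orbit_def)
    then show ?thesis
      using card_weight_permute[OF rep wf _ w(1)] mult w(1) sum_orbit[OF w(2)] by simp
  qed
  have weight_iff: "w \<in> weights \<phi> \<longleftrightarrow> 0 < wmult \<phi> w" if "(\<Sum>k\<in>UNIV. w$k) = 0" for w
    using mult[OF that] by (auto simp: wts card_gt_0_iff)
  have orbit_weights: "\<nu> \<in> weights \<phi>" if "w \<in> weights \<phi>" "\<nu> \<in> orbit w" for w \<nu>
  proof -
    have "(\<Sum>k\<in>UNIV. w$k) = 0" using that(1) by (simp add: weights_def)
    then show ?thesis
      using that weight_iff[of w] weight_iff[of \<nu>] perm[of w \<nu>] sum_orbit[OF that(2)] by simp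
  qed

  have lam_weight: "lam \<in> weights \<phi>" using lam by (auto simp: weights_def)
  \<comment> \<open>The transposed vector is again a weight, so it differs from \<open>lam\<close>
    by integers. Its difference at \<open>j\<close> is exactly \<open>lam$i - lam$j\<close>.\<close>
  have lam_int: "lam$i - lam$j \<in> \<int>" for i j
  proof -
    have "(\<chi> k. lam $ Transposition.transpose i j k) \<in> orbit lam"
      using permutes_swap_id[of i UNIV j] by (auto simp: orbit_def)
    then obtain m where m: "(\<chi> k. lam $ Transposition.transpose i j k) = wt m"
      using orbit_weights[OF lam_weight] wts by blast
    have "lam$i - lam$j = (wt m - lam)$j" by (simp add: m[symmetric])
    then show ?thesis using int by simp
  qed
  have "wt m $ i - wt m $ j \<in> \<int>" for m i j
  proof -
    have "wt m $ i - wt m $ j = (wt m - lam)$i - (wt m - lam)$j + (lam$i - lam$j)" by simp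
    then show ?thesis using int lam_int by (metis Ints_add Ints_diff)
  qed
  then have ex_dom: "\<exists>\<mu>\<in>orbit w. dominant \<mu>" if "w \<in> weights \<phi>" for w
    using that wts by (intro dominant_in_orbit) auto
  \<comment> \<open>Together with \<open>disj\<close> this partitions the weights into orbits of
    dominant weights, along which the product over all weights is regrouped.\<close>
  have weights_Un: "weights \<phi> = (\<Union>\<mu>\<in>dominant_weights \<phi>. orbit \<mu>)"
    using ex_dom orbit_weights orbit_sym unfolding dominant_weights_def by blast
  have disj: "orbit \<mu> \<inter> orbit \<mu>' = {}"
    if "\<mu> \<in> dominant_weights \<phi>" "\<mu>' \<in> dominant_weights \<phi>" "\<mu> \<noteq> \<mu>'" for \<mu> \<mu>'
    using that dominant_orbit_unique[of \<mu> \<mu>'] orbit_sym orbit_trans unfolding dominant_weights_def by blast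
  have fin: "finite (dominant_weights \<phi>)"
    by (rule finite_subset[of _ "weights \<phi>"]) (auto simp: dominant_weights_def wts)

  have diag: "det (mat z + \<phi> (diagm \<theta>)) =
      (\<Prod>\<mu>\<in>dominant_weights \<phi>. (\<Prod>\<nu>\<in>orbit \<mu>. z + pair \<nu> \<theta>) ^ wmult \<phi> \<mu>)"
    if "(\<Sum>i\<in>UNIV. \<theta>$i) = 0" for z \<theta>
  proof -
    have "det (mat z + \<phi> (diagm \<theta>)) = (\<Prod>i\<in>UNIV. z + pair (wt i) \<theta>)"
      using wf that by (simp add: weight_family_def)
    \<comment> \<open>Equal weights are collected first, so that their number becomes the
      exponent.\<close>
    also have "\<dots> = (\<Prod>w\<in>range wt. \<Prod>i\<in>{i \<in> UNIV. wt i = w}. z + pair (wt i) \<theta>)"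
      by (rule prod.group[symmetric]) auto
    also have "\<dots> = (\<Prod>w\<in>weights \<phi>. (z + pair w \<theta>) ^ wmult \<phi> w)"
      unfolding wts by (rule prod.cong) (auto simp: mult s0)
    also have "\<dots> = (\<Prod>\<mu>\<in>dominant_weights \<phi>. \<Prod>w\<in>orbit \<mu>. (z + pair w \<theta>) ^ wmult \<phi> w)"
      unfolding weights_Un using fin disj by (intro prod.UNION_disjoint) (auto simp: finite_orbit)
    also have "\<dots> = (\<Prod>\<mu>\<in>dominant_weights \<phi>. (\<Prod>\<nu>\<in>orbit \<mu>. z + pair \<nu> \<theta>) ^ wmult \<phi> \<mu>)"
    proof (rule prod.cong[OF refl])
      fix \<mu> assume "\<mu> \<in> dominant_weights \<phi>"
      then have "(\<Sum>k\<in>UNIV. \<mu>$k) = 0" by (simp add: dominant_weights_def weights_def)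
      then have "(\<Prod>w\<in>orbit \<mu>. (z + pair w \<theta>) ^ wmult \<phi> w) = (\<Prod>w\<in>orbit \<mu>. (z + pair w \<theta>) ^ wmult \<phi> \<mu>)"
        by (intro prod.cong refl) (simp add: perm)
      then show "(\<Prod>w\<in>orbit \<mu>. (z + pair w \<theta>) ^ wmult \<phi> w) = (\<Prod>\<nu>\<in>orbit \<mu>. z + pair \<nu> \<theta>) ^ wmult \<phi> \<mu>"
        by (simp add: prod_power_distrib)
    qed
    finally show ?thesis .
  qed

  show "f_phi \<phi> = (\<Prod>\<mu>\<in>dominant_weights \<phi>. (orbital_factor \<mu>) ^ (wmult \<phi> \<mu>))"
  proof (rule f_phi_eqI[OF rep])
    show "pvars (\<Prod>\<mu>\<in>dominant_weights \<phi>. (orbital_factor \<mu>) ^ (wmult \<phi> \<mu>)) \<subseteq> valid_vars"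
      by (intro pvars_prod order.trans[OF pvars_power orbital_factor_spec(1)])
    fix z and L :: "'n cmat" and \<theta>
    assume L: "L \<in> sl" "diagonalizable L \<theta>"
    then obtain P where P: "invertible P" "L = P ** diagm \<theta> ** matrix_inv P"
      by (auto simp: diagonalizable_def)
    then have \<theta>: "(\<Sum>i\<in>UNIV. \<theta>$i) = 0" using L(1) by (simp add: sl_eq_trace trace_conj trace_diagm)
    then have "det (mat z + \<phi> L) = det (mat z + \<phi> (diagm \<theta>))"
      unfolding P(2) by (intro char_det_conj_invariant[OF rep P(1)]) (simp add: diagm_in_sl)
    then show "peval (\<Prod>\<mu>\<in>dominant_weights \<phi>. (orbital_factor \<mu>) ^ (wmult \<phi> \<mu>)) (assign z L) = det (mat z + \<phi> L)"
      by (simp add: diag[OF \<theta>] peval_prod peval_power orbital_factor_spec(2)[OF L])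
  qed
qed

end
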